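(* Let $L>0$ and $\varepsilon\ge0$, and let $n_{cr}=n_{cr}(\varepsilon)$ be the largest $n$ for which $\frac1\varepsilon>4\lambda_n$ (for $\varepsilon=0$ the inequality holds for all $n$ and $n_{cr}=\infty$). Assume that $$\sup_{N\le n_{cr}}\{\lambda_{N+1}-\lambda_N\}<2L$$ and, in addition, $L>\lambda_1$. Then there exists a smooth nonlinearity $F:H\to H$ with $F(0)=0$, globally Lipschitz with Lipschitz constant $L$, such that the equation $$\varepsilon\,\partial_t^2u+\partial_tu+Au=F(u)$$ does not possess any finite-dimensional normally hyperbolic inertial manifold.
   Context: $H$ is an (infinite-dimensional) Hilbert space; $A:D(A)\to H$ is a positive self-adjoint operator with compact inverse, eigenvalues $\lambda_1\le\lambda_2\le\cdots$ and complete orthonormal eigenvectors $\{e_n\}$; $P_Nu=\sum_{n=1}^N(u,e_n)e_n$; $H^s=D(A^{s/2})$, $\|u\|_{H^s}^2=\sum_n\lambda_n^s(u,e_n)^2$. Phase space: $\mathcal E_\varepsilon=H^1\times H$ for $\varepsilon\neq0$ and $\mathcal E_0=H^1\times H^{-1}$, with norm $\|\xi_u\|^2_{\mathcal E_\varepsilon}=\varepsilon\|\partial_tu\|_H^2+\|\partial_tu\|_{H^{-1}}^2+\|u\|_{H^1}^2$, $\xi_u=(u,\partial_tu)$. For $\varepsilon=0$ the phase space is identified with the invariant set $\{(u,v)\in\mathcal E_0:\ v=F(u)-Au\}$. The semigroup is $S_\varepsilon(t)\xi_0=\xi_u(t)$, $t\ge0$, where $u$ solves the equation with $\xi_u(0)=\xi_0$;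 $D_\xi S_\varepsilon(t)$ denotes its Fréchet derivative at $\xi$. Inertial manifold (IM): an $N$-dimensional IM is a Lipschitz submanifold $\mathcal M\subset\mathcal E_\varepsilon$ with base $P_NH$ such that (1) $S_\varepsilon(t)\mathcal M=\mathcal M$ for $t\ge0$; (2) there are positive constants $C,\theta$ such that for every $\xi_0\in\mathcal E_\varepsilon$ there is $\bar\xi_0\in\mathcal M$ with $\|S_\varepsilon(t)\xi_0-S_\varepsilon(t)\bar\xi_0\|_{\mathcal E_\varepsilon}\le C\|\xi_0\|_{\mathcal E_\varepsilon}e^{-\theta t}$. Normal hyperbolicity (stable, absolute): let $S_\varepsilon(t)\in C^{1+\beta}(\mathcal E_\varepsilon,\mathcal E_\varepsilon)$ and let $\mathcal M_\varepsilon$ be an $N$-dimensional $C^{1+\beta}$ submanifold invariant under $S_\varepsilon(t)$ (for some $\beta>0$), with tangent spaces $\mathcal T_\xi\mathcal M_\varepsilon\sim\mathbb R^N$. It is normally hyperbolic if there is a vector bundle $\mathcal N\mathcal M_\varepsilon$ over $\mathcal M_\varepsilon$ with fibers $\mathcal N_\xi\mathcal M_\varepsilon$ of codimension $N$ in $\mathcal E_\varepsilon$ such that: (1) $D_\xi S_\varepsilon(t)\mathcal N_\xi\mathcal M_\varepsilon\subset\mathcal N_{S_\varepsilon(t)\xi}\mathcal M_\varepsilon$, $t\ge0$; (2) for every $\xi\in\mathcal M_\varepsilon$, $\mathcal E_\varepsilon=\mathcal T_\xi\mathcal M_\varepsilon\oplus\mathcal N_\xi\mathcal M_\varepsilon$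 and the corresponding projectors $P_\xi,Q_\xi$ satisfy $\|P_\xi\|+\|Q_\xi\|\le C$ with $C$ independent of $\xi$; (3) there are positive constants $C$, $\theta$ and $\kappa<\theta$ such that for every $\xi\in\mathcal M_\varepsilon$ and $t\ge0$, $\|D_\xi S_\varepsilon(t)\eta\|_{\mathcal E_\varepsilon}\le Ce^{-(\theta+\kappa)t}\|\eta\|_{\mathcal E_\varepsilon}$ for $\eta\in\mathcal N_\xi\mathcal M_\varepsilon$ and $\|D_\xi S_\varepsilon(t)\eta\|_{\mathcal E_\varepsilon}\ge C^{-1}e^{-(\theta-\kappa)t}\|\eta\|_{\mathcal E_\varepsilon}$ for $\eta\in\mathcal T_\xi\mathcal M_\varepsilon$. A normally hyperbolic IM is an IM which is normally hyperbolic in this sense. *)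

theory Defs
  imports "HOL-Analysis.Analysis" "HOL-Library.Function_Algebras"
begin

section \<open>The operator and its eigenbasis\<close>

definition self_adjoint_op :: "'a::real_inner set \<Rightarrow> ('a \<Rightarrow> 'a) \<Rightarrow> bool" where
  "self_adjoint_op domA A \<longleftrightarrow>
     subspace domA \<and> closure domA = UNIV \<and>
     (\<forall>x\<in>domA. \<forall>y\<in>domA. A (x + y) = A x + A y) \<and>
     (\<forall>c. \<forall>x\<in>domA. A (c *\<^sub>R x) = c *\<^sub>R A x) \<and>
     (\<forall>x\<in>domA. \<forall>y\<in>domA. A x \<bullet> y = x \<bullet> A y) \<and>
     {y. \<exists>z. \<forall>x\<in>domA. A x \<bullet> y = x \<bullet> z} = domA"  \<comment> \<open>\<open>D(A\<^sup>*) = D(A)\<close>\<close>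

definition positive_op :: "'a::real_inner set \<Rightarrow> ('a \<Rightarrow> 'a) \<Rightarrow> bool" where
  "positive_op domA A \<longleftrightarrow> (\<forall>x\<in>domA. x \<noteq> 0 \<longrightarrow> A x \<bullet> x > 0)"

definition compact_inverse :: "'a::real_inner set \<Rightarrow> ('a \<Rightarrow> 'a) \<Rightarrow> bool" where
  "compact_inverse domA A \<longleftrightarrow>
     bij_betw A domA UNIV \<and> compact (closure (inv_into domA A ` cball 0 1))"

text \<open>Indices are shifted: \<open>lam n\<close>, \<open>e n\<close> are the eigenvalue \<open>\<lambda>\<close> and eigenvector
  with number \<open>n + 1\<close>.\<close>

definition eigenbasis ::
    "'a::real_inner set \<Rightarrow> ('a \<Rightarrow> 'a) \<Rightarrow> (nat \<Rightarrow> real) \<Rightarrow> (nat \<Rightarrow> 'a) \<Rightarrow> bool" where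
  "eigenbasis domA A lam e \<longleftrightarrow>
     mono lam \<and>
     (\<forall>n. e n \<in> domA \<and> A (e n) = lam n *\<^sub>R e n) \<and>
     (\<forall>m n. e m \<bullet> e n = (if m = n then 1 else 0)) \<and>
     closure (span (range e)) = UNIV"

text \<open>The number of the last eigenvalue below \<open>1 / (4\<epsilon>)\<close>; it is \<open>0\<close> if there is none and
  \<open>\<infinity>\<close> if \<open>\<epsilon> = 0\<close>. The case \<open>\<epsilon> = 0\<close> is separate because \<open>1 / 0 = 0\<close> in HOL.\<close>

definition n_cr :: "real \<Rightarrow> (nat \<Rightarrow> real) \<Rightarrow> enat" where
  "n_cr eps lam = Sup {enat (Suc k) | k. eps = 0 \<or> 1 / eps > 4 * lam k}"

section \<open>Smooth maps\<close>

text \<open>Infinite Frechet differentiability: \<open>D k x [v\<^sub>1, \<dots>, v\<^sub>k]\<close> is the \<open>k\<close>-th derivative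
  at \<open>x\<close>, a bounded \<open>k\<close>-linear map, and \<open>D (Suc k)\<close> is the Frechet derivative of \<open>D k\<close>
  with respect to the norm of bounded \<open>k\<close>-linear maps.\<close>

definition smooth_map :: "('a::real_normed_vector \<Rightarrow> 'b::real_normed_vector) \<Rightarrow> bool" where
  "smooth_map f \<longleftrightarrow> (\<exists>D :: nat \<Rightarrow> 'a \<Rightarrow> 'a list \<Rightarrow> 'b.
     (\<forall>x. D 0 x [] = f x) \<and>
     (\<forall>k x vs i. length vs = k \<and> i < k \<longrightarrow> linear (\<lambda>h. D k x (vs[i := h]))) \<and>
     (\<forall>k x. \<exists>K. \<forall>vs. length vs = k \<longrightarrow> norm (D k x vs) \<le> K * prod_list (map norm vs)) \<and>
     (\<forall>k x. \<forall>r>0. \<exists>d>0. \<forall>h. norm h < d \<longrightarrow>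
        (\<forall>vs. length vs = k \<longrightarrow>
           norm (D k (x + h) vs - D k x vs - D (Suc k) x (h # vs))
             \<le> r * norm h * prod_list (map norm vs))))"

section \<open>Differentiability in explicitly given normed spaces\<close>

instantiation "fun" :: (type, real_vector) real_vector
begin
definition scaleR_fun :: "real \<Rightarrow> ('a \<Rightarrow> 'b) \<Rightarrow> 'a \<Rightarrow> 'b" where
  "scaleR_fun r f = (\<lambda>x. r *\<^sub>R f x)"
instance
  by standard (simp_all add: scaleR_fun_def plus_fun_def fun_eq_iff scaleR_add_left scaleR_add_right)
end

text \<open>The Sobolev scale depends on the eigenvalues, so its members cannot be types. Here a
  normed space is a linear subspace \<open>V\<close> of a type together with a function \<open>nV\<close> that is a
  norm on \<open>V\<close>. Linear maps on \<open>V\<close> are represented by total linear maps; only their values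
  on \<open>V\<close> matter.\<close>

definition op_norm ::
    "'v::real_vector set \<Rightarrow> ('v \<Rightarrow> real) \<Rightarrow> ('w::real_vector \<Rightarrow> real) \<Rightarrow> ('v \<Rightarrow> 'w) \<Rightarrow> ereal" where
  "op_norm V nV nW f = (SUP h\<in>V. ereal (nW (f h) / nV h))"

text \<open>Frechet derivative at \<open>x\<close> within \<open>X \<subseteq> V\<close>.\<close>

definition has_frechet ::
    "'v::real_vector set \<Rightarrow> ('v \<Rightarrow> real) \<Rightarrow> 'w::real_vector set \<Rightarrow> ('w \<Rightarrow> real) \<Rightarrow>
     'v set \<Rightarrow> ('v \<Rightarrow> 'w) \<Rightarrow> ('v \<Rightarrow> 'w) \<Rightarrow> 'v \<Rightarrow> bool" where
  "has_frechet V nV W nW X f f' x \<longleftrightarrow>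
     linear f' \<and> f' ` V \<subseteq> W \<and> op_norm V nV nW f' < \<infinity> \<and>
     (\<forall>r>0. \<exists>d>0. \<forall>y\<in>X. nV (y - x) < d \<longrightarrow>
        nW (f y - f x - f' (y - x)) \<le> r * nV (y - x))"

text \<open>\<open>f \<in> C\<^sup>1\<^sup>+\<^sup>\<beta>(X, W)\<close> with derivative \<open>f'\<close>; the Hoelder condition is local.\<close>

definition C1_holder ::
    "real \<Rightarrow> 'v::real_vector set \<Rightarrow> ('v \<Rightarrow> real) \<Rightarrow> 'w::real_vector set \<Rightarrow> ('w \<Rightarrow> real) \<Rightarrow>
     'v set \<Rightarrow> ('v \<Rightarrow> 'w) \<Rightarrow> ('v \<Rightarrow> 'v \<Rightarrow> 'w) \<Rightarrow> bool" where
  "C1_holder \<beta> V nV W nW X f f' \<longleftrightarrow>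
     (\<forall>x\<in>X. has_frechet V nV W nW X f (f' x) x) \<and>
     (\<forall>x\<in>X. \<exists>K. \<exists>r>0. \<forall>y\<in>X. \<forall>z\<in>X. nV (y - x) < r \<and> nV (z - x) < r \<longrightarrow>
        op_norm V nV nW (\<lambda>h. f' y h - f' z h) \<le> ereal (K * nV (y - z) powr \<beta>))"

definition direct_sum :: "'v::real_vector set \<Rightarrow> 'v set \<Rightarrow> 'v set \<Rightarrow> bool" where
  "direct_sum V S T \<longleftrightarrow>
     subspace S \<and> subspace T \<and> S \<inter> T = {0} \<and> V = {a + b | a b. a \<in> S \<and> b \<in> T}"

definition projector :: "'v::real_vector set \<Rightarrow> 'v set \<Rightarrow> 'v \<Rightarrow> 'v" where
  "projector S T x = (THE a. a \<in> S \<and> x - a \<in> T)"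

definition has_codim :: "nat \<Rightarrow> 'v::real_vector set \<Rightarrow> 'v set \<Rightarrow> bool" where
  "has_codim N V T \<longleftrightarrow>
     (\<exists>B. finite B \<and> independent B \<and> card B = N \<and> direct_sum V (span B) T)"

section \<open>The Sobolev scale\<close>

text \<open>For \<open>s < 0\<close> the space \<open>H\<^sup>s\<close> is larger than \<open>H\<close>. Elements of \<open>H\<^sup>s\<close> are represented by their
  coefficient sequences \<open>((u, e\<^sub>n))\<^sub>n\<close>, and \<open>u \<in> H\<close> is embedded as \<open>coeffs e u\<close>.\<close>

definition coeffs :: "(nat \<Rightarrow> 'a::real_inner) \<Rightarrow> 'a \<Rightarrow> nat \<Rightarrow> real" where
  "coeffs e u = (\<lambda>n. u \<bullet> e n)"

definition Hs :: "(nat \<Rightarrow> real) \<Rightarrow> real \<Rightarrow> (nat \<Rightarrow> real) set" where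
  "Hs lam s = {c. summable (\<lambda>n. lam n powr s * (c n)\<^sup>2)}"

definition Hs_norm :: "(nat \<Rightarrow> real) \<Rightarrow> real \<Rightarrow> (nat \<Rightarrow> real) \<Rightarrow> real" where
  "Hs_norm lam s c = sqrt (\<Sum>n. lam n powr s * (c n)\<^sup>2)"

text \<open>\<open>d\<close> is the derivative at \<open>t \<ge> 0\<close>, one-sided for \<open>t = 0\<close>, of the \<open>H\<^sup>s\<close>-valued function \<open>f\<close>.\<close>

definition has_Hs_derivative ::
    "(nat \<Rightarrow> real) \<Rightarrow> real \<Rightarrow> (real \<Rightarrow> nat \<Rightarrow> real) \<Rightarrow> (nat \<Rightarrow> real) \<Rightarrow> real \<Rightarrow> bool" where
  "has_Hs_derivative lam s f d t \<longleftrightarrow>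
     d \<in> Hs lam s \<and> (\<forall>r\<ge>0. f r \<in> Hs lam s) \<and>
     ((\<lambda>r. Hs_norm lam s (inverse (r - t) *\<^sub>R (f r - f t) - d)) \<longlongrightarrow> 0) (at t within {0..})"

definition P\<^sub>N :: "(nat \<Rightarrow> 'a::real_inner) \<Rightarrow> nat \<Rightarrow> 'a \<Rightarrow> 'a" where
  "P\<^sub>N e N u = (\<Sum>n<N. (u \<bullet> e n) *\<^sub>R e n)"

text \<open>The extension \<open>H\<^sup>1 \<rightarrow> H\<^sup>-\<^sup>1\<close> of the operator \<open>A\<close>.\<close>

definition A_ext :: "(nat \<Rightarrow> real) \<Rightarrow> (nat \<Rightarrow> 'a::real_inner) \<Rightarrow> 'a \<Rightarrow> nat \<Rightarrow> real" where
  "A_ext lam e u = (\<lambda>n. lam n * (u \<bullet> e n))"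

section \<open>The equation and its inertial manifolds\<close>

type_synonym 'a state = "'a \<times> (nat \<Rightarrow> real)"

locale damped_wave =
  fixes eps :: real
    and lam :: "nat \<Rightarrow> real"
    and e :: "nat \<Rightarrow> 'a::{real_inner, complete_space}"
    and F :: "'a \<Rightarrow> 'a"
begin

definition E_space :: "'a state set" where
  "E_space = {(u, v). coeffs e u \<in> Hs lam 1 \<and> v \<in> Hs lam (if eps = 0 then -1 else 0)}"

definition E_norm :: "'a state \<Rightarrow> real" where
  "E_norm = (\<lambda>(u, v). sqrt (eps * (Hs_norm lam 0 v)\<^sup>2 + (Hs_norm lam (-1) v)\<^sup>2
                             + (Hs_norm lam 1 (coeffs e u))\<^sup>2))"

text \<open>The phase space: all of \<open>E_space\<close> for \<open>\<epsilon> \<noteq> 0\<close>, and the invariant graph in it for \<open>\<epsilon> = 0\<close>.\<close>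

definition phase :: "'a state set" where
  "phase = (if eps = 0 then {(u, v) \<in> E_space. v = coeffs e (F u) - A_ext lam e u} else E_space)"

text \<open>\<open>\<xi> = (u, \<partial>\<^sub>tu)\<close> is continuous in \<open>E_norm\<close>, and the equation holds in \<open>H\<^sup>-\<^sup>1\<close> for every
  \<open>t \<ge> 0\<close>; \<open>w\<close> stands for \<open>\<partial>\<^sub>t\<^sup>2u(t)\<close>, which is not required to exist for \<open>\<epsilon> = 0\<close>.\<close>

definition solution :: "(real \<Rightarrow> 'a state) \<Rightarrow> bool" where
  "solution \<xi> \<longleftrightarrow>
     (\<forall>t\<ge>0. \<xi> t \<in> phase) \<and>
     (\<forall>t\<ge>0. ((\<lambda>r. E_norm (\<xi> r - \<xi> t)) \<longlongrightarrow> 0) (at t within {0..})) \<and>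
     (\<forall>t\<ge>0. has_Hs_derivative lam (-1) (\<lambda>r. coeffs e (fst (\<xi> r))) (snd (\<xi> t)) t) \<and>
     (\<forall>t\<ge>0. \<exists>w. (eps \<noteq> 0 \<longrightarrow> has_Hs_derivative lam (-1) (\<lambda>r. snd (\<xi> r)) w t) \<and>
        eps *\<^sub>R w + snd (\<xi> t) + A_ext lam e (fst (\<xi> t)) = coeffs e (F (fst (\<xi> t))))"

definition S :: "real \<Rightarrow> 'a state \<Rightarrow> 'a state" where
  "S t \<xi>\<^sub>0 = (THE \<zeta>. \<exists>\<xi>. solution \<xi> \<and> \<xi> 0 = \<xi>\<^sub>0 \<and> \<xi> t = \<zeta>)"

text \<open>A Lipschitz submanifold with base \<open>P\<^sub>N H\<close> is the graph of a Lipschitz map over \<open>P\<^sub>N H\<close>: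
  the point over \<open>p\<close> has a first component \<open>u\<close> with \<open>P\<^sub>N u = p\<close>.\<close>

definition lipschitz_submanifold :: "nat \<Rightarrow> 'a state set \<Rightarrow> bool" where
  "lipschitz_submanifold N M \<longleftrightarrow>
     (\<exists>\<Phi> K. M = \<Phi> ` range (P\<^sub>N e N) \<and> M \<subseteq> phase \<and>
        (\<forall>p\<in>range (P\<^sub>N e N). P\<^sub>N e N (fst (\<Phi> p)) = p) \<and>
        (\<forall>p\<in>range (P\<^sub>N e N). \<forall>q\<in>range (P\<^sub>N e N). E_norm (\<Phi> p - \<Phi> q) \<le> K * norm (p - q)))"

definition inertial_manifold :: "nat \<Rightarrow> 'a state set \<Rightarrow> bool" where
  "inertial_manifold N M \<longleftrightarrow>
     lipschitz_submanifold N M \<and>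
     (\<forall>t\<ge>0. S t ` M = M) \<and>
     (\<exists>C>0. \<exists>\<theta>>0. \<forall>\<xi>\<^sub>0\<in>phase. \<exists>\<xi>\<^sub>1\<in>M. \<forall>t\<ge>0.
        E_norm (S t \<xi>\<^sub>0 - S t \<xi>\<^sub>1) \<le> C * E_norm \<xi>\<^sub>0 * exp (- \<theta> * t))"

text \<open>Near each point, \<open>M\<close> is a \<open>C\<^sup>1\<^sup>+\<^sup>\<beta>\<close> embedded image of a relatively open subset of
  \<open>P\<^sub>N H \<cong> \<real>\<^sup>N\<close>.\<close>

definition C1_submanifold :: "real \<Rightarrow> nat \<Rightarrow> 'a state set \<Rightarrow> bool" where
  "C1_submanifold \<beta> N M \<longleftrightarrow>
     M \<subseteq> phase \<and>
     (\<forall>\<xi>\<in>M. \<exists>U \<phi> \<phi>' r.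
        openin (top_of_set (range (P\<^sub>N e N))) U \<and> r > 0 \<and>
        C1_holder \<beta> (range (P\<^sub>N e N)) norm E_space E_norm U \<phi> \<phi>' \<and>
        (\<forall>p\<in>U. inj_on (\<phi>' p) (range (P\<^sub>N e N))) \<and>
        bij_betw \<phi> U {\<zeta>\<in>M. E_norm (\<zeta> - \<xi>) < r} \<and>
        (\<forall>p\<in>U. \<forall>s>0. \<exists>d>0. \<forall>q\<in>U. E_norm (\<phi> q - \<phi> p) < d \<longrightarrow> norm (q - p) < s))"

text \<open>Velocities at \<open>\<xi>\<close> of curves in \<open>X\<close>. This is used for submanifolds and for the phase space
  itself, whose tangent space is \<open>E_space\<close> for \<open>\<epsilon> \<noteq> 0\<close> and is
  \<open>{(h, F'(u)h - Ah). h \<in> H\<^sup>1}\<close> at \<open>(u, F(u) - Au)\<close> for \<open>\<epsilon> = 0\<close>.\<close>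

definition tangent :: "'a state set \<Rightarrow> 'a state \<Rightarrow> 'a state set" where
  "tangent X \<xi> = {\<eta>\<in>E_space. \<exists>\<gamma>. \<gamma> 0 = \<xi> \<and> (\<exists>d>0. \<forall>s. \<bar>s\<bar> < d \<longrightarrow> \<gamma> s \<in> X) \<and>
     ((\<lambda>s. E_norm (inverse s *\<^sub>R (\<gamma> s - \<xi>) - \<eta>)) \<longlongrightarrow> 0) (at (0::real))}"

text \<open>A subbundle over \<open>M\<close> of the tangent bundle of the phase space, with local trivialisations
  \<open>\<tau>\<close> that are continuous in the operator norm.\<close>

definition vector_subbundle :: "'a state set \<Rightarrow> ('a state \<Rightarrow> 'a state set) \<Rightarrow> bool" where
  "vector_subbundle M \<N> \<longleftrightarrow>
     (\<forall>\<xi>\<in>M. subspace (\<N> \<xi>) \<and> \<N> \<xi> \<subseteq> tangent phase \<xi>) \<and>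
     (\<forall>\<xi>\<in>M. \<exists>r>0. \<exists>\<tau>.
        (\<forall>\<zeta>\<in>M. E_norm (\<zeta> - \<xi>) < r \<longrightarrow>
           linear (\<tau> \<zeta>) \<and> bij_betw (\<tau> \<zeta>) (\<N> \<xi>) (\<N> \<zeta>) \<and>
           op_norm (\<N> \<xi>) E_norm E_norm (\<tau> \<zeta>) < \<infinity> \<and>
           op_norm (\<N> \<zeta>) E_norm E_norm (inv_into (\<N> \<xi>) (\<tau> \<zeta>)) < \<infinity>) \<and>
        (\<forall>\<zeta>\<in>M. E_norm (\<zeta> - \<xi>) < r \<longrightarrow>
           (\<forall>s>0. \<exists>d>0. \<forall>\<zeta>'\<in>M. E_norm (\<zeta>' - \<xi>) < r \<and> E_norm (\<zeta>' - \<zeta>) < d \<longrightarrow>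
              op_norm (\<N> \<xi>) E_norm E_norm (\<lambda>h. \<tau> \<zeta>' h - \<tau> \<zeta> h) < ereal s)))"

text \<open>\<open>DS t \<xi>\<close> is the Frechet derivative of \<open>S t\<close> at \<open>\<xi>\<close> within the phase space; its values
  on \<open>tangent phase \<xi>\<close>, the only ones used below, are uniquely determined.\<close>

definition normally_hyperbolic :: "nat \<Rightarrow> 'a state set \<Rightarrow> bool" where
  "normally_hyperbolic N M \<longleftrightarrow>
     (\<exists>\<beta> DS \<N>. 0 < \<beta> \<and> \<beta> \<le> 1 \<and>
        (\<forall>t\<ge>0. C1_holder \<beta> E_space E_norm E_space E_norm phase (S t) (DS t)) \<and>
        C1_submanifold \<beta> N M \<and>
        (\<forall>t\<ge>0. S t ` M = M) \<and>
        vector_subbundle M \<N> \<and>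
        (\<forall>\<xi>\<in>M. has_codim N (tangent phase \<xi>) (\<N> \<xi>)) \<and>
        (\<forall>\<xi>\<in>M. \<forall>t\<ge>0. DS t \<xi> ` \<N> \<xi> \<subseteq> \<N> (S t \<xi>)) \<and>
        (\<forall>\<xi>\<in>M. direct_sum (tangent phase \<xi>) (tangent M \<xi>) (\<N> \<xi>)) \<and>
        (\<exists>C::real. \<forall>\<xi>\<in>M.
           op_norm (tangent phase \<xi>) E_norm E_norm (projector (tangent M \<xi>) (\<N> \<xi>)) +
           op_norm (tangent phase \<xi>) E_norm E_norm (projector (\<N> \<xi>) (tangent M \<xi>)) \<le> ereal C) \<and>
        (\<exists>C>0. \<exists>\<theta>>0. \<exists>\<kappa>>0. \<kappa> < \<theta> \<and>
           (\<forall>\<xi>\<in>M. \<forall>t\<ge>0.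
              (\<forall>\<eta>\<in>\<N> \<xi>. E_norm (DS t \<xi> \<eta>) \<le> C * exp (- (\<theta> + \<kappa>) * t) * E_norm \<eta>) \<and>
              (\<forall>\<eta>\<in>tangent M \<xi>.
                 E_norm (DS t \<xi> \<eta>) \<ge> inverse C * exp (- (\<theta> - \<kappa>) * t) * E_norm \<eta>))))"

definition normally_hyperbolic_IM :: "nat \<Rightarrow> 'a state set \<Rightarrow> bool" where
  "normally_hyperbolic_IM N M \<longleftrightarrow> inertial_manifold N M \<and> normally_hyperbolic N M"

end

end

theory Submission
  imports Defs "HOL-Computational_Algebra.Polynomial"
begin

text \<open>
  Normal hyperbolicity is required with the same pair of rates \<open>\<theta> - \<kappa>\<close>, \<open>\<theta> + \<kappa>\<close> along the whole
  manifold. An inertial manifold contains every equilibrium, so at each equilibrium the linearised flow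
  splits into exactly \<open>N\<close> slow directions, with decay rates at most \<open>\<theta> - \<kappa>\<close>, and directions of decay
  rate at least \<open>\<theta> + \<kappa>\<close>. It is enough to find a nonlinearity for which two equilibria make
  incompatible demands on \<open>\<theta>\<close>.

  The linearised equation of the mode with number \<open>n\<close> is \<open>\<epsilon> y'' + y' + \<nu> y = 0\<close>, where \<open>\<nu>\<close> is the
  eigenvalue \<open>\<lambda>\<close> of that mode minus the slope of \<open>F\<close>. Let \<open>l < L\<close> be at least half of every
  spectral gap in question. The nonlinearity built below has derivative \<open>- l\<close> at the equilibrium \<open>0\<close>,
  where \<open>\<nu> = \<lambda> + l\<close>. For each \<open>N\<close> it also has an equilibrium \<open>B e\<^sub>0\<close>, far out on the first axis,
  where \<open>\<nu> = max (\<lambda> - l) 0\<close> for the modes \<open>1, \<dots>, N\<close> (counted from \<open>0\<close>) and \<open>\<nu> = 0\<close> for the mode \<open>0\<close>.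
  The first equilibrium forces the slow decay rate belonging to \<open>\<lambda>\<^sub>N\<^sub>-\<^sub>1 + l\<close> to be at most
  \<open>\<theta> - \<kappa>\<close>, because otherwise fewer than \<open>N\<close> directions could be slow. The second one forces the slow
  decay rate belonging to the exponent of one of the modes up to \<open>N\<close> to be at least \<open>\<theta> + \<kappa>\<close>, because
  otherwise \<open>N + 1\<close> directions would be slow. Slow rates increase with \<open>\<nu>\<close>, so
  \<open>\<lambda>\<^sub>N - l > \<lambda>\<^sub>N\<^sub>-\<^sub>1 + l\<close>, which contradicts the choice of \<open>l\<close>. If \<open>\<lambda>\<^sub>N\<^sub>-\<^sub>1 + l\<close> lies beyond
  \<open>1 / (4 \<epsilon>)\<close>, all modes from there on oscillate with the common rate \<open>1 / (2 \<epsilon>)\<close>; a splitting that puts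
  them among the slow directions has infinitely many of these, and a splitting that puts them among the
  fast ones has at most \<open>N - 1\<close> slow directions. For \<open>N = 0\<close> the neutral
  mode \<open>0\<close> at the second equilibrium is one slow direction too many. This argument is
  \<open>no_normally_hyperbolic_IM\<close>.

  The nonlinearity is a bounded diagonal operator minus two sums of ridge functions
  \<open>u \<mapsto> \<Sum>\<^sub>n w\<^sub>n \<tau>(\<langle>u, a\<^sub>n\<rangle>) e\<^sub>n\<close>, where \<open>\<tau>\<close> is a smooth odd function that is the identity near \<open>0\<close>
  and constant far out. Such sums are smooth because square summable sequences are bounded. The
  directions \<open>a\<^sub>n = e\<^sub>n \<plusminus> \<eta>\<^sub>n e\<^sub>0\<close> with small \<open>\<eta>\<^sub>n\<close> let a large first coordinate
  saturate \<open>\<tau>\<close> in any prescribed finite number of modes, while the Lipschitz constant hardly changes.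
  At both kinds of equilibria \<open>F\<close> is exactly affine along each axis in question. Hence the solutions that
  start near the equilibrium on such an axis are known explicitly, and with the uniqueness of solutions
  the derivative of the semigroup is known on single modes (\<open>derivative_on_mode\<close>). Comparing the growth of
  these explicit solutions with \<open>\<theta> - \<kappa>\<close> and \<open>\<theta> + \<kappa>\<close> places each mode in one of the two subspaces
  (\<open>in_Q_if_decay\<close>, \<open>in_T_if_backward_bound\<close>), and dimensions are then counted
  (\<open>too_many_slow_modes\<close>, \<open>too_many_fast_modes\<close>).\<close>

section \<open>Orthonormal expansions\<close>

locale hilbert_basis =
  fixes e :: "nat \<Rightarrow> 'a::{real_inner, complete_space}"
  assumes orth: "e m \<bullet> e n = (if m = n then 1 else 0)"
    and dense: "closure (span (range e)) = UNIV"
begin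

definition synth :: "(nat \<Rightarrow> real) \<Rightarrow> 'a" where
  "synth c = (\<Sum>n. c n *\<^sub>R e n)"

lemma norm_e [simp]: "norm (e n) = 1"
  by (simp add: norm_eq_sqrt_inner orth)

lemma inner_finite_sum: "(\<Sum>i\<in>I. c i *\<^sub>R e i) \<bullet> e n = (if n \<in> I then c n else 0)" if "finite I"
  using that by (simp add: inner_sum_left orth if_distrib sum.delta cong: if_cong)

lemma norm_finite_sum: "(norm (\<Sum>i\<in>I. c i *\<^sub>R e i))\<^sup>2 = (\<Sum>i\<in>I. (c i)\<^sup>2)" if "finite I"
proof -
  have "(norm (\<Sum>i\<in>I. c i *\<^sub>R e i))\<^sup>2 = (\<Sum>j\<in>I. c j * ((\<Sum>i\<in>I. c i *\<^sub>R e i) \<bullet> e j))"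
    by (simp add: power2_norm_eq_inner inner_sum_right)
  also have "\<dots> = (\<Sum>j\<in>I. (c j)\<^sup>2)"
    using that by (intro sum.cong) (simp_all add: inner_finite_sum power2_eq_square)
  finally show ?thesis .
qed

lemma P_diff: "P\<^sub>N e m (u - v) = P\<^sub>N e m u - P\<^sub>N e m v"
  by (simp add: P\<^sub>N_def inner_diff_left scaleR_diff_left sum_subtractf)

lemma P_add: "P\<^sub>N e m (u + v) = P\<^sub>N e m u + P\<^sub>N e m v"
  by (simp add: P\<^sub>N_def inner_add_left scaleR_add_left sum.distrib)

lemma P_scaleR: "P\<^sub>N e m (c *\<^sub>R u) = c *\<^sub>R P\<^sub>N e m u"
  by (simp add: P\<^sub>N_def scaleR_sum_right)

lemma P_error: "(norm (u - P\<^sub>N e m u))\<^sup>2 = (norm u)\<^sup>2 - (\<Sum>n<m. (u \<bullet> e n)\<^sup>2)"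
proof -
  have 1: "P\<^sub>N e m u \<bullet> P\<^sub>N e m u = (\<Sum>n<m. (u \<bullet> e n)\<^sup>2)"
    using norm_finite_sum[of "{..<m}" "\<lambda>n. u \<bullet> e n"]
    by (simp add: P\<^sub>N_def power2_norm_eq_inner)
  have 2: "u \<bullet> P\<^sub>N e m u = (\<Sum>n<m. (u \<bullet> e n)\<^sup>2)"
    by (simp add: P\<^sub>N_def inner_sum_right power2_eq_square)
  show ?thesis
    using 1 2 by (simp add: power2_norm_eq_inner inner_diff_left inner_diff_right inner_commute)
qed

text \<open>The set of vectors with this property contains the basis and is closed under linear combinations.\<close>

lemma P_eventually_id:
  assumes "w \<in> span (range e)"
  shows "\<exists>m. \<forall>k\<ge>m. P\<^sub>N e k w = w"
  using assms
proof (induction rule: span_induct_alt)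
  case base
  then show ?case by (simp add: P\<^sub>N_def)
next
  case (step c x y)
  then obtain m j where m: "\<forall>k\<ge>m. P\<^sub>N e k y = y" and j: "x = e j" by auto
  have "P\<^sub>N e k (c *\<^sub>R x + y) = c *\<^sub>R x + y" if "k \<ge> max m (Suc j)" for k
  proof -
    have "P\<^sub>N e k (e j) = e j"
      using that by (simp add: P\<^sub>N_def orth if_distrib[of "\<lambda>t. t *\<^sub>R _"] cong: if_cong)
    then show ?thesis using that m j by (simp add: P_add P_scaleR)
  qed
  then show ?case by blast
qed

text \<open>A vector of the dense span near \<open>u\<close> is fixed by all late projections, and \<open>I - P\<^sub>N\<close> does not increase norms.\<close>

lemma P_tendsto: "(\<lambda>m. P\<^sub>N e m u) \<longlonglongrightarrow> u"
proof (rule LIMSEQ_I)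
  fix r :: real assume r: "r > 0"
  have "u \<in> closure (span (range e))" using dense by simp
  then obtain w where w: "w \<in> span (range e)" "dist w u < r"
    using r by (auto simp: closure_approachable)
  obtain m where m: "\<forall>k\<ge>m. P\<^sub>N e k w = w" using P_eventually_id[OF w(1)] by blast
  have "norm (P\<^sub>N e k u - u) < r" if "k \<ge> m" for k
  proof -
    have "norm ((u - w) - P\<^sub>N e k (u - w)) \<le> norm (u - w)"
      by (rule power2_le_imp_le) (auto simp: P_error sum_nonneg)
    moreover have "(u - w) - P\<^sub>N e k (u - w) = u - P\<^sub>N e k u"
      using m that by (simp add: P_diff)
    ultimately show ?thesis using w(2) by (simp add: dist_norm norm_minus_commute)
  qed
  then show "\<exists>no. \<forall>n\<ge>no. norm (P\<^sub>N e n u - u) < r" by blast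
qed

lemma parseval: "(\<lambda>n. (u \<bullet> e n)\<^sup>2) sums (norm u)\<^sup>2"
proof -
  have "(\<lambda>m. (norm u)\<^sup>2 - (norm (u - P\<^sub>N e m u))\<^sup>2) \<longlonglongrightarrow> (norm u)\<^sup>2 - (norm (u - u))\<^sup>2"
    by (intro tendsto_intros P_tendsto)
  then show ?thesis by (simp add: sums_def P_error)
qed

lemma coeff_eqI: "u = v" if "\<And>n. u \<bullet> e n = v \<bullet> e n"
proof -
  have "(\<lambda>n. 0) sums (norm (u - v))\<^sup>2"
    using parseval[of "u - v"] that by (simp add: inner_diff_left)
  then show ?thesis using sums_unique2 sums_zero by fastforce
qed

text \<open>Riesz--Fischer: tails of the series have the norm of tails of \<open>\<Sum>c\<^sub>n\<^sup>2\<close>.\<close>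

lemma synth_sums:
  assumes "summable (\<lambda>n. (c n)\<^sup>2)"
  shows "(\<lambda>n. c n *\<^sub>R e n) sums synth c"
proof -
  have "Cauchy (\<lambda>m. \<Sum>n<m. c n *\<^sub>R e n)"
  proof (rule CauchyI)
    fix r :: real assume r: "r > 0"
    then obtain M where M: "\<And>m n. m \<ge> M \<Longrightarrow> norm (sum (\<lambda>n. (c n)\<^sup>2) {m..<n}) < r\<^sup>2"
      using assms unfolding summable_Cauchy by (meson zero_less_power)
    have *: "norm ((\<Sum>n<a. c n *\<^sub>R e n) - (\<Sum>n<b. c n *\<^sub>R e n)) < r" if "M \<le> b" "b \<le> a" for a b
    proof -
      have "(\<Sum>n<a. c n *\<^sub>R e n) - (\<Sum>n<b. c n *\<^sub>R e n) = (\<Sum>n\<in>{b..<a}. c n *\<^sub>R e n)"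
        using sum_diff_nat_ivl[of 0 b a "\<lambda>n. c n *\<^sub>R e n"] that(2) by (simp add: lessThan_atLeast0)
      then have "(norm ((\<Sum>n<a. c n *\<^sub>R e n) - (\<Sum>n<b. c n *\<^sub>R e n)))\<^sup>2 = (\<Sum>n\<in>{b..<a}. (c n)\<^sup>2)"
        by (simp add: norm_finite_sum)
      also have "\<dots> < r\<^sup>2" using M[OF that(1), of a] by (simp add: abs_le_iff)
      finally show ?thesis using r by (meson less_imp_le power_less_imp_less_base)
    qed
    show "\<exists>M. \<forall>m\<ge>M. \<forall>n\<ge>M. norm ((\<Sum>n<m. c n *\<^sub>R e n) - (\<Sum>n<n. c n *\<^sub>R e n)) < r"
      using * by (metis nle_le norm_minus_commute)
  qed
  then have "summable (\<lambda>n. c n *\<^sub>R e n)"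
    by (simp add: Cauchy_convergent_iff summable_iff_convergent)
  then show ?thesis by (simp add: synth_def summable_sums)
qed

lemma synth_coeff:
  assumes "summable (\<lambda>n. (c n)\<^sup>2)"
  shows "synth c \<bullet> e k = c k"
proof -
  have "(\<lambda>m. (\<Sum>n<m. c n *\<^sub>R e n) \<bullet> e k) \<longlonglongrightarrow> synth c \<bullet> e k"
    using synth_sums[OF assms] by (intro tendsto_intros) (simp add: sums_def)
  moreover have "(\<lambda>m. (\<Sum>n<m. c n *\<^sub>R e n) \<bullet> e k) \<longlonglongrightarrow> c k"
    by (rule tendsto_eventually)
       (auto simp: inner_finite_sum eventually_sequentially intro!: exI[of _ "Suc k"])
  ultimately show ?thesis by (rule LIMSEQ_unique)
qed

lemma norm_synth:
  assumes "summable (\<lambda>n. (c n)\<^sup>2)"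
  shows "(norm (synth c))\<^sup>2 = (\<Sum>n. (c n)\<^sup>2)"
  using parseval[of "synth c"] by (simp add: synth_coeff[OF assms] sums_iff)

lemma summable_coeff: "summable (\<lambda>n. (u \<bullet> e n)\<^sup>2)"
  using parseval sums_iff by blast

lemma summable_square_diff:
  assumes "summable (\<lambda>n. (c n)\<^sup>2)" "summable (\<lambda>n. (d n)\<^sup>2)"
  shows "summable (\<lambda>n. (c n - d n :: real)\<^sup>2)"
proof (rule summable_comparison_test')
  show "summable (\<lambda>n. 2 * (c n)\<^sup>2 + 2 * (d n)\<^sup>2)" by (intro summable_add summable_mult assms)
  fix n show "norm ((c n - d n)\<^sup>2) \<le> 2 * (c n)\<^sup>2 + 2 * (d n)\<^sup>2"
  proof -
    have "(c n - d n)\<^sup>2 = 2 * (c n)\<^sup>2 + 2 * (d n)\<^sup>2 - (c n + d n)\<^sup>2"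
      by (simp add: power2_sum power2_diff)
    then show ?thesis using zero_le_power2[of "c n - d n"] zero_le_power2[of "c n + d n"]
      unfolding real_norm_def by linarith
  qed
qed

lemma synth_diff:
  assumes "summable (\<lambda>n. (c n)\<^sup>2)" "summable (\<lambda>n. (d n)\<^sup>2)"
  shows "synth (\<lambda>n. c n - d n) = synth c - synth d"
  by (rule coeff_eqI) (simp add: synth_coeff assms summable_square_diff inner_diff_left)

end

section \<open>A smooth truncation of the identity of the line\<close>

text \<open>The sequence of all derivatives is carried along explicitly, so that the derivatives of every order of
the functions built from it are available by name.\<close>

definition derivs :: "(nat \<Rightarrow> real \<Rightarrow> real) \<Rightarrow> bool" where
  "derivs D \<longleftrightarrow> (\<forall>k x. (D k has_real_derivative D (Suc k) x) (at x))"

lemma derivs_affine: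
  assumes "derivs D"
  shows "derivs (\<lambda>k x. c ^ k * D k (c * x + d))"
  unfolding derivs_def
proof (intro allI)
  fix k x
  have "(D k has_real_derivative D (Suc k) (c * x + d)) (at (c * x + d))"
    using assms by (simp add: derivs_def)
  then have "((\<lambda>x. D k (c * x + d)) has_real_derivative D (Suc k) (c * x + d) * c) (at x)"
    by (rule DERIV_chain2) (auto intro!: derivative_eq_intros)
  from DERIV_cmult[OF this, of "c ^ k"]
  show "((\<lambda>x. c ^ k * D k (c * x + d)) has_real_derivative c ^ Suc k * D (Suc k) (c * x + d)) (at x)"
    by (simp add: algebra_simps)
qed

lemma derivs_lincomb:
  assumes "derivs D" "derivs E"
  shows "derivs (\<lambda>k x. a * D k x + b * E k x)"
  unfolding derivs_def
proof (intro allI)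
  fix k x
  show "((\<lambda>x. a * D k x + b * E k x) has_real_derivative a * D (Suc k) x + b * E (Suc k) x) (at x)"
    by (rule DERIV_add; rule DERIV_cmult; use assms in \<open>simp add: derivs_def\<close>)
qed

text \<open>\<open>product_derivs D E i j k\<close> is the derivative of order \<open>k\<close> of \<open>D\<^sub>i E\<^sub>j\<close>. Splitting one derivative at a
time avoids the binomial coefficients of the Leibniz rule.\<close>

fun product_derivs :: "(nat \<Rightarrow> real \<Rightarrow> real) \<Rightarrow> (nat \<Rightarrow> real \<Rightarrow> real) \<Rightarrow> nat \<Rightarrow> nat \<Rightarrow> nat \<Rightarrow> real \<Rightarrow> real" where
  "product_derivs D E i j 0 = (\<lambda>x. D i x * E j x)"
| "product_derivs D E i j (Suc k) =
     (\<lambda>x. product_derivs D E (Suc i) j k x + product_derivs D E i (Suc j) k x)"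

lemma derivs_product:
  assumes "derivs D" "derivs E"
  shows "derivs (product_derivs D E i j)"
proof -
  have "(product_derivs D E i j k has_real_derivative product_derivs D E i j (Suc k) x) (at x)" for k x
  proof (induction k arbitrary: i j)
    case 0
    have "(D i has_real_derivative D (Suc i) x) (at x)" "(E j has_real_derivative E (Suc j) x) (at x)"
      using assms by (simp_all add: derivs_def)
    from DERIV_mult[OF this] show ?case by (simp add: add.commute mult.commute)
  next
    case (Suc k)
    show ?case
      using DERIV_add[OF Suc.IH[of "Suc i" j] Suc.IH[of i "Suc j"]] by simp
  qed
  then show ?thesis by (simp add: derivs_def del: product_derivs.simps)
qed

lemma derivs_continuous:
  assumes "derivs D" shows "continuous_on A (D k)"
  using assms unfolding derivs_def by (meson DERIV_continuous_on DERIV_subset subset_UNIV has_field_derivative_at_within)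

lemma derivs_antiderivative:
  assumes "derivs D"
  obtains E where "derivs E" "\<And>k. E (Suc k) = D k"
proof -
  have "\<exists>F. \<forall>x::real. -\<infinity> < ereal x \<longrightarrow> ereal x < \<infinity> \<longrightarrow> (F has_vector_derivative D 0 x) (at x)"
    using derivs_continuous[OF assms, of UNIV 0]
    by (intro einterval_antiderivative) (auto simp: continuous_on_eq_continuous_at)
  then obtain F where F: "\<And>x. (F has_real_derivative D 0 x) (at x)"
    by (auto simp: has_real_derivative_iff_has_vector_derivative)
  have "derivs (case_nat F D)"
    unfolding derivs_def using F assms by (auto simp: derivs_def split: nat.split)
  then show thesis by (rule that) simp
qed

text \<open>For positive \<open>x\<close> the derivative of order \<open>k\<close> of \<open>exp (- 1 / x)\<close> is a polynomial in \<open>1 / x\<close> times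
\<open>exp (- 1 / x)\<close>.\<close>

primrec flat_poly :: "nat \<Rightarrow> real poly" where
  "flat_poly 0 = 1"
| "flat_poly (Suc k) = [:0, 0, 1:] * (flat_poly k - pderiv (flat_poly k))"

definition flat :: "nat \<Rightarrow> real \<Rightarrow> real" where
  "flat k x = (if x \<le> 0 then 0 else poly (flat_poly k) (1 / x) * exp (- (1 / x)))"

lemma poly_exp_tendsto_0: "((\<lambda>z::real. poly p z * exp (- z)) \<longlongrightarrow> 0) at_top"
proof -
  have "((\<lambda>z. \<Sum>i\<le>degree p. coeff p i * (z ^ i / exp z)) \<longlongrightarrow> (\<Sum>i\<le>degree p. coeff p i * 0)) at_top"
    by (intro tendsto_intros tendsto_power_div_exp_0)
  then show ?thesis
    by (simp add: poly_altdef sum_divide_distrib exp_minus divide_inverse sum_distrib_right mult.assoc)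
qed

text \<open>At \<open>0\<close> the difference quotients tend to \<open>0\<close> because \<open>exp (- z)\<close> beats every polynomial in \<open>z = 1 / x\<close>.\<close>

lemma derivs_flat: "derivs flat"
  unfolding derivs_def
proof (intro allI)
  fix k and x :: real
  consider "x < 0" | "x = 0" | "x > 0" by linarith
  then show "(flat k has_real_derivative flat (Suc k) x) (at x)"
  proof cases
    case 1
    have "((\<lambda>x. 0) has_real_derivative 0) (at x)" by simp
    moreover have "eventually (\<lambda>y. 0 = flat k y) (nhds x)"
      using 1 by (auto simp: flat_def eventually_nhds intro!: exI[of _ "{..<0}"])
    ultimately show ?thesis
      using 1 DERIV_cong_ev[of x x "\<lambda>x. 0" "flat k" 0 0] by (simp add: flat_def)
  next
    case 2
    have "((\<lambda>h. (flat k (0 + h) - flat k 0) / h) \<longlongrightarrow> 0) (at_right 0)"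
    proof -
      have "((\<lambda>z. poly ([:0, 1:] * flat_poly k) z * exp (- z)) \<longlongrightarrow> 0) at_top"
        by (rule poly_exp_tendsto_0)
      then have "((\<lambda>h. poly ([:0, 1:] * flat_poly k) (inverse h) * exp (- inverse h)) \<longlongrightarrow> 0) (at_right (0::real))"
        by (rule filterlim_compose[OF _ filterlim_inverse_at_top_right])
      moreover have "eventually (\<lambda>h::real. poly ([:0, 1:] * flat_poly k) (inverse h) * exp (- inverse h)
          = (flat k (0 + h) - flat k 0) / h) (at_right 0)"
        unfolding eventually_at_right_field
        by (intro exI[of _ 1]) (auto simp: flat_def field_simps)
      ultimately show ?thesis by (rule Lim_transform_eventually)
    qed
    moreover have "((\<lambda>h. (flat k (0 + h) - flat k 0) / h) \<longlongrightarrow> 0) (at_left 0)"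
    proof (rule tendsto_eventually)
      show "eventually (\<lambda>h. (flat k (0 + h) - flat k 0) / h = 0) (at_left 0)"
        unfolding eventually_at_left_field
        by (intro exI[of _ "-1"]) (auto simp: flat_def)
    qed
    ultimately have "((\<lambda>h. (flat k (0 + h) - flat k 0) / h) \<longlongrightarrow> 0) (at 0)"
      by (simp add: filterlim_split_at)
    then show ?thesis using 2 by (simp add: DERIV_def flat_def)
  next
    case 3
    have "((\<lambda>x. poly (flat_poly k) (1 / x) * exp (- (1 / x))) has_real_derivative
      (poly (pderiv (flat_poly k)) (1 / x) * (- 1 / x\<^sup>2)) * exp (- (1 / x))
       + poly (flat_poly k) (1 / x) * (exp (- (1 / x)) * (1 / x\<^sup>2))) (at x)"
      using 3 by (auto intro!: derivative_eq_intros DERIV_chain2[OF poly_DERIV] simp: power2_eq_square)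
    moreover have "(poly (pderiv (flat_poly k)) (1 / x) * (- 1 / x\<^sup>2)) * exp (- (1 / x))
       + poly (flat_poly k) (1 / x) * (exp (- (1 / x)) * (1 / x\<^sup>2)) = flat (Suc k) x"
      using 3 by (simp add: flat_def power2_eq_square field_simps)
    moreover have "eventually (\<lambda>y. poly (flat_poly k) (1 / y) * exp (- (1 / y)) = flat k y) (nhds x)"
      using 3 by (auto simp: flat_def eventually_nhds intro!: exI[of _ "{0<..}"])
    ultimately show ?thesis
      using DERIV_cong_ev[of x x "\<lambda>y. poly (flat_poly k) (1 / y) * exp (- (1 / y))" "flat k"] by simp
  qed
qed

text \<open>The normalised antiderivative of a smooth bump with support \<open>[0, 1]\<close>.\<close>

lemma smooth_step:
  obtains D where "derivs D" "\<And>x. x \<le> 0 \<Longrightarrow> D 0 x = 0" "\<And>x. x \<ge> 1 \<Longrightarrow> D 0 x = 1" "mono (D 0)"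
proof -
  define b where "b = product_derivs flat (\<lambda>k x. (-1) ^ k * flat k (-1 * x + 1)) 0 0"
  have b: "derivs b" unfolding b_def by (intro derivs_product derivs_affine derivs_flat)
  have b0: "b 0 x = flat 0 x * flat 0 (1 - x)" for x by (simp add: b_def)
  have b_nonneg: "b 0 x \<ge> 0" for x by (simp add: b0 flat_def)
  have b_pos: "b 0 x > 0" if "0 < x" "x < 1" for x using that by (simp add: b0 flat_def)
  have b_zero: "b 0 x = 0" if "x \<le> 0 \<or> x \<ge> 1" for x using that by (auto simp: b0 flat_def)
  obtain B where B: "derivs B" "\<And>k. B (Suc k) = b k" using derivs_antiderivative[OF b] by blast
  have dB: "(B 0 has_real_derivative b 0 x) (at x)" for x using B by (metis derivs_def)
  have mono: "B 0 x \<le> B 0 y" if "x \<le> y" for x y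
    using that by (rule DERIV_nonneg_imp_nondecreasing) (use dB b_nonneg in blast)
  have less: "B 0 0 < B 0 1"
    by (rule DERIV_pos_imp_increasing_open)
       (use dB b_pos derivs_continuous[OF B(1)] in auto)
  have left: "B 0 x = B 0 0" if "x \<le> 0" for x
  proof (cases "x = 0")
    case False
    show ?thesis
    proof (rule DERIV_isconst_end[of x 0 "B 0", symmetric])
      show "(B 0 has_real_derivative 0) (at y)" if "x < y" "y < 0" for y
        using dB[of y] b_zero[of y] that by simp
    qed (use that False in \<open>auto intro: derivs_continuous[OF B(1)]\<close>)
  qed simp
  have right: "B 0 x = B 0 1" if "x \<ge> 1" for x
  proof (cases "x = 1")
    case False
    show ?thesis
    proof (rule DERIV_isconst_end[of 1 x "B 0"])
      show "(B 0 has_real_derivative 0) (at y)" if "1 < y" "y < x" for y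
        using dB[of y] b_zero[of y] that by simp
    qed (use that False in \<open>auto intro: derivs_continuous[OF B(1)]\<close>)
  qed simp
  define c where "c = 1 / (B 0 1 - B 0 0)"
  define D where "D k x = c * B k x + (- c * B 0 0) * (if k = 0 then 1 else 0)" for k x
  have "derivs (\<lambda>k (x::real). if k = 0 then 1 else 0)" by (simp add: derivs_def)
  then have D: "derivs D" unfolding D_def by (intro derivs_lincomb B)
  have D0: "D 0 x = (B 0 x - B 0 0) / (B 0 1 - B 0 0)" for x
    by (simp add: D_def c_def diff_divide_distrib)
  have mono_D: "mono (D 0)"
    using mono less by (auto simp: D0 mono_def intro!: divide_right_mono)
  show thesis
  proof (rule that[OF D _ _ mono_D])
    show "D 0 x = 0" if "x \<le> 0" for x using left[OF that] by (simp add: D0)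
    show "D 0 x = 1" if "x \<ge> 1" for x using right[OF that] less by (simp add: D0)
  qed
qed

text \<open>The antiderivative of a plateau function, which is a difference of two shifted smooth steps,
symmetrised to become odd. All derivatives vanish outside \<open>[-2, 2]\<close> and are therefore bounded.\<close>

lemma smooth_truncation:
  obtains D c where "derivs D" "\<And>x. \<bar>x\<bar> \<le> 1 \<Longrightarrow> D 0 x = x" "\<And>x. D 0 (- x) = - D 0 x"
    "\<And>x. x \<ge> 2 \<Longrightarrow> D 0 x = c" "\<And>x. 0 \<le> D (Suc 0) x" "\<And>x. D (Suc 0) x \<le> 1"
    "\<And>k. \<exists>K. \<forall>x. \<bar>D (Suc k) x\<bar> \<le> K"
proof -
  obtain st where st: "derivs st" "\<And>x. x \<le> 0 \<Longrightarrow> st 0 x = 0" "\<And>x. x \<ge> 1 \<Longrightarrow> st 0 x = 1" "mono (st 0)"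
    using smooth_step by blast
  have st01: "0 \<le> st 0 x" "st 0 x \<le> 1" for x
    using st(2)[of x] st(3)[of x] monoD[OF st(4), of 0 x] monoD[OF st(4), of x 1] st(2)[of 0] st(3)[of 1]
    by (cases "x \<le> 0"; cases "x \<ge> 1"; simp)+
  define chi where "chi k x = 1 * (1 ^ k * st k (1 * x + 2)) + (-1) * (1 ^ k * st k (1 * x + (-1)))" for k x
  have chi: "derivs chi" unfolding chi_def by (intro derivs_lincomb derivs_affine st)
  have chi0: "chi 0 x = st 0 (x + 2) - st 0 (x - 1)" for x by (simp add: chi_def)
  obtain X where X: "derivs X" "\<And>k. X (Suc k) = chi k" using derivs_antiderivative[OF chi] by blast
  define D where "D k x = (1/2) * X k x + (-1/2) * ((-1) ^ k * X k (-1 * x + 0))" for k x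
  have D: "derivs D" unfolding D_def by (intro derivs_lincomb derivs_affine X)
  have D0: "D 0 x = (X 0 x - X 0 (- x)) / 2" for x by (simp add: D_def)
  have D1: "D (Suc 0) x = (chi 0 x + chi 0 (- x)) / 2" for x
    using X(2)[of 0] by (simp add: D_def)
  have dD: "(D k has_real_derivative D (Suc k) x) (at x)" for k x using D by (simp add: derivs_def)
  have chi01: "0 \<le> chi 0 x" "chi 0 x \<le> 1" for x
    using st01[of "x+2"] st01[of "x-1"] monoD[OF st(4), of "x-1" "x+2"] by (auto simp: chi0)
  have D1_one: "D (Suc 0) x = 1" if "\<bar>x\<bar> \<le> 1" for x
    using that st(2)[of "x - 1"] st(2)[of "- x - 1"] st(3)[of "x + 2"] st(3)[of "- x + 2"]
    by (simp add: D1 chi0 abs_le_iff)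
  have D1_zero: "D (Suc 0) x = 0" if "\<bar>x\<bar> \<ge> 2" for x
  proof -
    have "chi 0 y = 0" if "\<bar>y\<bar> \<ge> 2" for y
    proof (cases "y \<ge> 0")
      case True
      then show ?thesis using that by (simp add: chi0 st(3))
    next
      case False
      then show ?thesis using that by (simp add: chi0 st(2))
    qed
    then show ?thesis using that by (simp add: D1)
  qed
  have id: "D 0 x = x" if "\<bar>x\<bar> \<le> 1" for x
  proof -
    have "(\<lambda>y. D 0 y - y) x = (\<lambda>y. D 0 y - y) 0"
    proof (rule has_derivative_zero_unique[of "{-1..1}" "\<lambda>y. D 0 y - y"])
      show "convex {-1..1::real}" by simp
      fix y :: real assume y: "y \<in> {-1..1}"
      have "((\<lambda>y. D 0 y - y) has_real_derivative D (Suc 0) y - 1) (at y)"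
        using dD[of 0 y] by (auto intro!: derivative_eq_intros)
      then show "((\<lambda>y. D 0 y - y) has_derivative (\<lambda>h. 0)) (at y within {-1..1})"
        using D1_one[of y] y
        by (auto simp: has_field_derivative_def abs_le_iff lambda_zero intro!: has_derivative_at_withinI)
    qed (use that in auto)
    then show ?thesis by (simp add: D0)
  qed
  have const: "D 0 x = D 0 2" if "x \<ge> 2" for x
  proof (cases "x = 2")
    case False
    show ?thesis
    proof (rule DERIV_isconst_end[of 2 x "D 0"])
      show "(D 0 has_real_derivative 0) (at y)" if "2 < y" "y < x" for y
        using dD[of 0 y] D1_zero[of y] that by simp
    qed (use that False in \<open>auto intro: derivs_continuous[OF D]\<close>)
  qed simp
  have out: "D (Suc k) x = 0" if "\<bar>x\<bar> > 2" for k x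
    using that
  proof (induction k arbitrary: x)
    case 0
    then show ?case using D1_zero[of x] by simp
  next
    case (Suc k)
    have ev: "eventually (\<lambda>y. D (Suc k) y = 0) (nhds x)"
      unfolding eventually_nhds
      by (rule exI[of _ "{y. \<bar>y\<bar> > 2}"]) (use Suc in \<open>auto intro!: open_Collect_less continuous_intros\<close>)
    have "((\<lambda>y. 0) has_real_derivative D (Suc (Suc k)) x) (at x)"
      using dD[of "Suc k" x] ev by (simp add: DERIV_cong_ev[OF refl ev refl])
    then show ?case using DERIV_unique DERIV_const by blast
  qed
  have bnd: "\<exists>K. \<forall>x. \<bar>D (Suc k) x\<bar> \<le> K" for k
  proof -
    have "compact (D (Suc k) ` {-2..2})"
      by (intro compact_continuous_image derivs_continuous[OF D]) simp
    then obtain K where K: "\<And>x. x \<in> {-2..2} \<Longrightarrow> \<bar>D (Suc k) x\<bar> \<le> K"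
      by (force dest!: compact_imp_bounded simp: bounded_iff)
    have "\<bar>D (Suc k) x\<bar> \<le> max K 0" for x
      using K[of x] out[of x k] by (cases "\<bar>x\<bar> > 2"; force simp: abs_le_iff)
    then show ?thesis by blast
  qed
  have chi_avg: "0 \<le> chi 0 x + chi 0 (- x)" "chi 0 x + chi 0 (- x) \<le> 2" for x
    using chi01[of x] chi01[of "- x"] by auto
  show thesis
  proof (rule that[OF D id _ const])
    show "D 0 (- x) = - D 0 x" for x using D0[of x] D0[of "- x"] by (simp add: field_simps)
    show "0 \<le> D (Suc 0) x" "D (Suc 0) x \<le> 1" for x unfolding D1 using chi_avg[of x] by auto
  qed (use bnd in auto)
qed

section \<open>Smooth maps between normed spaces\<close>

lemma prod_list_norm_nonneg: "0 \<le> prod_list (map norm vs)"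
  by (induction vs) auto

lemma smooth_map_linear:
  assumes "bounded_linear f"
  shows "smooth_map f"
proof -
  interpret bounded_linear f by fact
  define D where "D k x vs = (if k = 0 then f x else if k = Suc 0 then f (hd vs) else 0)" for k :: nat and x vs
  obtain K where K: "\<And>x. norm (f x) \<le> norm x * K" using bounded by blast
  show ?thesis
    unfolding smooth_map_def
  proof (intro exI[of _ D] conjI allI impI)
    fix x show "D 0 x [] = f x" by (simp add: D_def)
  next
    fix k x and vs :: "'a list" and i assume "length vs = k \<and> i < k"
    then show "linear (\<lambda>h. D k x (vs[i := h]))"
    proof (cases "k = Suc 0")
      case True
      then have "D k x (vs[i := h]) = f h" for h
        using \<open>length vs = k \<and> i < k\<close> by (cases vs) (auto simp: D_def)
      then show ?thesis using linear_axioms by simp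
    next
      case False
      then have "(\<lambda>h. D k x (vs[i := h])) = (\<lambda>h. 0)"
        using \<open>length vs = k \<and> i < k\<close> by (auto simp: D_def)
      then show ?thesis by (simp add: linear_zero)
    qed
  next
    fix k :: nat and x
    show "\<exists>B. \<forall>vs. length vs = k \<longrightarrow> norm (D k x vs) \<le> B * prod_list (map norm vs)"
    proof (cases k)
      case 0
      then show ?thesis by (intro exI[of _ "norm (f x)"]) (simp add: D_def)
    next
      case (Suc j)
      have "norm (D k x vs) \<le> \<bar>K\<bar> * prod_list (map norm vs)" if "length vs = k" for vs
      proof (cases "j = 0")
        case True
        then obtain v where "vs = [v]" using \<open>length vs = k\<close> Suc by (auto simp: length_Suc_conv)
        moreover have "norm v * K \<le> \<bar>K\<bar> * norm v"
          using mult_right_mono[of K "\<bar>K\<bar>" "norm v"] by (simp add: mult.commute)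
        ultimately show ?thesis using K[of v] True Suc by (simp add: D_def)
      next
        case False
        then show ?thesis using Suc by (auto simp: D_def intro!: mult_nonneg_nonneg prod_list_norm_nonneg)
      qed
      then show ?thesis by blast
    qed
  next
    fix k :: nat and x and r :: real assume "r > 0"
    then show "\<exists>d>0. \<forall>h. norm h < d \<longrightarrow> (\<forall>vs. length vs = k \<longrightarrow>
        norm (D k (x + h) vs - D k x vs - D (Suc k) x (h # vs)) \<le> r * norm h * prod_list (map norm vs))"
      by (intro exI[of _ 1]) (auto simp: D_def add intro!: mult_nonneg_nonneg prod_list_norm_nonneg)
  qed
qed

text \<open>The matrix of the definition of smoothness, named to keep the list of higher derivatives in hand.\<close>

definition derivative_tower ::
    "('a::real_normed_vector \<Rightarrow> 'b::real_normed_vector) \<Rightarrow> (nat \<Rightarrow> 'a \<Rightarrow> 'a list \<Rightarrow> 'b) \<Rightarrow> bool" where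
  "derivative_tower f D \<longleftrightarrow> (\<forall>x. D 0 x [] = f x) \<and>
     (\<forall>k x vs i. length vs = k \<and> i < k \<longrightarrow> linear (\<lambda>h. D k x (vs[i := h]))) \<and>
     (\<forall>k x. \<exists>K. \<forall>vs. length vs = k \<longrightarrow> norm (D k x vs) \<le> K * prod_list (map norm vs)) \<and>
     (\<forall>k x. \<forall>r>0. \<exists>d>0. \<forall>h. norm h < d \<longrightarrow>
        (\<forall>vs. length vs = k \<longrightarrow>
           norm (D k (x + h) vs - D k x vs - D (Suc k) x (h # vs))
             \<le> r * norm h * prod_list (map norm vs)))"

lemma smooth_map_iff_tower: "smooth_map f \<longleftrightarrow> (\<exists>D. derivative_tower f D)"
  unfolding smooth_map_def derivative_tower_def by (rule refl)

lemma smooth_map_diff: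
  fixes f g :: "'a::real_normed_vector \<Rightarrow> 'b::real_normed_vector"
  assumes "smooth_map f" "smooth_map g"
  shows "smooth_map (\<lambda>x. f x - g x)"
proof -
  obtain D E where DE: "derivative_tower f D" "derivative_tower g E"
    using assms by (auto simp: smooth_map_iff_tower)
  note D = DE(1)[unfolded derivative_tower_def, THEN conjunct1, rule_format]
    DE(1)[unfolded derivative_tower_def, THEN conjunct2, THEN conjunct1, rule_format]
    DE(1)[unfolded derivative_tower_def, THEN conjunct2, THEN conjunct2, THEN conjunct1, rule_format]
    DE(1)[unfolded derivative_tower_def, THEN conjunct2, THEN conjunct2, THEN conjunct2, rule_format]
  note E = DE(2)[unfolded derivative_tower_def, THEN conjunct1, rule_format]
    DE(2)[unfolded derivative_tower_def, THEN conjunct2, THEN conjunct1, rule_format]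
    DE(2)[unfolded derivative_tower_def, THEN conjunct2, THEN conjunct2, THEN conjunct1, rule_format]
    DE(2)[unfolded derivative_tower_def, THEN conjunct2, THEN conjunct2, THEN conjunct2, rule_format]
  show ?thesis
    unfolding smooth_map_def
  proof (intro exI[of _ "\<lambda>k x vs. D k x vs - E k x vs"] conjI allI impI)
    fix x show "D 0 x [] - E 0 x [] = f x - g x" by (simp add: D E)
  next
    fix k x and vs :: "'a list" and i assume "length vs = k \<and> i < k"
    then show "linear (\<lambda>h. D k x (vs[i := h]) - E k x (vs[i := h]))"
      by (intro linear_compose_sub D E) auto
  next
    fix k x
    obtain K1 K2 where K: "\<And>vs. length vs = k \<Longrightarrow> norm (D k x vs) \<le> K1 * prod_list (map norm vs)"
      "\<And>vs. length vs = k \<Longrightarrow> norm (E k x vs) \<le> K2 * prod_list (map norm vs)"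
      using D(3)[of k x] E(3)[of k x] by metis
    have "norm (D k x vs - E k x vs) \<le> (K1 + K2) * prod_list (map norm vs)" if "length vs = k" for vs
      using norm_triangle_ineq4[of "D k x vs" "E k x vs"] K[OF that] by (simp add: algebra_simps)
    then show "\<exists>K. \<forall>vs. length vs = k \<longrightarrow> norm (D k x vs - E k x vs) \<le> K * prod_list (map norm vs)"
      by blast
  next
    fix k x and r :: real assume r: "r > 0"
    obtain d1 where d1: "d1 > 0" "\<And>h vs. norm h < d1 \<Longrightarrow> length vs = k \<Longrightarrow>
        norm (D k (x + h) vs - D k x vs - D (Suc k) x (h # vs)) \<le> r/2 * norm h * prod_list (map norm vs)"
      using D(4)[of "r/2" k x] r by (metis half_gt_zero)
    obtain d2 where d2: "d2 > 0" "\<And>h vs. norm h < d2 \<Longrightarrow> length vs = k \<Longrightarrow>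
        norm (E k (x + h) vs - E k x vs - E (Suc k) x (h # vs)) \<le> r/2 * norm h * prod_list (map norm vs)"
      using E(4)[of "r/2" k x] r by (metis half_gt_zero)
    have "norm (D k (x + h) vs - E k (x + h) vs - (D k x vs - E k x vs) - (D (Suc k) x (h # vs) - E (Suc k) x (h # vs)))
       \<le> r * norm h * prod_list (map norm vs)" if "norm h < min d1 d2" "length vs = k" for h vs
    proof -
      have "norm ((D k (x + h) vs - D k x vs - D (Suc k) x (h # vs)) - (E k (x + h) vs - E k x vs - E (Suc k) x (h # vs)))
        \<le> r/2 * norm h * prod_list (map norm vs) + r/2 * norm h * prod_list (map norm vs)"
        using that by (intro order_trans[OF norm_triangle_ineq4] add_mono d1 d2) auto
      then show ?thesis by (simp add: algebra_simps)
    qed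
    then show "\<exists>d>0. \<forall>h. norm h < d \<longrightarrow> (\<forall>vs. length vs = k \<longrightarrow>
      norm (D k (x + h) vs - E k (x + h) vs - (D k x vs - E k x vs) - (D (Suc k) x (h # vs) - E (Suc k) x (h # vs)))
       \<le> r * norm h * prod_list (map norm vs))"
      using d1(1) d2(1) by (intro exI[of _ "min d1 d2"]) auto
  qed
qed

lemma linear_prod_list_update:
  assumes "i < length vs" and lin: "linear f"
  shows "linear (\<lambda>h. prod_list (map f (vs[i := h])) :: real)"
  using assms(1)
proof (induction vs arbitrary: i)
  case (Cons v vs)
  show ?case
  proof (cases i)
    case 0
    then show ?thesis
      using lin by (intro linearI) (simp_all add: linear_add linear_scale algebra_simps)
  next
    case (Suc j)
    then have "linear (\<lambda>h. prod_list (map f (vs[j := h])))" using Cons by simp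
    then have "linear (\<lambda>h. f v *\<^sub>R prod_list (map f (vs[j := h])))"
      by (rule linear_compose_scale_right)
    then show ?thesis using Suc by simp
  qed
qed simp

text \<open>Applying the mean value inequality twice loses only the factor \<open>1 / 2\<close> of Taylor's formula.\<close>

lemma taylor_2_bound:
  assumes "derivs D" "\<And>x. \<bar>D (Suc (Suc k)) x\<bar> \<le> K"
  shows "\<bar>D k (x + h) - D k x - D (Suc k) x * h\<bar> \<le> K * h\<^sup>2"
proof -
  have dD: "(D k has_real_derivative D (Suc k) x) (at x)" for k x using assms(1) by (simp add: derivs_def)
  have lip: "\<bar>D (Suc k) y - D (Suc k) x\<bar> \<le> K * \<bar>y - x\<bar>" for y x
    using field_differentiable_bound[of UNIV "D (Suc k)" "D (Suc (Suc k))" K y x] dD assms(2) by simp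
  have K: "K \<ge> 0" using assms(2)[of 0] by linarith
  have "norm ((D k (x + h) - D (Suc k) x * (x + h)) - (D k x - D (Suc k) x * x)) \<le> (K * \<bar>h\<bar>) * norm ((x + h) - x)"
  proof (rule field_differentiable_bound)
    show "convex (closed_segment x (x + h))" by simp
    fix z assume "z \<in> closed_segment x (x + h)"
    then have z: "\<bar>z - x\<bar> \<le> \<bar>h\<bar>" by (auto simp: closed_segment_eq_real_ivl split: if_splits)
    show "((\<lambda>z. D k z - D (Suc k) x * z) has_field_derivative D (Suc k) z - D (Suc k) x) (at z within closed_segment x (x + h))"
      by (rule DERIV_diff[OF has_field_derivative_at_within[OF dD] DERIV_cmult_Id])
    show "norm (D (Suc k) z - D (Suc k) x) \<le> K * \<bar>h\<bar>"
      using lip[of z x] mult_left_mono[OF z K] by simp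
  qed auto
  then show ?thesis by (simp add: algebra_simps power2_eq_square abs_mult)
qed

context hilbert_basis
begin

text \<open>The derivative of order \<open>k\<close> at \<open>x\<close> has the coefficients
\<open>w\<^sub>n \<tau>\<^sup>(\<^sup>k\<^sup>)(x \<bullet> a\<^sub>n) \<Prod>\<^sub>i (v\<^sub>i \<bullet> a\<^sub>n)\<close>. Each sequence \<open>(v \<bullet> a\<^sub>n)\<^sub>n\<close> is square summable, hence
bounded by its norm; therefore products of several such sequences, and in particular the quadratic
Taylor remainder, are again square summable.\<close>

lemma smooth_map_ridge_sum:
  fixes a :: "nat \<Rightarrow> 'b::real_inner"
  assumes D: "derivs D" "\<And>x. \<bar>D 0 x\<bar> \<le> C * \<bar>x\<bar>" "\<And>k. \<exists>K. \<forall>x. \<bar>D (Suc k) x\<bar> \<le> K"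
    and w: "\<And>n. \<bar>w n\<bar> \<le> W"
    and a: "\<And>v. summable (\<lambda>n. (v \<bullet> a n)\<^sup>2)" "\<And>v. (\<Sum>n. (v \<bullet> a n)\<^sup>2) \<le> (B * norm v)\<^sup>2"
    and "B \<ge> 0"
  shows "smooth_map (\<lambda>u. synth (\<lambda>n. w n * D 0 (u \<bullet> a n)))"
proof -
  have W0: "W \<ge> 0" using w[of 0] by linarith
  define pr where "pr vs n = prod_list (map (\<lambda>v. v \<bullet> a n) vs)" for vs n
  have a_le: "\<bar>v \<bullet> a n\<bar> \<le> B * norm v" for v n
  proof (rule power2_le_imp_le)
    have "(\<Sum>k\<in>{n}. (v \<bullet> a k)\<^sup>2) \<le> (\<Sum>k. (v \<bullet> a k)\<^sup>2)"
      by (rule sum_le_suminf) (auto intro: a)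
    then show "\<bar>v \<bullet> a n\<bar>\<^sup>2 \<le> (B * norm v)\<^sup>2" using a(2)[of v] by simp
  qed (use \<open>B \<ge> 0\<close> in simp)
  have pr_le: "\<bar>pr vs n\<bar> \<le> B ^ length vs * prod_list (map norm vs)" for vs n
  proof (induction vs)
    case (Cons v vs)
    have "\<bar>v \<bullet> a n\<bar> * \<bar>pr vs n\<bar> \<le> (B * norm v) * (B ^ length vs * prod_list (map norm vs))"
      using Cons a_le \<open>B \<ge> 0\<close> by (intro mult_mono) auto
    then show ?case by (simp add: pr_def abs_mult algebra_simps)
  qed (simp add: pr_def)
  have pn0: "prod_list (map norm vs) \<ge> 0" for vs :: "'b list" by (induction vs) auto
  \<comment> \<open>every estimate below leaves one factor \<open>v \<bullet> a n\<close>, which is square summable in \<open>n\<close>, and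
    bounds the remaining factors uniformly in \<open>n\<close>\<close>
  have dom: "summable (\<lambda>n. (c n)\<^sup>2)" "norm (synth c) \<le> M * (B * norm v)"
    if "\<And>n. \<bar>c n\<bar> \<le> M * \<bar>v \<bullet> a n\<bar>" "M \<ge> 0" for c M v
  proof -
    have le: "(c n)\<^sup>2 \<le> M\<^sup>2 * (v \<bullet> a n)\<^sup>2" for n
      using power_mono[OF that(1)[of n], of 2] by (simp add: power_mult_distrib)
    have s: "summable (\<lambda>n. M\<^sup>2 * (v \<bullet> a n)\<^sup>2)" by (intro summable_mult a)
    show c: "summable (\<lambda>n. (c n)\<^sup>2)"
      by (rule summable_comparison_test'[OF s, of 0]) (use le in simp)
    have "(norm (synth c))\<^sup>2 \<le> (\<Sum>n. M\<^sup>2 * (v \<bullet> a n)\<^sup>2)"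
      unfolding norm_synth[OF c] by (intro suminf_le c s le)
    also have "\<dots> \<le> M\<^sup>2 * (B * norm v)\<^sup>2"
      using a by (simp add: suminf_mult mult_left_mono)
    finally show "norm (synth c) \<le> M * (B * norm v)"
      using that(2) \<open>B \<ge> 0\<close> by (intro power2_le_imp_le[of "norm (synth c)"]) (auto simp: power_mult_distrib)
  qed
  define E where "E k x vs = (\<lambda>n. w n * (D k (x \<bullet> a n) * pr vs n))" for k x vs
  have E_bound: "\<exists>K\<ge>0. \<forall>vs. length vs = k \<longrightarrow>
      (\<exists>v M. M \<ge> 0 \<and> (\<forall>n. \<bar>E k x vs n\<bar> \<le> M * \<bar>v \<bullet> a n\<bar>) \<and> M * (B * norm v) \<le> K * prod_list (map norm vs))" for k x
  proof (cases k)
    case 0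
    have "\<bar>E k x [] n\<bar> \<le> (W * \<bar>C\<bar>) * \<bar>x \<bullet> a n\<bar>" for n
    proof -
      have "C * \<bar>x \<bullet> a n\<bar> \<le> \<bar>C\<bar> * \<bar>x \<bullet> a n\<bar>" by (intro mult_right_mono) auto
      then have "\<bar>D 0 (x \<bullet> a n)\<bar> \<le> \<bar>C\<bar> * \<bar>x \<bullet> a n\<bar>" using D(2)[of "x \<bullet> a n"] by linarith
      then have "\<bar>w n\<bar> * \<bar>D 0 (x \<bullet> a n)\<bar> \<le> W * (\<bar>C\<bar> * \<bar>x \<bullet> a n\<bar>)"
        using w W0 by (intro mult_mono) auto
      then show ?thesis using 0 by (simp add: E_def pr_def abs_mult mult.assoc)
    qed
    then show ?thesis
      using 0 W0 \<open>B \<ge> 0\<close>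
      by (intro exI[of _ "W * \<bar>C\<bar> * (B * norm x)"]) (auto intro!: exI[of _ x] exI[of _ "W * \<bar>C\<bar>"])
  next
    case (Suc j)
    obtain K where K: "\<And>y. \<bar>D (Suc j) y\<bar> \<le> K" using D(3) by blast
    have K0: "K \<ge> 0" using K[of 0] by linarith
    have main: "\<bar>E k x (v # vs) n\<bar> \<le> (W * K * (B ^ j * prod_list (map norm vs))) * \<bar>v \<bullet> a n\<bar>"
      if "length vs = j" for v vs n
    proof -
      have "\<bar>w n\<bar> * \<bar>D k (x \<bullet> a n)\<bar> * \<bar>pr vs n\<bar> \<le> W * K * (B ^ j * prod_list (map norm vs))"
        using w K pr_le[of vs n] W0 K0 Suc that by (intro mult_mono) auto
      from mult_right_mono[OF this, of "\<bar>v \<bullet> a n\<bar>"] show ?thesis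
        by (simp add: E_def pr_def abs_mult algebra_simps)
    qed
    show ?thesis
    proof (intro exI[of _ "W * K * B ^ Suc j"] conjI allI impI)
      show "0 \<le> W * K * B ^ Suc j" using W0 K0 \<open>B \<ge> 0\<close> by simp
      fix vs :: "'b list" assume "length vs = k"
      then obtain v vs' where vs: "vs = v # vs'" "length vs' = j" using Suc by (auto simp: length_Suc_conv)
      show "\<exists>v M. M \<ge> 0 \<and> (\<forall>n. \<bar>E k x vs n\<bar> \<le> M * \<bar>v \<bullet> a n\<bar>) \<and>
          M * (B * norm v) \<le> W * K * B ^ Suc j * prod_list (map norm vs)"
        using vs main W0 K0 \<open>B \<ge> 0\<close> pn0[of vs']
        by (intro exI[of _ v] exI[of _ "W * K * (B ^ j * prod_list (map norm vs'))"]) (auto simp: algebra_simps)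
    qed
  qed
  have E_summable: "summable (\<lambda>n. (E k x vs n)\<^sup>2)" if "length vs = k" for k x vs
    using E_bound[of k x] that dom(1) by blast
  have E_norm_le: "\<exists>K. \<forall>vs. length vs = k \<longrightarrow> norm (synth (E k x vs)) \<le> K * prod_list (map norm vs)" for k x
  proof -
    obtain K where K: "\<forall>vs. length vs = k \<longrightarrow>
      (\<exists>v M. M \<ge> 0 \<and> (\<forall>n. \<bar>E k x vs n\<bar> \<le> M * \<bar>v \<bullet> a n\<bar>) \<and> M * (B * norm v) \<le> K * prod_list (map norm vs))"
      using E_bound by blast
    have "norm (synth (E k x vs)) \<le> K * prod_list (map norm vs)" if "length vs = k" for vs
    proof -
      obtain v M where "M \<ge> 0" "\<And>n. \<bar>E k x vs n\<bar> \<le> M * \<bar>v \<bullet> a n\<bar>"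
        "M * (B * norm v) \<le> K * prod_list (map norm vs)"
        using K \<open>length vs = k\<close> by blast
      then show ?thesis by (meson dom(2) order_trans)
    qed
    then show ?thesis by blast
  qed
  have lin_pr: "linear (\<lambda>h. pr (vs[i := h]) n)" if "i < length vs" for vs i n
    unfolding pr_def using that
    by (intro linear_prod_list_update) (auto intro!: bounded_linear.linear bounded_linear_inner_left)
  show ?thesis
    unfolding smooth_map_def
  proof (intro exI[of _ "\<lambda>k x vs. synth (E k x vs)"] conjI allI impI)
    fix x show "synth (E 0 x []) = synth (\<lambda>n. w n * D 0 (x \<bullet> a n))" by (simp add: E_def pr_def)
  next
    fix k x and vs :: "'b list" and i assume i: "length vs = k \<and> i < k"
    then have l: "i < length vs" "length (vs[i := h]) = k" for h by auto
    have add: "pr (vs[i := h + h']) n = pr (vs[i := h]) n + pr (vs[i := h']) n" for h h' n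
      using linear_add[OF lin_pr[OF l(1)]] .
    have scale: "pr (vs[i := r *\<^sub>R h]) n = r * pr (vs[i := h]) n" for r h n
      using linear_scale[OF lin_pr[OF l(1)]] by simp
    have c: "synth (E k x (vs[i := h])) \<bullet> e n = E k x (vs[i := h]) n" for h n
      by (rule synth_coeff) (rule E_summable, rule l)
    show "linear (\<lambda>h. synth (E k x (vs[i := h])))"
    proof (rule linearI)
      fix h h' show "synth (E k x (vs[i := h + h'])) = synth (E k x (vs[i := h])) + synth (E k x (vs[i := h']))"
        by (rule coeff_eqI) (simp only: c inner_add_left, simp add: E_def add algebra_simps)
    next
      fix r h show "synth (E k x (vs[i := r *\<^sub>R h])) = r *\<^sub>R synth (E k x (vs[i := h]))"
        by (rule coeff_eqI) (simp only: c inner_scaleR_left, simp add: E_def scale algebra_simps)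
    qed
  next
    fix k x show "\<exists>K. \<forall>vs. length vs = k \<longrightarrow> norm (synth (E k x vs)) \<le> K * prod_list (map norm vs)"
      by (rule E_norm_le)
  next
    fix k x and r :: real assume r: "r > 0"
    obtain K where K: "\<And>y. \<bar>D (Suc (Suc k)) y\<bar> \<le> K" using D(3) by blast
    have K0: "K \<ge> 0" using K[of 0] by linarith
    define Q where "Q = W * K * B ^ Suc (Suc k)"
    have Q0: "Q \<ge> 0" unfolding Q_def using W0 K0 \<open>B \<ge> 0\<close> by simp
    have main: "norm (synth (E k (x + h) vs) - synth (E k x vs) - synth (E (Suc k) x (h # vs)))
       \<le> Q * (norm h)\<^sup>2 * prod_list (map norm vs)" if "length vs = k" for h vs
    proof -
      define M where "M = W * (K * (B * norm h)) * (B ^ k * prod_list (map norm vs))"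
      have M0: "M \<ge> 0" unfolding M_def using W0 K0 \<open>B \<ge> 0\<close> pn0 by (intro mult_nonneg_nonneg) auto
      have *: "\<bar>E k (x + h) vs n - E k x vs n - E (Suc k) x (h # vs) n\<bar> \<le> M * \<bar>h \<bullet> a n\<bar>" for n
      proof -
        let ?X = "x \<bullet> a n" and ?H = "h \<bullet> a n"
        have "\<bar>D k (?X + ?H) - D k ?X - D (Suc k) ?X * ?H\<bar> \<le> K * ?H\<^sup>2"
          by (rule taylor_2_bound[OF D(1) K])
        also have "\<dots> \<le> K * (B * norm h) * \<bar>?H\<bar>"
          using mult_right_mono[OF a_le[of h n], of "\<bar>?H\<bar>"] K0
          by (simp add: power2_eq_square abs_mult[symmetric] mult.assoc mult_left_mono)
        finally have "\<bar>w n\<bar> * \<bar>D k (?X + ?H) - D k ?X - D (Suc k) ?X * ?H\<bar> * \<bar>pr vs n\<bar>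
            \<le> W * (K * (B * norm h) * \<bar>?H\<bar>) * (B ^ k * prod_list (map norm vs))"
          using w[of n] pr_le[of vs n] W0 K0 \<open>B \<ge> 0\<close> that by (intro mult_mono) auto
        moreover have "E k (x + h) vs n - E k x vs n - E (Suc k) x (h # vs) n
            = w n * (D k (?X + ?H) - D k ?X - D (Suc k) ?X * ?H) * pr vs n"
          by (simp add: E_def pr_def inner_add_left algebra_simps)
        moreover have "W * (K * (B * norm h) * \<bar>?H\<bar>) * (B ^ k * prod_list (map norm vs)) = M * \<bar>?H\<bar>"
          by (simp add: M_def)
        ultimately show ?thesis by (simp only: abs_mult)
      qed
      have "synth (E k (x + h) vs) - synth (E k x vs) - synth (E (Suc k) x (h # vs))
        = synth (\<lambda>n. E k (x + h) vs n - E k x vs n - E (Suc k) x (h # vs) n)"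
        using that by (simp add: synth_diff summable_square_diff E_summable)
      moreover have "M * (B * norm h) = Q * (norm h)\<^sup>2 * prod_list (map norm vs)"
        by (simp add: M_def Q_def power2_eq_square algebra_simps)
      ultimately show ?thesis using dom(2)[OF * M0] by simp
    qed
    show "\<exists>d>0. \<forall>h. norm h < d \<longrightarrow> (\<forall>vs. length vs = k \<longrightarrow>
        norm (synth (E k (x + h) vs) - synth (E k x vs) - synth (E (Suc k) x (h # vs)))
          \<le> r * norm h * prod_list (map norm vs))"
    proof (intro exI[of _ "r / (Q + 1)"] conjI allI impI)
      show "r / (Q + 1) > 0" using r Q0 by simp
      fix h :: 'b and vs :: "'b list" assume h: "norm h < r / (Q + 1)" and l: "length vs = k"
      have "Q * norm h \<le> (Q + 1) * norm h" by (simp add: algebra_simps)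
      also have "\<dots> \<le> r" using h Q0 by (simp add: field_simps)
      finally have "Q * (norm h)\<^sup>2 * prod_list (map norm vs) \<le> r * norm h * prod_list (map norm vs)"
        using pn0[of vs] by (intro mult_right_mono) (simp_all add: power2_eq_square mult.assoc[symmetric] mult_right_mono)
      then show "norm (synth (E k (x + h) vs) - synth (E k x vs) - synth (E (Suc k) x (h # vs)))
          \<le> r * norm h * prod_list (map norm vs)"
        using main[OF l, of h] by linarith
    qed
  qed
qed

end

section \<open>The nonlinearity\<close>

context hilbert_basis begin

lemma bounded_linear_diagonal:
  assumes "\<And>n. \<bar>d n\<bar> \<le> M"
  shows "bounded_linear (\<lambda>u. synth (\<lambda>n. d n * (u \<bullet> e n)))"
    and "synth (\<lambda>n. d n * (u \<bullet> e n)) \<bullet> e k = d k * (u \<bullet> e k)"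
proof -
  have M: "M \<ge> 0" using assms[of 0] by linarith
  have le: "(d n * (u \<bullet> e n))\<^sup>2 \<le> M\<^sup>2 * (u \<bullet> e n)\<^sup>2" for u n
    using power_mono[OF assms, of n 2] by (simp add: power_mult_distrib mult_right_mono)
  have s: "summable (\<lambda>n. M\<^sup>2 * (u \<bullet> e n)\<^sup>2)" for u by (intro summable_mult summable_coeff)
  have sd: "summable (\<lambda>n. (d n * (u \<bullet> e n))\<^sup>2)" for u
    by (rule summable_comparison_test'[OF s[of u], of 0]) (use le in simp)
  show c: "synth (\<lambda>n. d n * (u \<bullet> e n)) \<bullet> e k = d k * (u \<bullet> e k)" for u k
    by (rule synth_coeff[OF sd])
  show "bounded_linear (\<lambda>u. synth (\<lambda>n. d n * (u \<bullet> e n)))"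
  proof (rule bounded_linear_intro)
    fix u v show "synth (\<lambda>n. d n * ((u + v) \<bullet> e n)) = synth (\<lambda>n. d n * (u \<bullet> e n)) + synth (\<lambda>n. d n * (v \<bullet> e n))"
    proof (rule coeff_eqI)
      fix n show "synth (\<lambda>n. d n * ((u + v) \<bullet> e n)) \<bullet> e n = (synth (\<lambda>n. d n * (u \<bullet> e n)) + synth (\<lambda>n. d n * (v \<bullet> e n))) \<bullet> e n"
        unfolding inner_add_left[of "synth _" "synth _"] c by (simp add: inner_add_left distrib_left)
    qed
  next
    fix r u show "synth (\<lambda>n. d n * ((r *\<^sub>R u) \<bullet> e n)) = r *\<^sub>R synth (\<lambda>n. d n * (u \<bullet> e n))"
    proof (rule coeff_eqI)
      fix n show "synth (\<lambda>n. d n * ((r *\<^sub>R u) \<bullet> e n)) \<bullet> e n = (r *\<^sub>R synth (\<lambda>n. d n * (u \<bullet> e n))) \<bullet> e n"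
        unfolding inner_scaleR_left[of r "synth _"] c by simp
    qed
  next
    fix u
    have "(norm (synth (\<lambda>n. d n * (u \<bullet> e n))))\<^sup>2 \<le> (\<Sum>n. M\<^sup>2 * (u \<bullet> e n)\<^sup>2)"
      unfolding norm_synth[OF sd] by (intro suminf_le sd s le)
    also have "\<dots> = (norm u * M)\<^sup>2"
      using parseval[of u] by (simp add: suminf_mult sums_iff power_mult_distrib mult.commute)
    finally show "norm (synth (\<lambda>n. d n * (u \<bullet> e n))) \<le> norm u * M"
      by (rule power2_le_imp_le) (use M in simp)
  qed
qed

end

text \<open>Here \<open>D\<close> lists the derivatives of the truncation. The number \<open>l\<close> is the size of the slopes, \<open>\<delta>\<close> is the
margin granted to the first component, and \<open>h\<close> measures how strongly the first coordinate acts on the others.\<close>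

locale nonlinearity = hilbert_basis +
  fixes lam :: "nat \<Rightarrow> real" and D :: "nat \<Rightarrow> real \<Rightarrow> real" and l \<delta> h c :: real
  assumes lam_pos: "\<And>n. lam n > 0" and l_pos: "l > 0" and \<delta>_pos: "\<delta> > 0" and h_pos: "h > 0"
    and D: "derivs D" "\<And>k. \<exists>K. \<forall>x. \<bar>D (Suc k) x\<bar> \<le> K"
    and D_id: "\<And>x. \<bar>x\<bar> \<le> 1 \<Longrightarrow> D 0 x = x" and D_odd: "\<And>x. D 0 (- x) = - D 0 x"
    and D_const: "\<And>x. x \<ge> 2 \<Longrightarrow> D 0 x = c" and D1: "\<And>x. 0 \<le> D (Suc 0) x" "\<And>x. D (Suc 0) x \<le> 1"
begin

definition amp :: real where "amp = lam 0 + l + \<delta>"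
definition stretch :: real where "stretch = amp / \<delta>"
definition eta :: "nat \<Rightarrow> real" where "eta n = h / 2 ^ n"
definition diag :: "nat \<Rightarrow> real" where "diag n = (if n = 0 then lam 0 else min l (lam n))"
definition ridge_p :: "nat \<Rightarrow> 'a" where "ridge_p n = (if n = 0 then e 0 else e n + eta n *\<^sub>R e 0)"
definition ridge_m :: "nat \<Rightarrow> 'a" where "ridge_m n = (if n = 0 then (1 / stretch) *\<^sub>R e 0 else e n - eta n *\<^sub>R e 0)"
definition wt_p :: "nat \<Rightarrow> real" where "wt_p n = (if n = 0 then amp else (l + min l (lam n)) / 2)"
definition wt_m :: "nat \<Rightarrow> real" where "wt_m n = (if n = 0 then - amp else (l + min l (lam n)) / 2)"

text \<open>In the first component the two truncations cancel for large arguments and leave the slope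
\<open>lam 0\<close>, which makes a whole half-line consist of equilibria. The amplitudes are such that the slope near
\<open>0\<close> is \<open>- l\<close>. In another component, saturated truncations of opposite sign cancel and leave the slope
\<open>min l (lam n)\<close>, and near \<open>0\<close> they contribute \<open>- l - min l (lam n)\<close>. Taking the minimum
with \<open>lam n\<close> keeps the exponents at the distant equilibria nonnegative, so that the explicit
solutions near them are bounded and stay in the region where \<open>F\<close> is affine.\<close>

definition F :: "'a \<Rightarrow> 'a" where
  "F u = synth (\<lambda>n. diag n * (u \<bullet> e n)) - synth (\<lambda>n. wt_p n * D 0 (u \<bullet> ridge_p n))
     - synth (\<lambda>n. wt_m n * D 0 (u \<bullet> ridge_m n))"

lemma amp_pos: "amp > 0" using lam_pos[of 0] l_pos \<delta>_pos by (simp add: amp_def)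
lemma stretch_gt_1: "stretch > 1" using lam_pos[of 0] l_pos \<delta>_pos by (simp add: stretch_def amp_def)
lemma eta_pos: "eta n > 0" using h_pos by (simp add: eta_def)
lemma eta_le: "eta n \<le> h" using h_pos by (simp add: eta_def field_simps)

lemma eta_antimono: "eta n \<le> eta m" if "m \<le> n"
  using h_pos that by (simp add: eta_def frac_le power_increasing)

text \<open>The bound \<open>2 * h\<^sup>2\<close> is the geometric sum \<open>4 / 3 * h\<^sup>2\<close> rounded up.\<close>

lemma eta_sums: "summable (\<lambda>n. (eta n)\<^sup>2)" "(\<Sum>n. (eta n)\<^sup>2) \<le> 2 * h\<^sup>2"
proof -
  have eq: "(eta n)\<^sup>2 = h\<^sup>2 * (1 / 4) ^ n" for n
    by (simp add: eta_def power_divide power_mult_distrib[symmetric] power2_eq_square)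
  have "(\<lambda>n. h\<^sup>2 * (1 / 4) ^ n) sums (h\<^sup>2 * (1 / (1 - 1 / 4)))"
    by (intro sums_mult geometric_sums) simp
  then have "(\<lambda>n. (eta n)\<^sup>2) sums (h\<^sup>2 * (1 / (1 - 1 / 4)))" by (simp only: eq)
  note sums = this
  show "summable (\<lambda>n. (eta n)\<^sup>2)" using sums by (rule sums_summable)
  have "(\<Sum>n. (eta n)\<^sup>2) = h\<^sup>2 * (1 / (1 - 1 / 4))" using sums by (rule sums_unique[symmetric])
  also have "\<dots> = 4 / 3 * h\<^sup>2" by simp
  finally show "(\<Sum>n. (eta n)\<^sup>2) \<le> 2 * h\<^sup>2" using zero_le_power2[of h] by linarith
qed

lemma D_diff: "\<exists>\<theta>. 0 \<le> \<theta> \<and> \<theta> \<le> 1 \<and> D 0 x - D 0 y = \<theta> * (x - y)"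
proof -
  have dD: "(D 0 has_real_derivative D (Suc 0) z) (at z)" for z using D(1) by (simp add: derivs_def)
  have *: "\<exists>\<theta>. 0 \<le> \<theta> \<and> \<theta> \<le> 1 \<and> D 0 b - D 0 a = \<theta> * (b - a)" if ab: "a < b" for a b
  proof -
    obtain z where "D 0 b - D 0 a = (b - a) * D (Suc 0) z"
      using MVT2[OF ab, of "D 0" "D (Suc 0)"] dD by blast
    then show ?thesis using D1[of z] by (intro exI[of _ "D (Suc 0) z"]) auto
  qed
  consider "x < y" | "x = y" | "y < x" by linarith
  then show ?thesis
  proof cases
    case 1
    from *[OF this] obtain \<theta> where "0 \<le> \<theta>" "\<theta> \<le> 1" "D 0 y - D 0 x = \<theta> * (y - x)" by blast
    then show ?thesis by (intro exI[of _ \<theta>]) (auto simp: algebra_simps)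
  qed (use * in auto)
qed

lemma D_zero: "D 0 0 = 0" using D_id[of 0] by simp

lemma D_le: "\<bar>D 0 x\<bar> \<le> 1 * \<bar>x\<bar>"
proof -
  obtain \<theta> where "0 \<le> \<theta>" "\<theta> \<le> 1" "D 0 x = \<theta> * x" using D_diff[of x 0] by (auto simp: D_zero)
  then show ?thesis by (simp add: abs_mult mult_left_le_one_le)
qed

lemma diag_bound: "\<bar>diag n\<bar> \<le> lam 0 + l"
  using lam_pos[of 0] lam_pos[of n] l_pos by (auto simp: diag_def)

lemma wt_bound: "\<bar>wt_p n\<bar> \<le> amp + l" "\<bar>wt_m n\<bar> \<le> amp + l"
  using lam_pos[of n] l_pos amp_pos by (auto simp: wt_p_def wt_m_def)

lemma inner_ridge:
  "u \<bullet> ridge_p n = (if n = 0 then u \<bullet> e 0 else u \<bullet> e n + eta n * (u \<bullet> e 0))"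
  "u \<bullet> ridge_m n = (if n = 0 then (u \<bullet> e 0) / stretch else u \<bullet> e n - eta n * (u \<bullet> e 0))"
  by (simp_all add: ridge_p_def ridge_m_def inner_add_right inner_diff_right)

lemma ridge_square_le:
  "(u \<bullet> ridge_p n)\<^sup>2 \<le> 2 * (u \<bullet> e n)\<^sup>2 + 2 * (u \<bullet> e 0)\<^sup>2 * (eta n)\<^sup>2"
  "(u \<bullet> ridge_m n)\<^sup>2 \<le> 2 * (u \<bullet> e n)\<^sup>2 + 2 * (u \<bullet> e 0)\<^sup>2 * (eta n)\<^sup>2"
proof -
  have 1: "(x + y)\<^sup>2 \<le> 2 * x\<^sup>2 + 2 * y\<^sup>2" "(x - y)\<^sup>2 \<le> 2 * x\<^sup>2 + 2 * y\<^sup>2" for x y :: real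
    using zero_le_power2[of "x - y"] zero_le_power2[of "x + y"] by (simp_all add: power2_sum power2_diff)
  have 2: "x\<^sup>2 \<le> 2 * x\<^sup>2 + 2 * x\<^sup>2 * y\<^sup>2" for x y :: real by simp
  have "stretch\<^sup>2 \<ge> 1" using stretch_gt_1 by (simp add: one_le_power)
  then have "(x / stretch)\<^sup>2 \<le> x\<^sup>2" for x
    using divide_left_mono[of 1 "stretch\<^sup>2" "x\<^sup>2"] stretch_gt_1 by (simp add: power_divide)
  then have 3: "(x / stretch)\<^sup>2 \<le> 2 * x\<^sup>2 + 2 * x\<^sup>2 * y\<^sup>2" for x y using 2 order_trans by blast
  show "(u \<bullet> ridge_p n)\<^sup>2 \<le> 2 * (u \<bullet> e n)\<^sup>2 + 2 * (u \<bullet> e 0)\<^sup>2 * (eta n)\<^sup>2"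
    using 1(1)[of "u \<bullet> e n" "eta n * (u \<bullet> e 0)"] 2[of "u \<bullet> e 0" "eta 0"]
    by (simp add: inner_ridge power_mult_distrib mult.commute mult.left_commute)
  show "(u \<bullet> ridge_m n)\<^sup>2 \<le> 2 * (u \<bullet> e n)\<^sup>2 + 2 * (u \<bullet> e 0)\<^sup>2 * (eta n)\<^sup>2"
    using 1(2)[of "u \<bullet> e n" "eta n * (u \<bullet> e 0)"] 3[of "u \<bullet> e 0" "eta 0"]
    by (simp add: inner_ridge power_mult_distrib mult.commute mult.left_commute)
qed

text \<open>The form of all componentwise bounds below: the diagonal part plus the influence of the first coordinate.\<close>

lemma square_sums_le:
  assumes a: "\<And>n. (a n)\<^sup>2 \<le> p * (u \<bullet> e n)\<^sup>2 + q * (u \<bullet> e 0)\<^sup>2 * (eta n)\<^sup>2" and "q \<ge> 0"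
  shows "summable (\<lambda>n. (a n :: real)\<^sup>2)" "(\<Sum>n. (a n)\<^sup>2) \<le> (p + 2 * q * h\<^sup>2) * (norm u)\<^sup>2"
proof -
  have s: "summable (\<lambda>n. p * (u \<bullet> e n)\<^sup>2)" "summable (\<lambda>n. q * (u \<bullet> e 0)\<^sup>2 * (eta n)\<^sup>2)"
    by (intro summable_mult summable_coeff eta_sums)+
  show sa: "summable (\<lambda>n. (a n)\<^sup>2)"
    by (rule summable_comparison_test'[OF summable_add[OF s], of 0]) (use a in simp)
  have u0: "(u \<bullet> e 0)\<^sup>2 \<le> (norm u)\<^sup>2"
    using Cauchy_Schwarz_ineq2[of u "e 0"] by (simp add: abs_le_square_iff[symmetric])
  have "(\<Sum>n. (a n)\<^sup>2) \<le> (\<Sum>n. p * (u \<bullet> e n)\<^sup>2 + q * (u \<bullet> e 0)\<^sup>2 * (eta n)\<^sup>2)"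
    by (intro suminf_le sa summable_add s a)
  also have "\<dots> = p * (norm u)\<^sup>2 + q * (u \<bullet> e 0)\<^sup>2 * (\<Sum>n. (eta n)\<^sup>2)"
    using parseval[of u] eta_sums(1) by (simp add: suminf_add[OF s, symmetric] suminf_mult sums_iff)
  also have "\<dots> \<le> p * (norm u)\<^sup>2 + q * (norm u)\<^sup>2 * (2 * h\<^sup>2)"
    using assms(2) u0 eta_sums by (intro add_left_mono mult_mono) (auto intro: suminf_nonneg)
  finally show "(\<Sum>n. (a n)\<^sup>2) \<le> (p + 2 * q * h\<^sup>2) * (norm u)\<^sup>2" by (simp add: algebra_simps)
qed

lemma ridge_summable:
  "summable (\<lambda>n. (wt_p n * D 0 (u \<bullet> ridge_p n))\<^sup>2)" "summable (\<lambda>n. (wt_m n * D 0 (u \<bullet> ridge_m n))\<^sup>2)"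
proof -
  have *: "(w * D 0 x)\<^sup>2 \<le> (amp + l)\<^sup>2 * x\<^sup>2" if "\<bar>w\<bar> \<le> amp + l" for w x
  proof -
    have "\<bar>w * D 0 x\<bar> \<le> (amp + l) * \<bar>x\<bar>"
      unfolding abs_mult using that D_le[of x] by (intro mult_mono) auto
    from power_mono[OF this, of 2] show ?thesis by (simp add: power_mult_distrib)
  qed
  have sp: "summable (\<lambda>n. (u \<bullet> ridge_p n)\<^sup>2)" and sm: "summable (\<lambda>n. (u \<bullet> ridge_m n)\<^sup>2)"
    by (rule square_sums_le(1)[where p = 2 and q = 2 and u = u], rule ridge_square_le, simp)+
  show "summable (\<lambda>n. (wt_p n * D 0 (u \<bullet> ridge_p n))\<^sup>2)"
    by (rule summable_comparison_test'[OF summable_mult[OF sp, of "(amp + l)\<^sup>2"], of 0]) (simp add: * wt_bound)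
  show "summable (\<lambda>n. (wt_m n * D 0 (u \<bullet> ridge_m n))\<^sup>2)"
    by (rule summable_comparison_test'[OF summable_mult[OF sm, of "(amp + l)\<^sup>2"], of 0]) (simp add: * wt_bound)
qed

lemma F_coeff: "F u \<bullet> e n = diag n * (u \<bullet> e n) - wt_p n * D 0 (u \<bullet> ridge_p n) - wt_m n * D 0 (u \<bullet> ridge_m n)"
  unfolding F_def inner_diff_left
  by (simp only: bounded_linear_diagonal(2)[OF diag_bound] synth_coeff[OF ridge_summable(1)] synth_coeff[OF ridge_summable(2)])

lemma F_coeff_0: "F u \<bullet> e 0 = lam 0 * (u \<bullet> e 0) - amp * D 0 (u \<bullet> e 0) + amp * D 0 ((u \<bullet> e 0) / stretch)"
  by (simp add: F_coeff diag_def wt_p_def wt_m_def inner_ridge)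

lemma F_coeff_Suc:
  assumes "n > 0"
  shows "F u \<bullet> e n = min l (lam n) * (u \<bullet> e n) - (l + min l (lam n)) / 2 *
    (D 0 (u \<bullet> e n + eta n * (u \<bullet> e 0)) + D 0 (u \<bullet> e n - eta n * (u \<bullet> e 0)))"
  using assms by (simp add: F_coeff diag_def wt_p_def wt_m_def inner_ridge distrib_left)

lemma smooth_F: "smooth_map F"
proof -
  define B where "B = sqrt (2 + 4 * h\<^sup>2)"
  have B: "B \<ge> 0" "B\<^sup>2 = 2 + 4 * h\<^sup>2" by (simp_all add: B_def)
  have "smooth_map (\<lambda>u. synth (\<lambda>n. wt_p n * D 0 (u \<bullet> ridge_p n)))"
    using square_sums_le[of "\<lambda>n. _ \<bullet> ridge_p n" 2 _ 2, OF ridge_square_le(1)] B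
    by (intro smooth_map_ridge_sum[OF D(1) D_le D(2) wt_bound(1)]) (simp_all add: power_mult_distrib)
  moreover have "smooth_map (\<lambda>u. synth (\<lambda>n. wt_m n * D 0 (u \<bullet> ridge_m n)))"
    using square_sums_le[of "\<lambda>n. _ \<bullet> ridge_m n" 2 _ 2, OF ridge_square_le(2)] B
    by (intro smooth_map_ridge_sum[OF D(1) D_le D(2) wt_bound(2)]) (simp_all add: power_mult_distrib)
  moreover have "smooth_map (\<lambda>u. synth (\<lambda>n. diag n * (u \<bullet> e n)))"
    by (rule smooth_map_linear[OF bounded_linear_diagonal(1)[OF diag_bound]])
  ultimately have "smooth_map (\<lambda>u. synth (\<lambda>n. diag n * (u \<bullet> e n)) - synth (\<lambda>n. wt_p n * D 0 (u \<bullet> ridge_p n))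
     - synth (\<lambda>n. wt_m n * D 0 (u \<bullet> ridge_m n)))"
    using smooth_map_diff by blast
  then show ?thesis by (simp add: F_def[abs_def])
qed

text \<open>By the mean value theorem the difference quotient is \<open>lam 0 - s * amp + t * \<delta>\<close> with \<open>s, t\<close> in \<open>[0, 1]\<close>.\<close>

lemma F_difference_0:
  assumes "l + \<delta> \<le> M" "lam 0 + \<delta> \<le> M"
  shows "\<bar>F u \<bullet> e 0 - F v \<bullet> e 0\<bar> \<le> M * \<bar>(u - v) \<bullet> e 0\<bar>"
proof -
  let ?d = "(u - v) \<bullet> e 0"
  obtain s where s: "0 \<le> s" "s \<le> 1" "D 0 (u \<bullet> e 0) - D 0 (v \<bullet> e 0) = s * ?d"
    using D_diff[of "u \<bullet> e 0" "v \<bullet> e 0"] by (auto simp: inner_diff_left)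
  obtain t where t: "0 \<le> t" "t \<le> 1" "D 0 ((u \<bullet> e 0) / stretch) - D 0 ((v \<bullet> e 0) / stretch) = t * (?d / stretch)"
    using D_diff[of "(u \<bullet> e 0) / stretch" "(v \<bullet> e 0) / stretch"] by (auto simp: inner_diff_left diff_divide_distrib)
  have as: "amp * (?d / stretch) = \<delta> * ?d" using amp_pos \<delta>_pos by (simp add: stretch_def)
  have "F u \<bullet> e 0 - F v \<bullet> e 0 = lam 0 * ?d - amp * (s * ?d) + amp * (t * (?d / stretch))"
    unfolding s(3)[symmetric] t(3)[symmetric] F_coeff_0 by (simp add: inner_diff_left algebra_simps)
  also have "amp * (t * (?d / stretch)) = t * (\<delta> * ?d)"
    unfolding as[symmetric] by (rule mult.left_commute)
  finally have "F u \<bullet> e 0 - F v \<bullet> e 0 = (lam 0 - s * amp + t * \<delta>) * ?d" by (simp add: algebra_simps)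
  moreover have "\<bar>lam 0 - s * amp + t * \<delta>\<bar> \<le> M"
  proof -
    have "0 \<le> s * amp" "s * amp \<le> amp" "0 \<le> t * \<delta>" "t * \<delta> \<le> \<delta>"
      using s t amp_pos \<delta>_pos by (simp_all add: mult_left_le_one_le)
    then show ?thesis using assms by (simp add: amp_def abs_le_iff)
  qed
  ultimately show ?thesis by (simp add: abs_mult mult_right_mono)
qed

text \<open>With \<open>x, y\<close> the increments of the two ridge arguments, the increment of \<open>F\<close> is a combination of \<open>x\<close> and \<open>y\<close> with
coefficients in \<open>[- l / 2, l / 2]\<close>, and \<open>x\<^sup>2 + y\<^sup>2\<close> is computed by the parallelogram identity. The
first coordinate enters only as an additional square, and the diagonal part keeps the constant \<open>l\<close>.\<close>

lemma F_difference_Suc: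
  assumes "n > 0"
  shows "(F u \<bullet> e n - F v \<bullet> e n)\<^sup>2 \<le> l\<^sup>2 * (((u - v) \<bullet> e n)\<^sup>2 + (eta n)\<^sup>2 * ((u - v) \<bullet> e 0)\<^sup>2)"
proof -
  define b where "b = min l (lam n)"
  define x where "x = (u - v) \<bullet> e n + eta n * ((u - v) \<bullet> e 0)"
  define y where "y = (u - v) \<bullet> e n - eta n * ((u - v) \<bullet> e 0)"
  have b: "0 \<le> b" "b \<le> l" using lam_pos[of n] l_pos by (auto simp: b_def)
  obtain s where s: "0 \<le> s" "s \<le> 1"
    "D 0 (u \<bullet> e n + eta n * (u \<bullet> e 0)) - D 0 (v \<bullet> e n + eta n * (v \<bullet> e 0)) = s * x"
    using D_diff[of "u \<bullet> e n + eta n * (u \<bullet> e 0)" "v \<bullet> e n + eta n * (v \<bullet> e 0)"]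
    by (auto simp: x_def inner_diff_left algebra_simps)
  obtain t where t: "0 \<le> t" "t \<le> 1"
    "D 0 (u \<bullet> e n - eta n * (u \<bullet> e 0)) - D 0 (v \<bullet> e n - eta n * (v \<bullet> e 0)) = t * y"
    using D_diff[of "u \<bullet> e n - eta n * (u \<bullet> e 0)" "v \<bullet> e n - eta n * (v \<bullet> e 0)"]
    by (auto simp: y_def inner_diff_left algebra_simps)
  have xy: "(x + y) / 2 = u \<bullet> e n - v \<bullet> e n" by (simp add: x_def y_def inner_diff_left)
  have "F u \<bullet> e n - F v \<bullet> e n = b * ((x + y) / 2) - (l + b) / 2 * (s * x + t * y)"
    unfolding s(3)[symmetric] t(3)[symmetric] F_coeff_Suc[OF assms] b_def[symmetric] xy
    by (simp add: algebra_simps)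
  also have "\<dots> = (b / 2 - (l + b) / 2 * s) * x + (b / 2 - (l + b) / 2 * t) * y"
    by (simp add: algebra_simps add_divide_distrib)
  also have "\<bar>\<dots>\<bar> \<le> l / 2 * \<bar>x\<bar> + l / 2 * \<bar>y\<bar>"
  proof -
    have coef: "\<bar>b / 2 - (l + b) / 2 * r\<bar> \<le> l / 2" if "0 \<le> r" "r \<le> 1" for r
    proof -
      have "0 \<le> (l + b) / 2 * r" "(l + b) / 2 * r \<le> (l + b) / 2"
        using that b l_pos by (auto intro!: mult_nonneg_nonneg mult_left_le)
      then show ?thesis using b by (simp add: abs_le_iff field_simps)
    qed
    have "\<bar>(b / 2 - (l + b) / 2 * s) * x + (b / 2 - (l + b) / 2 * t) * y\<bar>
      \<le> \<bar>b / 2 - (l + b) / 2 * s\<bar> * \<bar>x\<bar> + \<bar>b / 2 - (l + b) / 2 * t\<bar> * \<bar>y\<bar>"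
      by (metis abs_mult abs_triangle_ineq)
    also have "\<dots> \<le> l / 2 * \<bar>x\<bar> + l / 2 * \<bar>y\<bar>"
      using coef s t by (intro add_mono mult_right_mono) auto
    finally show ?thesis .
  qed
  finally have "(F u \<bullet> e n - F v \<bullet> e n)\<^sup>2 \<le> (l / 2 * \<bar>x\<bar> + l / 2 * \<bar>y\<bar>)\<^sup>2"
    using power_mono[of "\<bar>F u \<bullet> e n - F v \<bullet> e n\<bar>" _ 2] by simp
  also have "\<dots> = (l / 2)\<^sup>2 * (\<bar>x\<bar> + \<bar>y\<bar>)\<^sup>2" by (simp add: power_mult_distrib[symmetric] distrib_left)
  also have "\<dots> \<le> (l / 2)\<^sup>2 * (2 * x\<^sup>2 + 2 * y\<^sup>2)"
    using zero_le_power2[of "\<bar>x\<bar> - \<bar>y\<bar>"] by (intro mult_left_mono) (simp_all add: power2_sum power2_diff)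
  also have "\<dots> = l\<^sup>2 * (((u - v) \<bullet> e n)\<^sup>2 + (eta n)\<^sup>2 * ((u - v) \<bullet> e 0)\<^sup>2)"
    by (simp add: x_def y_def power2_eq_square field_simps)
  finally show ?thesis .
qed

lemma lipschitz_F:
  assumes M: "l + \<delta> \<le> M" "lam 0 + \<delta> \<le> M" and L: "L \<ge> 0" "M\<^sup>2 + 2 * l\<^sup>2 * h\<^sup>2 \<le> L\<^sup>2"
  shows "L-lipschitz_on UNIV F"
proof (rule lipschitz_onI)
  fix u v
  have M0: "M \<ge> 0" using M(1) l_pos \<delta>_pos by linarith
  have "((F u - F v) \<bullet> e n)\<^sup>2 \<le> M\<^sup>2 * ((u - v) \<bullet> e n)\<^sup>2 + l\<^sup>2 * ((u - v) \<bullet> e 0)\<^sup>2 * (eta n)\<^sup>2" for n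
  proof (cases "n = 0")
    case True
    have "(F u \<bullet> e 0 - F v \<bullet> e 0)\<^sup>2 \<le> M\<^sup>2 * ((u - v) \<bullet> e 0)\<^sup>2"
      using power_mono[OF F_difference_0[OF M, of u v], of 2] by (simp add: power_mult_distrib)
    then show ?thesis using True by (simp add: inner_diff_left[of "F u"] add_increasing2)
  next
    case False
    have "l\<^sup>2 * ((u - v) \<bullet> e n)\<^sup>2 \<le> M\<^sup>2 * ((u - v) \<bullet> e n)\<^sup>2"
      using M(1) l_pos \<delta>_pos by (intro mult_right_mono power_mono) auto
    then show ?thesis using F_difference_Suc[of n u v] False
      by (simp add: inner_diff_left[of "F u"] distrib_left mult.commute mult.left_commute)
  qed
  from square_sums_le(2)[OF this]
  have "(norm (F u - F v))\<^sup>2 \<le> (M\<^sup>2 + 2 * l\<^sup>2 * h\<^sup>2) * (norm (u - v))\<^sup>2"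
    using parseval[of "F u - F v"] by (simp add: sums_iff)
  also have "\<dots> \<le> L\<^sup>2 * (norm (u - v))\<^sup>2" using L(2) by (rule mult_right_mono) simp
  finally have "(norm (F u - F v))\<^sup>2 \<le> (L * norm (u - v))\<^sup>2" by (simp add: power_mult_distrib)
  then show "dist (F u) (F v) \<le> L * dist u v"
    unfolding dist_norm by (rule power2_le_imp_le) (use L in simp)
qed (rule L)

lemma F_near_zero:
  assumes "norm u \<le> 1 / (1 + h)"
  shows "F u = - l *\<^sub>R u"
proof (rule coeff_eqI)
  fix n
  have c: "\<bar>u \<bullet> e k\<bar> \<le> norm u" for k using Cauchy_Schwarz_ineq2[of u "e k"] by simp
  have u1: "norm u * (1 + h) \<le> 1" using assms h_pos by (simp add: field_simps)
  have u2: "norm u \<le> 1" using u1 h_pos mult_left_mono[of 1 "1 + h" "norm u"] by simp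
  show "F u \<bullet> e n = (- l *\<^sub>R u) \<bullet> e n"
  proof (cases "n = 0")
    case True
    have 1: "\<bar>u \<bullet> e 0\<bar> \<le> 1" using c[of 0] u2 by linarith
    have 2: "\<bar>(u \<bullet> e 0) / stretch\<bar> \<le> 1"
      using 1 stretch_gt_1 by (simp add: abs_divide divide_le_eq)
    have "amp / stretch = \<delta>" using amp_pos \<delta>_pos by (simp add: stretch_def)
    then have "F u \<bullet> e 0 = lam 0 * (u \<bullet> e 0) - amp * (u \<bullet> e 0) + \<delta> * (u \<bullet> e 0)"
      unfolding F_coeff_0 D_id[OF 1] D_id[OF 2] by (metis times_divide_eq_left times_divide_eq_right)
    then show ?thesis using True by (simp add: amp_def algebra_simps)
  next
    case False
    have "eta n * \<bar>u \<bullet> e 0\<bar> \<le> h * norm u" using eta_le eta_pos c h_pos by (intro mult_mono) (auto intro: less_imp_le)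
    then have "\<bar>u \<bullet> e n\<bar> + \<bar>eta n * (u \<bullet> e 0)\<bar> \<le> 1"
      using c[of n] u1 eta_pos[of n] by (simp add: abs_mult algebra_simps)
    then have "\<bar>u \<bullet> e n + eta n * (u \<bullet> e 0)\<bar> \<le> 1" "\<bar>u \<bullet> e n - eta n * (u \<bullet> e 0)\<bar> \<le> 1" by linarith+
    then show ?thesis using False by (simp add: F_coeff_Suc D_id algebra_simps add_divide_distrib)
  qed
qed

text \<open>The first coordinate is made so large that all truncations in the components up to \<open>N\<close> are saturated; in the
components beyond, the oddness of the truncation gives \<open>F = 0\<close> on the axis.\<close>

lemma F_far:
  "\<exists>B. \<forall>n\<le>N. \<forall>y. \<bar>y\<bar> \<le> 1 \<longrightarrow> F (B *\<^sub>R e 0 + y *\<^sub>R e n) = (lam 0 * B) *\<^sub>R e 0 + (diag n * y) *\<^sub>R e n"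
proof -
  \<comment> \<open>saturates both truncations of the first component and those of the components up to \<open>N\<close>, also after a shift
    of one coordinate by at most \<open>1\<close>\<close>
  define B where "B = 2 * stretch + 1 + 3 / eta N"
  have B_ge: "B \<ge> 2 * stretch + 1" using eta_pos[of N] by (simp add: B_def)
  have eta_B: "eta n * B \<ge> 3" if "n \<le> N" for n
  proof -
    have "3 = eta N * (3 / eta N)" using eta_pos[of N] by simp
    also have "\<dots> \<le> eta n * B"
      using eta_antimono[OF that] eta_pos[of n] eta_pos[of N] stretch_gt_1 by (intro mult_mono) (auto simp: B_def)
    finally show ?thesis .
  qed
  have sat0: "lam 0 * x - amp * D 0 x + amp * D 0 (x / stretch) = lam 0 * x" if "x \<ge> 2 * stretch" for x
    using that stretch_gt_1 D_const[of x] D_const[of "x / stretch"] by (simp add: pos_le_divide_eq)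
  show ?thesis
  proof (intro exI[of _ B] allI impI)
    fix n y assume n: "n \<le> N" and y: "\<bar>y\<bar> \<le> (1::real)"
    let ?u = "B *\<^sub>R e 0 + y *\<^sub>R e n"
    show "F ?u = (lam 0 * B) *\<^sub>R e 0 + (diag n * y) *\<^sub>R e n"
    proof (rule coeff_eqI)
      fix m
      have u0: "?u \<bullet> e 0 \<ge> 2 * stretch" using B_ge y by (auto simp: inner_add_left orth)
      show "F ?u \<bullet> e m = ((lam 0 * B) *\<^sub>R e 0 + (diag n * y) *\<^sub>R e n) \<bullet> e m"
      proof (cases "m = 0")
        case True
        then show ?thesis
          using sat0[OF u0] by (auto simp: F_coeff_0 inner_add_left orth diag_def algebra_simps)
      next
        case m: False
        show ?thesis
        proof (cases "m = n")
          case True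
          then have n0: "n \<noteq> 0" using m by simp
          have u: "?u \<bullet> e n = y" "?u \<bullet> e 0 = B" using n0 by (simp_all add: inner_add_left orth)
          have "D 0 (y + eta n * B) = c" "D 0 (- (y - eta n * B)) = c"
            using eta_B[OF n] y by (intro D_const; linarith)+
          then have "D 0 (y + eta n * B) + D 0 (y - eta n * B) = 0" using D_odd[of "y - eta n * B"] by simp
          then show ?thesis
            using n0 True F_coeff_Suc[of n ?u] unfolding u by (simp add: inner_add_left orth diag_def)
        next
          case False
          have "?u \<bullet> e m = 0" using m False by (simp add: inner_add_left orth)
          then show ?thesis
            using m False F_coeff_Suc[of m ?u] D_odd[of "eta m * (?u \<bullet> e 0)"] by (simp add: inner_add_left orth)
        qed
      qed
    qed
  qed
qed

end

section \<open>The energy space as a Hilbert space\<close>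

text \<open>Positivity of \<open>nV h\<close> matters because the quotient in the operator norm is \<open>0\<close> when \<open>nV h = 0\<close>.\<close>

lemma op_norm_bound:
  assumes "op_norm V nV nW f \<le> ereal C" "h \<in> V" "nV h > 0"
  shows "nW (f h) \<le> C * nV h"
proof -
  have "ereal (nW (f h) / nV h) \<le> op_norm V nV nW f"
    unfolding op_norm_def by (rule SUP_upper) fact
  then have "nW (f h) / nV h \<le> C" using assms(1) by (metis ereal_less_eq(3) order_trans)
  then show ?thesis using assms(3) by (simp add: field_simps)
qed

locale wave = damped_wave eps lam e F + hilbert_basis e
  for eps :: real and lam :: "nat \<Rightarrow> real" and e :: "nat \<Rightarrow> 'a::{real_inner, complete_space}"
    and F :: "'a \<Rightarrow> 'a" +
  fixes L :: real
  assumes lam_pos: "lam n > 0"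
    and lam_mono: "mono lam"
    and eps_nonneg: "eps \<ge> 0"
    and F_lipschitz: "L-lipschitz_on UNIV F"
begin

text \<open>The two norms of the velocity are merged into one weighted norm. It has the right meaning for
\<open>eps = 0\<close> too, where the first summand of the energy norm is \<open>0\<close> times a meaningless number.\<close>

definition weight :: "nat \<Rightarrow> real" where "weight n = eps + 1 / lam n"

lemma weight_pos: "weight n > 0"
  using lam_pos[of n] eps_nonneg by (simp add: weight_def add_nonneg_pos)

lemma lam_nonneg [simp]: "lam n \<ge> 0" and lam_neq_0 [simp]: "lam n \<noteq> 0" and weight_nonneg [simp]: "weight n \<ge> 0"
  using lam_pos[of n] weight_pos[of n] by (simp_all add: less_imp_le)

lemma powr_lam: "lam n powr 1 = lam n" "lam n powr 0 = 1" "lam n powr (-1) = 1 / lam n"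
  using lam_pos[of n] by (simp_all add: powr_minus inverse_eq_divide)

lemma summable_weighted:
  assumes "\<And>n. a n \<ge> 0"
  shows "summable (\<lambda>n. a n * (c n)\<^sup>2) \<longleftrightarrow> summable (\<lambda>n. (sqrt (a n) * c n)\<^sup>2)"
  using assms by (simp add: power_mult_distrib)

lemma Hs_subspace: "subspace (Hs lam s)"
proof (rule subspaceI)
  show "0 \<in> Hs lam s" by (simp add: Hs_def zero_fun_def)
  have iff: "c \<in> Hs lam s \<longleftrightarrow> summable (\<lambda>n. (sqrt (lam n powr s) * c n)\<^sup>2)" for c
    by (simp add: Hs_def summable_weighted)
  fix c d and r :: real assume c: "c \<in> Hs lam s"
  show r: "r *\<^sub>R c \<in> Hs lam s" for r
    using summable_mult[of "\<lambda>n. (sqrt (lam n powr s) * c n)\<^sup>2" "r\<^sup>2"] c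
    by (simp add: iff scaleR_fun_def power_mult_distrib algebra_simps)
  assume d: "d \<in> Hs lam s"
  have "summable (\<lambda>n. (- (sqrt (lam n powr s) * d n))\<^sup>2)" using d by (simp add: iff)
  from summable_square_diff[OF c[unfolded iff] this]
  show "c + d \<in> Hs lam s" by (simp add: iff plus_fun_def algebra_simps)
qed

lemma E_space_iff:
  "(u, v) \<in> E_space \<longleftrightarrow> summable (\<lambda>n. lam n * (u \<bullet> e n)\<^sup>2) \<and> summable (\<lambda>n. weight n * (v n)\<^sup>2)"
proof -
  have "summable (\<lambda>n. weight n * (v n)\<^sup>2) \<longleftrightarrow> summable (\<lambda>n. (v n)\<^sup>2)" if "eps \<noteq> 0"
  proof
    have eps: "eps > 0" using that eps_nonneg by simp
    assume "summable (\<lambda>n. weight n * (v n)\<^sup>2)"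
    then have s: "summable (\<lambda>n. (1 / eps) * (weight n * (v n)\<^sup>2))" by (rule summable_mult)
    show "summable (\<lambda>n. (v n)\<^sup>2)"
    proof (rule summable_comparison_test'[OF s])
      fix n
      have "eps * (v n)\<^sup>2 \<le> weight n * (v n)\<^sup>2"
        using lam_pos[of n] by (intro mult_right_mono) (simp_all add: weight_def)
      then show "norm ((v n)\<^sup>2) \<le> (1 / eps) * (weight n * (v n)\<^sup>2)" using eps by (simp add: field_simps)
    qed
  next
    assume "summable (\<lambda>n. (v n)\<^sup>2)"
    then have s: "summable (\<lambda>n. weight 0 * (v n)\<^sup>2)" by (rule summable_mult)
    show "summable (\<lambda>n. weight n * (v n)\<^sup>2)"
    proof (rule summable_comparison_test'[OF s])
      fix n
      have "weight n \<le> weight 0"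
        using monoD[OF lam_mono, of 0 n] lam_pos[of 0] by (simp add: weight_def frac_le)
      then show "norm (weight n * (v n)\<^sup>2) \<le> weight 0 * (v n)\<^sup>2"
        using weight_pos[of n] by (simp add: mult_right_mono)
    qed
  qed
  then show ?thesis by (auto simp: E_space_def Hs_def coeffs_def powr_lam weight_def)
qed

lemma E_space_subspace: "subspace E_space"
proof -
  have *: "c + d \<in> Hs lam s" "r *\<^sub>R c \<in> Hs lam s" if "c \<in> Hs lam s" "d \<in> Hs lam s" for c d r s
    using Hs_subspace that by (auto simp: subspace_add subspace_scale)
  have "coeffs e (u + u') = coeffs e u + coeffs e u'" "coeffs e (r *\<^sub>R u) = r *\<^sub>R coeffs e u" for u u' r
    by (auto simp: coeffs_def inner_add_left scaleR_fun_def plus_fun_def)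
  moreover have "(\<lambda>n. 0) \<in> Hs lam s" for s by (simp add: Hs_def)
  ultimately show ?thesis
    using * by (auto intro!: subspaceI simp: E_space_def zero_prod_def coeffs_def zero_fun_def)
qed

text \<open>An isometry of the energy space into the square of the Hilbert space; it transports the norm axioms.\<close>

definition isom :: "'a state \<Rightarrow> 'a \<times> 'a" where
  "isom \<xi> = (synth (\<lambda>n. sqrt (lam n) * (fst \<xi> \<bullet> e n)), synth (\<lambda>n. sqrt (weight n) * snd \<xi> n))"

lemma E_space_summable:
  assumes "\<xi> \<in> E_space"
  shows "summable (\<lambda>n. (sqrt (lam n) * (fst \<xi> \<bullet> e n))\<^sup>2)"
    and "summable (\<lambda>n. (sqrt (weight n) * snd \<xi> n)\<^sup>2)"
  using assms by (cases \<xi>; simp add: E_space_iff power_mult_distrib)+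

lemma isom_coeff:
  assumes "\<xi> \<in> E_space"
  shows "fst (isom \<xi>) \<bullet> e n = sqrt (lam n) * (fst \<xi> \<bullet> e n)"
    and "snd (isom \<xi>) \<bullet> e n = sqrt (weight n) * snd \<xi> n"
  using E_space_summable[OF assms] by (simp_all add: isom_def synth_coeff)

lemma isom_add: "isom (\<xi> + \<zeta>) = isom \<xi> + isom \<zeta>" if "\<xi> \<in> E_space" "\<zeta> \<in> E_space"
  using that subspace_add[OF E_space_subspace that]
  by (intro prod_eqI coeff_eqI) (simp_all add: isom_coeff inner_add_left algebra_simps)

lemma isom_scale: "isom (r *\<^sub>R \<xi>) = r *\<^sub>R isom \<xi>" if "\<xi> \<in> E_space"
  using that subspace_scale[OF E_space_subspace that]
  by (intro prod_eqI coeff_eqI) (simp_all add: isom_coeff scaleR_fun_def)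

lemma isom_diff: "isom (\<xi> - \<zeta>) = isom \<xi> - isom \<zeta>" if "\<xi> \<in> E_space" "\<zeta> \<in> E_space"
  using that subspace_diff[OF E_space_subspace that]
  by (intro prod_eqI coeff_eqI) (simp_all add: isom_coeff inner_diff_left algebra_simps)

lemma E_norm_sq:
  assumes "\<xi> \<in> E_space"
  shows "(E_norm \<xi>)\<^sup>2 = (\<Sum>n. lam n * (fst \<xi> \<bullet> e n)\<^sup>2) + (\<Sum>n. weight n * (snd \<xi> n)\<^sup>2)"
    and "E_norm \<xi> \<ge> 0"
proof -
  obtain u v where \<xi>: "\<xi> = (u, v)" by (cases \<xi>)
  have su: "summable (\<lambda>n. lam n * (u \<bullet> e n)\<^sup>2)" and sv: "summable (\<lambda>n. weight n * (v n)\<^sup>2)"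
    using assms by (simp_all add: \<xi> E_space_iff)
  have sv1: "summable (\<lambda>n. (1 / lam n) * (v n)\<^sup>2)"
  proof (rule summable_comparison_test'[OF sv])
    fix n show "norm ((1 / lam n) * (v n)\<^sup>2) \<le> weight n * (v n)\<^sup>2"
      using eps_nonneg lam_pos[of n] by (simp add: weight_def distrib_right abs_mult)
  qed
  have sv0: "eps \<noteq> 0 \<Longrightarrow> summable (\<lambda>n. (v n)\<^sup>2)"
    using assms by (simp add: \<xi> E_space_def Hs_def powr_lam)
  have H: "(Hs_norm lam 1 (coeffs e u))\<^sup>2 = (\<Sum>n. lam n * (u \<bullet> e n)\<^sup>2)"
    "(Hs_norm lam (-1) v)\<^sup>2 = (\<Sum>n. (1 / lam n) * (v n)\<^sup>2)"
    using suminf_nonneg[OF su] suminf_nonneg[OF sv1]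
    by (simp_all add: Hs_norm_def powr_lam coeffs_def)
  have v: "eps * (Hs_norm lam 0 v)\<^sup>2 + (Hs_norm lam (-1) v)\<^sup>2 = (\<Sum>n. weight n * (v n)\<^sup>2)"
  proof (cases "eps = 0")
    case True
    have "weight = (\<lambda>n. 1 / lam n)" unfolding weight_def using True by simp
    then show ?thesis unfolding H using True by simp
  next
    case False
    have "(Hs_norm lam 0 v)\<^sup>2 = (\<Sum>n. (v n)\<^sup>2)"
      using suminf_nonneg[OF sv0[OF False]] by (simp add: Hs_norm_def powr_lam)
    then show ?thesis
      unfolding H weight_def
      by (simp only: distrib_right suminf_add[OF summable_mult[OF sv0[OF False]] sv1, symmetric]
            suminf_mult[OF sv0[OF False]])
  qed
  show "(E_norm \<xi>)\<^sup>2 = (\<Sum>n. lam n * (fst \<xi> \<bullet> e n)\<^sup>2) + (\<Sum>n. weight n * (snd \<xi> n)\<^sup>2)"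
    using eps_nonneg by (simp add: E_norm_def \<xi> v[symmetric] H(1)[symmetric])
  show "E_norm \<xi> \<ge> 0" using eps_nonneg by (simp add: E_norm_def \<xi>)
qed

lemma E_norm_isom: "E_norm \<xi> = norm (isom \<xi>)" if "\<xi> \<in> E_space"
proof (rule power2_eq_imp_eq)
  have "(norm (isom \<xi>))\<^sup>2 = (norm (fst (isom \<xi>)))\<^sup>2 + (norm (snd (isom \<xi>)))\<^sup>2"
    by (simp add: norm_prod_def)
  also have "\<dots> = (E_norm \<xi>)\<^sup>2"
    unfolding isom_def fst_conv snd_conv
    using E_space_summable[OF that]
    by (simp add: norm_synth E_norm_sq[OF that] power_mult_distrib)
  finally show "(E_norm \<xi>)\<^sup>2 = (norm (isom \<xi>))\<^sup>2" ..
qed (use E_norm_sq[OF that] in simp_all)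

lemma E_norm_zero [simp]: "E_norm 0 = 0"
proof -
  have "0 \<in> E_space" by (rule subspace_0[OF E_space_subspace])
  then show ?thesis using isom_scale[of 0 0] by (simp add: E_norm_isom)
qed

lemma E_norm_scale: "E_norm (r *\<^sub>R \<xi>) = \<bar>r\<bar> * E_norm \<xi>" if "\<xi> \<in> E_space"
  using that subspace_scale[OF E_space_subspace that] by (simp add: E_norm_isom isom_scale)

lemma E_norm_add_le: "E_norm (\<xi> + \<zeta>) \<le> E_norm \<xi> + E_norm \<zeta>" if "\<xi> \<in> E_space" "\<zeta> \<in> E_space"
  using that subspace_add[OF E_space_subspace that]
  by (simp add: E_norm_isom isom_add norm_triangle_ineq)

lemma coeff_le_E_norm:
  assumes "\<xi> \<in> E_space"
  shows "sqrt (lam n) * \<bar>fst \<xi> \<bullet> e n\<bar> \<le> E_norm \<xi>" "sqrt (weight n) * \<bar>snd \<xi> n\<bar> \<le> E_norm \<xi>"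
proof -
  have *: "\<bar>x \<bullet> e n\<bar> \<le> norm x" for x using Cauchy_Schwarz_ineq2[of x "e n"] by simp
  have "norm (fst (isom \<xi>)) \<le> E_norm \<xi>" "norm (snd (isom \<xi>)) \<le> E_norm \<xi>"
    using norm_fst_le[of "fst (isom \<xi>)" "snd (isom \<xi>)"] norm_snd_le[of "snd (isom \<xi>)" "fst (isom \<xi>)"] assms by (simp_all add: E_norm_isom)
  with *[of "fst (isom \<xi>)"] *[of "snd (isom \<xi>)"]
  show "sqrt (lam n) * \<bar>fst \<xi> \<bullet> e n\<bar> \<le> E_norm \<xi>" "sqrt (weight n) * \<bar>snd \<xi> n\<bar> \<le> E_norm \<xi>"
    using lam_pos[of n] weight_pos[of n] by (auto simp: isom_coeff[OF assms] abs_mult)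
qed

lemma E_norm_eq_0D: "\<xi> = 0" if "\<xi> \<in> E_space" "E_norm \<xi> \<le> 0"
proof -
  have "fst \<xi> \<bullet> e n = 0" "snd \<xi> n = 0" for n
    using coeff_le_E_norm[OF that(1), of n] that(2) lam_pos[of n] weight_pos[of n]
    by (auto simp: mult_le_0_iff dest!: order_trans[OF _ that(2)])
  then show ?thesis by (intro prod_eqI coeff_eqI) auto
qed

lemma norm_fst_le_E_norm:
  assumes "\<xi> \<in> E_space"
  shows "sqrt (lam 0) * norm (fst \<xi>) \<le> E_norm \<xi>"
proof (rule power2_le_imp_le)
  have s: "summable (\<lambda>n. lam n * (fst \<xi> \<bullet> e n)\<^sup>2)" "summable (\<lambda>n. weight n * (snd \<xi> n)\<^sup>2)"
    using assms by (cases \<xi>; simp add: E_space_iff)+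
  have "lam 0 * (norm (fst \<xi>))\<^sup>2 = (\<Sum>n. lam 0 * (fst \<xi> \<bullet> e n)\<^sup>2)"
    using parseval[of "fst \<xi>"] by (simp add: sums_iff suminf_mult)
  also have "\<dots> \<le> (\<Sum>n. lam n * (fst \<xi> \<bullet> e n)\<^sup>2)"
    by (intro suminf_le s summable_mult summable_coeff mult_right_mono monoD[OF lam_mono]) auto
  also have "\<dots> \<le> (E_norm \<xi>)\<^sup>2"
    using suminf_nonneg[OF s(2)] by (simp add: E_norm_sq[OF assms])
  finally show "(sqrt (lam 0) * norm (fst \<xi>))\<^sup>2 \<le> (E_norm \<xi>)\<^sup>2"
    using lam_pos[of 0] by (simp add: power_mult_distrib)
qed (use E_norm_sq(2)[OF assms] in simp)

lemma phase_E_space: "\<xi> \<in> phase \<Longrightarrow> \<xi> \<in> E_space"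
  by (auto simp: phase_def split: if_splits)

end

section \<open>Uniqueness of solutions\<close>

context wave begin

lemma Hs_coeff_le:
  assumes "c \<in> Hs lam (-1)"
  shows "\<bar>c n\<bar> \<le> sqrt (lam n) * Hs_norm lam (-1) c"
proof -
  have s: "summable (\<lambda>n. (c n)\<^sup>2 / lam n)"
    using assms by (simp add: Hs_def powr_lam)
  have "(\<Sum>k\<in>{n}. (c k)\<^sup>2 / lam k) \<le> (\<Sum>k. (c k)\<^sup>2 / lam k)"
    by (rule sum_le_suminf) (auto intro: s)
  then have "sqrt ((c n)\<^sup>2 / lam n) \<le> Hs_norm lam (-1) c"
    by (simp add: Hs_norm_def powr_lam)
  then show ?thesis using lam_pos[of n] by (simp add: real_sqrt_divide field_simps)
qed

text \<open>Convergence in the negative Sobolev norm implies convergence of each coefficient, so that the equation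
splits into scalar equations coupled only through \<open>F\<close>.\<close>

lemma Hs_derivative_coeff:
  assumes "has_Hs_derivative lam (-1) f d t" "t \<ge> 0"
  shows "((\<lambda>r. f r n) has_real_derivative d n) (at t within {0..})"
proof -
  let ?q = "\<lambda>r. inverse (r - t) *\<^sub>R (f r - f t) - d"
  have lim: "((\<lambda>r. Hs_norm lam (-1) (?q r)) \<longlongrightarrow> 0) (at t within {0..})"
    using assms by (simp add: has_Hs_derivative_def)
  have mem: "?q r \<in> Hs lam (-1)" if "r \<ge> 0" for r
    using assms that by (auto simp: has_Hs_derivative_def intro!: subspace_diff subspace_scale Hs_subspace)
  have "((\<lambda>r. ?q r n) \<longlongrightarrow> 0) (at t within {0..})"
  proof (rule Lim_null_comparison)
    show "((\<lambda>r. sqrt (lam n) * Hs_norm lam (-1) (?q r)) \<longlongrightarrow> 0) (at t within {0..})"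
      using tendsto_mult_right_zero[OF lim] .
    show "\<forall>\<^sub>F r in at t within {0..}. norm (?q r n) \<le> sqrt (lam n) * Hs_norm lam (-1) (?q r)"
      using Hs_coeff_le[OF mem] by (auto simp: eventually_at_filter simp del: fun_diff_def minus_apply)
  qed
  then have "((\<lambda>r. (f r n - f t n) / (r - t) - d n) \<longlongrightarrow> 0) (at t within {0..})"
    by (simp add: scaleR_fun_def divide_inverse mult.commute)
  then show ?thesis
    unfolding has_field_derivative_iff using Lim_null by blast
qed

lemma solution_modes:
  assumes "solution \<xi>" "t \<ge> 0"
  shows "((\<lambda>r. fst (\<xi> r) \<bullet> e n) has_real_derivative snd (\<xi> t) n) (at t within {0..})"
    and "\<exists>w. (eps \<noteq> 0 \<longrightarrow> ((\<lambda>r. snd (\<xi> r) n) has_real_derivative w) (at t within {0..})) \<and>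
         eps * w + snd (\<xi> t) n + lam n * (fst (\<xi> t) \<bullet> e n) = F (fst (\<xi> t)) \<bullet> e n"
proof -
  have "has_Hs_derivative lam (-1) (\<lambda>r. coeffs e (fst (\<xi> r))) (snd (\<xi> t)) t"
    using assms by (simp add: solution_def)
  from Hs_derivative_coeff[OF this assms(2), of n]
  show "((\<lambda>r. fst (\<xi> r) \<bullet> e n) has_real_derivative snd (\<xi> t) n) (at t within {0..})"
    by (simp add: coeffs_def)
  obtain w where w: "eps \<noteq> 0 \<longrightarrow> has_Hs_derivative lam (-1) (\<lambda>r. snd (\<xi> r)) w t"
      "eps *\<^sub>R w + snd (\<xi> t) + A_ext lam e (fst (\<xi> t)) = coeffs e (F (fst (\<xi> t)))"
    using assms unfolding solution_def by blast
  have "eps * w n + snd (\<xi> t) n + lam n * (fst (\<xi> t) \<bullet> e n) = F (fst (\<xi> t)) \<bullet> e n"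
    using fun_cong[OF w(2), of n] by (simp add: scaleR_fun_def A_ext_def coeffs_def)
  then show "\<exists>w. (eps \<noteq> 0 \<longrightarrow> ((\<lambda>r. snd (\<xi> r) n) has_real_derivative w) (at t within {0..})) \<and>
         eps * w + snd (\<xi> t) n + lam n * (fst (\<xi> t) \<bullet> e n) = F (fst (\<xi> t)) \<bullet> e n"
    using w(1) Hs_derivative_coeff[OF _ assms(2), of "\<lambda>r. snd (\<xi> r)" w n] by (intro exI[of _ "w n"]) auto
qed

lemma solution_continuous:
  assumes "solution \<xi>"
  shows "continuous_on {0..} (\<lambda>t. fst (\<xi> t))"
  unfolding continuous_on_def
proof
  fix t :: real assume t: "t \<in> {0..}"
  have mem: "\<xi> r \<in> E_space" if "r \<ge> 0" for r
    using assms that phase_E_space by (auto simp: solution_def)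
  have lim: "((\<lambda>r. E_norm (\<xi> r - \<xi> t)) \<longlongrightarrow> 0) (at t within {0..})"
    using assms t by (auto simp: solution_def)
  have "((\<lambda>r. fst (\<xi> r) - fst (\<xi> t)) \<longlongrightarrow> 0) (at t within {0..})"
  proof (rule Lim_null_comparison)
    show "((\<lambda>r. inverse (sqrt (lam 0)) * E_norm (\<xi> r - \<xi> t)) \<longlongrightarrow> 0) (at t within {0..})"
      using tendsto_mult_right_zero[OF lim] .
    show "\<forall>\<^sub>F r in at t within {0..}. norm (fst (\<xi> r) - fst (\<xi> t)) \<le> inverse (sqrt (lam 0)) * E_norm (\<xi> r - \<xi> t)"
      using norm_fst_le_E_norm[OF subspace_diff[OF E_space_subspace mem mem]] t lam_pos[of 0]
      by (auto simp: eventually_at_filter field_simps)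
  qed
  then show "((\<lambda>t. fst (\<xi> t)) \<longlongrightarrow> fst (\<xi> t)) (at t within {0..})"
    using Lim_null by blast
qed

text \<open>The energy \<open>\<epsilon> z\<^sub>n\<^sup>2 + \<lambda>\<^sub>n d\<^sub>n\<^sup>2\<close> of the difference grows in each mode at the rate
\<open>2 z\<^sub>n (g\<^sub>n - z\<^sub>n) \<le> g\<^sub>n\<^sup>2 / 2\<close>, where \<open>g\<close> is the difference of the nonlinear terms. The same
formula holds for \<open>\<epsilon> = 0\<close>. As \<open>F\<close> is Lipschitz, summation over the modes gives a Gronwall inequality for the norm of the
difference.\<close>

theorem solution_unique:
  assumes sol: "solution \<xi>" "solution \<zeta>" and init: "\<xi> 0 = \<zeta> 0" and "T \<ge> 0"
  shows "\<xi> T = \<zeta> T"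
proof -
  define d where "d t n = (fst (\<xi> t) - fst (\<zeta> t)) \<bullet> e n" for t n
  define z where "z t n = snd (\<xi> t) n - snd (\<zeta> t) n" for t n
  define g where "g t n = (F (fst (\<xi> t)) - F (fst (\<zeta> t))) \<bullet> e n" for t n
  define E where "E m t = (\<Sum>n<m. eps * (z t n)\<^sup>2 + lam n * (d t n)\<^sup>2)" for m t
  define D where "D t = (norm (fst (\<xi> t) - fst (\<zeta> t)))\<^sup>2" for t
  have L0: "L \<ge> 0" using F_lipschitz by (rule lipschitz_on_nonneg)
  have d_deriv: "((\<lambda>t. d t n) has_real_derivative z t n) (at t within {0..})" if "t \<ge> 0" for t n
    using DERIV_diff[OF solution_modes(1)[OF sol(1) that] solution_modes(1)[OF sol(2) that]]
    by (simp add: d_def z_def inner_diff_left)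
  have mode_energy: "((\<lambda>t. eps * (z t n)\<^sup>2 + lam n * (d t n)\<^sup>2) has_real_derivative 2 * z t n * (g t n - z t n))
      (at t within {0..})" if t: "t \<ge> 0" for t n
  proof -
    obtain w1 where w1: "eps \<noteq> 0 \<longrightarrow> ((\<lambda>r. snd (\<xi> r) n) has_real_derivative w1) (at t within {0..})"
         "eps * w1 + snd (\<xi> t) n + lam n * (fst (\<xi> t) \<bullet> e n) = F (fst (\<xi> t)) \<bullet> e n"
      using solution_modes(2)[OF sol(1) t] by blast
    obtain w2 where w2: "eps \<noteq> 0 \<longrightarrow> ((\<lambda>r. snd (\<zeta> r) n) has_real_derivative w2) (at t within {0..})"
         "eps * w2 + snd (\<zeta> t) n + lam n * (fst (\<zeta> t) \<bullet> e n) = F (fst (\<zeta> t)) \<bullet> e n"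
      using solution_modes(2)[OF sol(2) t] by blast
    have eq: "eps * (w1 - w2) + lam n * d t n = g t n - z t n"
      using w1(2) w2(2) by (simp add: d_def z_def g_def inner_diff_left algebra_simps)
    have dd: "((\<lambda>t. lam n * (d t n)\<^sup>2) has_real_derivative 2 * z t n * (lam n * d t n)) (at t within {0..})"
      by (auto intro!: derivative_eq_intros d_deriv[OF t])
    have "((\<lambda>t. eps * (z t n)\<^sup>2) has_real_derivative 2 * z t n * (eps * (w1 - w2))) (at t within {0..})"
    proof (cases "eps = 0")
      case False
      have "((\<lambda>t. z t n) has_real_derivative w1 - w2) (at t within {0..})"
        unfolding z_def using w1(1) w2(1) False by (intro DERIV_diff) auto
      then show ?thesis by (auto intro!: derivative_eq_intros)
    qed simp
    from DERIV_add[OF this dd] show ?thesis by (simp only: eq[symmetric] distrib_left)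
  qed
  have E_deriv: "(E m has_real_derivative (\<Sum>n<m. 2 * z t n * (g t n - z t n))) (at t within {0..})" if "t \<ge> 0" for m t
    unfolding E_def by (intro DERIV_sum mode_energy that)
  have E_rate: "(\<Sum>n<m. 2 * z t n * (g t n - z t n)) \<le> L\<^sup>2 * D t / 2" for m t
  proof -
    have "(\<Sum>n<m. 2 * z t n * (g t n - z t n)) \<le> (\<Sum>n<m. (g t n)\<^sup>2 / 2)"
    proof (rule sum_mono)
      fix n show "2 * z t n * (g t n - z t n) \<le> (g t n)\<^sup>2 / 2"
        using zero_le_power2[of "2 * z t n - g t n"] by (simp add: power2_eq_square algebra_simps)
    qed
    also have "\<dots> = (\<Sum>n<m. (g t n)\<^sup>2) / 2" by (simp add: sum_divide_distrib)
    also have "(\<Sum>n<m. (g t n)\<^sup>2) \<le> (norm (F (fst (\<xi> t)) - F (fst (\<zeta> t))))\<^sup>2"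
      using sum_le_suminf[OF summable_coeff, of "{..<m}" "F (fst (\<xi> t)) - F (fst (\<zeta> t))"]
        parseval[of "F (fst (\<xi> t)) - F (fst (\<zeta> t))"] by (simp add: g_def sums_iff)
    also have "\<dots> \<le> L\<^sup>2 * D t"
      using power_mono[OF lipschitz_onD[OF F_lipschitz, of "fst (\<xi> t)" "fst (\<zeta> t)"], of 2]
      by (simp add: D_def dist_norm power_mult_distrib)
    finally show ?thesis by simp
  qed
  define k where "k = L\<^sup>2 / lam 0 + 1"
  have k: "k > 0" using lam_pos[of 0] by (simp add: k_def add_nonneg_pos)
  \<comment> \<open>The difference is measured with the weight \<open>exp (- k * t)\<close>; \<open>k\<close> is large enough for the
    energy inequality to halve the weighted maximum, which therefore vanishes. Each finite sum of modes is
    compared with the integrated bound by its derivative.\<close>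
  have "continuous_on {0..T} (\<lambda>t. exp (- k * t) * D t)"
    unfolding D_def
    by (intro continuous_intros continuous_on_subset[OF solution_continuous] sol) auto
  then obtain s where s: "s \<in> {0..T}" "\<And>t. t \<in> {0..T} \<Longrightarrow> exp (- k * t) * D t \<le> exp (- k * s) * D s"
    using continuous_attains_sup[of "{0..T}" "\<lambda>t. exp (- k * t) * D t"] \<open>T \<ge> 0\<close> by auto
  define M where "M = exp (- k * s) * D s"
  have M0: "M \<ge> 0" by (simp add: M_def D_def)
  have D_le: "D t \<le> M * exp (k * t)" if "t \<in> {0..T}" for t
    using s(2)[OF that] by (simp add: M_def exp_minus field_simps)
  have E_le: "E m t \<le> L\<^sup>2 * M * exp (k * t) / (2 * k)" if t: "t \<in> {0..T}" for m t
  proof (cases "t = 0")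
    case True
    have "E m 0 = 0" using init by (simp add: E_def d_def z_def)
    then show ?thesis using True M0 k by simp
  next
    case False
    define G where "G r = L\<^sup>2 * M * exp (k * r) / (2 * k) - E m r" for r
    have G_deriv: "(G has_real_derivative L\<^sup>2 * M * exp (k * r) / 2 - (\<Sum>n<m. 2 * z r n * (g r n - z r n))) (at r within {0..})"
      if "r \<ge> 0" for r
    proof -
      have "((\<lambda>r. L\<^sup>2 * M * exp (k * r) / (2 * k)) has_real_derivative L\<^sup>2 * M * exp (k * r) / 2) (at r within {0..})"
        using k by (auto intro!: derivative_eq_intros simp: field_simps)
      from DERIV_diff[OF this E_deriv[OF that]] show ?thesis by (simp add: G_def[abs_def])
    qed
    have "G 0 \<le> G t"
    proof (rule DERIV_nonneg_imp_increasing_open[of 0 t G])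
      show "0 \<le> t" using t by simp
      fix r assume r: "0 < r" "r < t"
      have "at r within {0..} = at r" by (rule at_within_interior) (use r in simp)
      then have "(G has_real_derivative L\<^sup>2 * M * exp (k * r) / 2 - (\<Sum>n<m. 2 * z r n * (g r n - z r n))) (at r)"
        using G_deriv[of r] r by simp
      moreover have "L\<^sup>2 * M * exp (k * r) / 2 - (\<Sum>n<m. 2 * z r n * (g r n - z r n)) \<ge> 0"
        using E_rate[where t = r and m = m] mult_left_mono[OF D_le[of r], of "L\<^sup>2"] r t by (simp add: mult.assoc)
      ultimately show "\<exists>y. (G has_real_derivative y) (at r) \<and> 0 \<le> y" by blast
    next
      have "continuous_on {0..} G"
        using G_deriv by (auto intro!: DERIV_continuous_on)
      then show "continuous_on {0..t} G" by (rule continuous_on_subset) auto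
    qed
    moreover have "G 0 \<ge> 0" using init M0 k by (simp add: G_def E_def d_def z_def)
    ultimately show ?thesis by (simp add: G_def)
  qed
  have "lam 0 * D s \<le> L\<^sup>2 * M * exp (k * s) / (2 * k)"
  proof (rule LIMSEQ_le_const2)
    have "(\<lambda>m. \<Sum>n<m. (d s n)\<^sup>2) \<longlonglongrightarrow> D s"
      using parseval[of "fst (\<xi> s) - fst (\<zeta> s)"] by (simp add: sums_def d_def D_def)
    then show "(\<lambda>m. lam 0 * (\<Sum>n<m. (d s n)\<^sup>2)) \<longlonglongrightarrow> lam 0 * D s" by (rule tendsto_mult_left)
    have "lam 0 * (\<Sum>n<m. (d s n)\<^sup>2) \<le> L\<^sup>2 * M * exp (k * s) / (2 * k)" for m
    proof -
      have "lam 0 * (\<Sum>n<m. (d s n)\<^sup>2) \<le> E m s"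
        unfolding E_def sum_distrib_left using eps_nonneg
        by (intro sum_mono) (simp add: add_increasing mult_right_mono monoD[OF lam_mono])
      then show ?thesis using E_le[OF s(1), of m] by linarith
    qed
    then show "\<exists>N. \<forall>m\<ge>N. lam 0 * (\<Sum>n<m. (d s n)\<^sup>2) \<le> L\<^sup>2 * M * exp (k * s) / (2 * k)" by blast
  qed
  moreover have "D s = M * exp (k * s)" by (simp add: M_def exp_minus field_simps)
  ultimately have "(lam 0 * M) * exp (k * s) \<le> (L\<^sup>2 * M / (2 * k)) * exp (k * s)" by (simp add: mult.assoc)
  then have "lam 0 * M \<le> L\<^sup>2 * M / (2 * k)" by (intro mult_right_le_imp_le[of "lam 0 * M" "exp (k * s)"]) auto
  then have "2 * k * lam 0 * M \<le> L\<^sup>2 * M" using k by (simp add: field_simps)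
  moreover have "k * lam 0 = L\<^sup>2 + lam 0" using lam_pos[of 0] by (simp add: k_def field_simps)
  moreover have "2 * k * lam 0 * M = 2 * (k * lam 0) * M" by simp
  ultimately have "2 * (L\<^sup>2 + lam 0) * M \<le> L\<^sup>2 * M" by simp
  then have "(L\<^sup>2 + 2 * lam 0) * M \<le> 0" by (simp add: algebra_simps)
  moreover have "L\<^sup>2 + 2 * lam 0 > 0" using lam_pos[of 0] by (simp add: add_nonneg_pos)
  ultimately have "M \<le> 0" by (simp add: mult_le_0_iff)
  then have "D t \<le> 0" if "t \<in> {0..T}" for t
    using D_le[OF that] M0 by simp
  then have u: "fst (\<xi> t) = fst (\<zeta> t)" if "t \<in> {0..T}" for t
    using that by (auto simp: D_def)
  show ?thesis
  proof (cases "T = 0")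
    case True then show ?thesis using init by simp
  next
    case False
    then have T: "T > 0" using \<open>T \<ge> 0\<close> by simp
    have "snd (\<xi> T) n = snd (\<zeta> T) n" for n
    proof -
      have zero: "d t n = 0" if "t \<in> {0..T}" for t using u[OF that] by (simp add: d_def)
      have "((\<lambda>t. d t n) has_real_derivative z T n) (at T within {0..T})"
        by (rule DERIV_subset[OF d_deriv]) (use T in auto)
      then have "((\<lambda>t. 0) has_real_derivative z T n) (at T within {0..T})"
        by (rule has_field_derivative_transform_within[OF _ zero_less_one]) (use zero T in auto)
      moreover have "((\<lambda>t. 0) has_real_derivative 0) (at T within {0..T})" by simp
      moreover have "at T within {0..T} \<noteq> bot" using T by (simp add: at_within_Icc_at_left)
      ultimately have "z T n = 0"
        by (metis has_real_derivative_iff_has_vector_derivative vector_derivative_unique_within)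
      then show ?thesis by (simp add: z_def)
    qed
    then show ?thesis using u[of T] T by (intro prod_eqI) auto
  qed
qed

lemma S_eqI:
  assumes "solution \<xi>" "t \<ge> 0"
  shows "S t (\<xi> 0) = \<xi> t"
  unfolding S_def
proof (rule the_equality)
  show "\<exists>\<zeta>. solution \<zeta> \<and> \<zeta> 0 = \<xi> 0 \<and> \<zeta> t = \<xi> t" using assms by blast
  fix \<eta> assume "\<exists>\<zeta>. solution \<zeta> \<and> \<zeta> 0 = \<xi> 0 \<and> \<zeta> t = \<eta>"
  then show "\<eta> = \<xi> t" using solution_unique[OF _ assms(1) _ assms(2)] by blast
qed

end

section \<open>Explicit one-mode solutions near an equilibrium\<close>

definition single :: "nat \<Rightarrow> real \<Rightarrow> nat \<Rightarrow> real" where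
  "single n y = (\<lambda>m. if m = n then y else 0)"

lemma single_sums: "(\<lambda>m. a m * (single n y m)\<^sup>2) sums (a n * y\<^sup>2 :: real)"
proof -
  have "(\<lambda>m. if m = n then a m * y\<^sup>2 else 0) sums (a n * y\<^sup>2)" by (rule sums_single)
  moreover have "(\<lambda>m. if m = n then a m * y\<^sup>2 else 0) = (\<lambda>m. a m * (single n y m)\<^sup>2)"
    by (auto simp: single_def)
  ultimately show ?thesis by simp
qed

lemma single_Hs [simp]: "single n y \<in> Hs lam s"
  using single_sums by (auto simp: Hs_def sums_iff)

lemma single_add: "single n (x + y) = single n x + single n y"
  and single_diff: "single n (x - y) = single n x - single n y"
  and single_scale: "single n (c * y) = c *\<^sub>R single n y"
  by (simp_all add: single_def scaleR_fun_def fun_eq_iff)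

context wave begin

lemma Hs_norm_single: "Hs_norm lam (-1) (single n y) = \<bar>y\<bar> / sqrt (lam n)"
  using single_sums[of "\<lambda>n. lam n powr (-1)" n y]
  by (simp add: Hs_norm_def powr_lam sums_iff real_sqrt_divide)

definition mode :: "nat \<Rightarrow> real \<Rightarrow> real \<Rightarrow> 'a state" where
  "mode n x y = (x *\<^sub>R e n, single n y)"

lemma mode_add: "mode n (x + x') (y + y') = mode n x y + mode n x' y'"
  and mode_diff: "mode n (x - x') (y - y') = mode n x y - mode n x' y'"
  and mode_scale: "mode n (c * x) (c * y) = c *\<^sub>R mode n x y"
  by (simp_all add: mode_def single_add single_diff single_scale scaleR_add_left scaleR_diff_left)

lemma mode_sums:
  "(\<lambda>m. lam m * (fst (mode n x y) \<bullet> e m)\<^sup>2) sums (lam n * x\<^sup>2)"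
  "(\<lambda>m. weight m * (snd (mode n x y) m)\<^sup>2) sums (weight n * y\<^sup>2)"
proof -
  have "fst (mode n x y) \<bullet> e m = single n x m" for m
    by (simp add: mode_def single_def orth)
  then show "(\<lambda>m. lam m * (fst (mode n x y) \<bullet> e m)\<^sup>2) sums (lam n * x\<^sup>2)"
    using single_sums[of lam n x] by simp
qed (use single_sums[of weight n y] in \<open>simp add: mode_def\<close>)

lemma mode_E_space [simp]: "mode n x y \<in> E_space"
  using mode_sums[of n x y] unfolding sums_iff
  by (cases "mode n x y") (simp add: E_space_iff)

lemma E_norm_mode: "E_norm (mode n x y) = sqrt (lam n * x\<^sup>2 + weight n * y\<^sup>2)"
  using E_norm_sq[OF mode_E_space, of n x y] mode_sums[of n x y]
  by (intro real_sqrt_unique[symmetric]) (simp_all add: sums_iff)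

lemma E_norm_mode_le: "E_norm (mode n x y) \<le> sqrt (lam n) * \<bar>x\<bar> + sqrt (weight n) * \<bar>y\<bar>"
  using sqrt_sum_squares_le_sum_abs[of "sqrt (lam n) * x" "sqrt (weight n) * y"]
  by (simp add: E_norm_mode power_mult_distrib abs_mult)

lemma mode_zero_iff: "mode n x y = 0 \<longleftrightarrow> x = 0 \<and> y = 0"
proof
  assume "mode n x y = 0"
  then have "x *\<^sub>R e n = 0" "single n y n = 0" by (simp_all add: mode_def zero_prod_def)
  moreover have "e n \<noteq> 0" using norm_e[of n] by (metis norm_zero zero_neq_one)
  ultimately show "x = 0 \<and> y = 0" by (simp add: single_def)
qed (simp add: mode_def zero_prod_def single_def zero_fun_def)

text \<open>This point is an equilibrium only if \<open>F\<close> has the value \<open>lam 0 * B\<close> times \<open>e 0\<close> there, which is part of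
\<open>linear_along\<close>.\<close>

definition equilibrium :: "real \<Rightarrow> 'a state" where
  "equilibrium B = (B *\<^sub>R e 0, 0)"

text \<open>Exact affinity on a segment, rather than differentiability, is what makes solutions near the
equilibrium explicit.\<close>

definition linear_along :: "real \<Rightarrow> nat \<Rightarrow> real \<Rightarrow> bool" where
  "linear_along B n k \<longleftrightarrow> (\<exists>r>0. \<forall>y. \<bar>y\<bar> \<le> r \<longrightarrow>
     F (B *\<^sub>R e 0 + y *\<^sub>R e n) = (lam 0 * B) *\<^sub>R e 0 + (k * y) *\<^sub>R e n)"

text \<open>For \<open>eps = 0\<close> the condition reads \<open>Z = - nu Y\<close>, the relation that defines the phase space there.\<close>

definition oscillation :: "real \<Rightarrow> (real \<Rightarrow> real) \<Rightarrow> (real \<Rightarrow> real) \<Rightarrow> (real \<Rightarrow> real) \<Rightarrow> bool" where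
  "oscillation nu Y Z W \<longleftrightarrow> (\<forall>t. (Y has_real_derivative Z t) (at t) \<and>
     (eps \<noteq> 0 \<longrightarrow> (Z has_real_derivative W t) (at t)) \<and> eps * W t + Z t + nu * Y t = 0)"

lemma oscillation_scale:
  assumes "oscillation nu Y Z W"
  shows "oscillation nu (\<lambda>t. s * Y t) (\<lambda>t. s * Z t) (\<lambda>t. s * W t)"
proof -
  have "eps * (s * W t) + s * Z t + nu * (s * Y t) = 0" for t
  proof -
    have "eps * (s * W t) + s * Z t + nu * (s * Y t) = s * (eps * W t + Z t + nu * Y t)"
      by (simp add: algebra_simps)
    also have "\<dots> = 0" using assms by (simp add: oscillation_def)
    finally show ?thesis .
  qed
  then show ?thesis using assms by (auto simp: oscillation_def intro!: DERIV_cmult)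
qed

lemma oscillation_shift:
  assumes "oscillation nu Y Z W"
  shows "oscillation nu (\<lambda>t. Y (t + s)) (\<lambda>t. Z (t + s)) (\<lambda>t. W (t + s))"
proof -
  have shift: "((\<lambda>t. f (t + s)) has_real_derivative d) (at t)" if "(f has_real_derivative d) (at (t + s))"
    for f :: "real \<Rightarrow> real" and d t
    using that by (rule DERIV_shift[THEN iffD1])
  show ?thesis
    using assms shift unfolding oscillation_def by blast
qed

lemma coeffs_mode: "coeffs e (B *\<^sub>R e 0 + x *\<^sub>R e n) = single 0 B + single n x"
  by (auto simp: coeffs_def single_def orth inner_add_left)

lemma has_Hs_derivative_single:
  assumes "(Y has_real_derivative d) (at t)" and "c \<in> Hs lam (-1)"
  shows "has_Hs_derivative lam (-1) (\<lambda>r. c + single n (Y r)) (single n d) t"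
proof -
  have "((\<lambda>r. (Y r - Y t) / (r - t) - d) \<longlongrightarrow> 0) (at t within {0..})"
    using has_field_derivative_at_within[OF assms(1), of "{0..}"]
    unfolding has_field_derivative_iff by (subst (asm) Lim_null)
  then have "((\<lambda>r. \<bar>(Y r - Y t) / (r - t) - d\<bar> / sqrt (lam n)) \<longlongrightarrow> 0) (at t within {0..})"
    by (intro tendsto_divide_zero tendsto_rabs_zero)
  moreover have "Hs_norm lam (-1) (inverse (r - t) *\<^sub>R ((c + single n (Y r)) - (c + single n (Y t))) - single n d)
      = \<bar>(Y r - Y t) / (r - t) - d\<bar> / sqrt (lam n)" for r
  proof -
    have "inverse (r - t) *\<^sub>R ((c + single n (Y r)) - (c + single n (Y t))) - single n d
        = single n ((Y r - Y t) / (r - t) - d)"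
      by (auto simp: single_def scaleR_fun_def divide_inverse)
    then show ?thesis by (simp only: Hs_norm_single)
  qed
  ultimately show ?thesis
    using assms(2) by (simp add: has_Hs_derivative_def subspace_add[OF Hs_subspace])
qed

lemma mode_in_phase:
  assumes F: "F (B *\<^sub>R e 0 + x *\<^sub>R e n) = (lam 0 * B) *\<^sub>R e 0 + (k * x) *\<^sub>R e n"
    and y: "eps = 0 \<Longrightarrow> y = - (lam n - k) * x"
  shows "equilibrium B + mode n x y \<in> phase"
proof -
  have eq: "equilibrium B + mode n x y = (B *\<^sub>R e 0 + x *\<^sub>R e n, single n y)"
    by (simp add: equilibrium_def mode_def)
  have mem: "equilibrium B + mode n x y \<in> E_space"
  proof -
    have "equilibrium B = mode 0 B 0"
      by (auto simp: equilibrium_def mode_def single_def zero_fun_def)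
    then show ?thesis by (simp add: subspace_add[OF E_space_subspace])
  qed
  moreover have "single n y = coeffs e (F (B *\<^sub>R e 0 + x *\<^sub>R e n)) - A_ext lam e (B *\<^sub>R e 0 + x *\<^sub>R e n)" if "eps = 0"
    unfolding F y[OF that] by (auto simp: single_def coeffs_def A_ext_def orth inner_add_left algebra_simps)
  ultimately show ?thesis by (auto simp: phase_def eq)
qed

lemma mode_solution:
  assumes F: "\<And>y. \<bar>y\<bar> \<le> r \<Longrightarrow> F (B *\<^sub>R e 0 + y *\<^sub>R e n) = (lam 0 * B) *\<^sub>R e 0 + (k * y) *\<^sub>R e n"
    and osc: "oscillation (lam n - k) Y Z W" and bounded: "\<And>t. t \<ge> 0 \<Longrightarrow> \<bar>Y t\<bar> \<le> r"
  shows "solution (\<lambda>t. equilibrium B + mode n (Y t) (Z t))"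
  unfolding solution_def
proof (intro conjI allI impI)
  have Y: "(Y has_real_derivative Z t) (at t)"
    and Z: "eps \<noteq> 0 \<Longrightarrow> (Z has_real_derivative W t) (at t)"
    and eq: "eps * W t + Z t + (lam n - k) * Y t = 0" for t
    using osc by (auto simp: oscillation_def)
  have Z0: "Z t = - (lam n - k) * Y t" if "eps = 0" for t using eq[of t] that by (simp add: algebra_simps)
  fix t :: real assume t: "t \<ge> 0"
  show "equilibrium B + mode n (Y t) (Z t) \<in> phase"
    by (rule mode_in_phase[OF F[OF bounded[OF t]]]) (use Z0 in simp)
  have "isCont Y t" by (rule DERIV_isCont[OF Y])
  moreover have "isCont Z t"
  proof (cases "eps = 0")
    case True
    then have "Z = (\<lambda>t. - (lam n - k) * Y t)" using Z0 by blast
    then show ?thesis using \<open>isCont Y t\<close> by (simp add: continuous_intros)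
  qed (use DERIV_isCont[OF Z] in simp)
  ultimately have "((\<lambda>r. sqrt (lam n * (Y r - Y t)\<^sup>2 + weight n * (Z r - Z t)\<^sup>2))
      \<longlongrightarrow> sqrt (lam n * (Y t - Y t)\<^sup>2 + weight n * (Z t - Z t)\<^sup>2)) (at t within {0..})"
    by (intro tendsto_intros) (auto simp: isCont_def intro: tendsto_within_subset)
  then show "((\<lambda>r. E_norm (equilibrium B + mode n (Y r) (Z r) - (equilibrium B + mode n (Y t) (Z t))))
      \<longlongrightarrow> 0) (at t within {0..})"
    by (simp add: mode_diff[symmetric] E_norm_mode)
  show "has_Hs_derivative lam (-1) (\<lambda>r. coeffs e (fst (equilibrium B + mode n (Y r) (Z r))))
      (snd (equilibrium B + mode n (Y t) (Z t))) t"
    using has_Hs_derivative_single[OF Y single_Hs, of 0 B n]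
    by (simp add: equilibrium_def mode_def coeffs_mode)
  show "\<exists>w. (eps \<noteq> 0 \<longrightarrow> has_Hs_derivative lam (-1) (\<lambda>r. snd (equilibrium B + mode n (Y r) (Z r))) w t) \<and>
      eps *\<^sub>R w + snd (equilibrium B + mode n (Y t) (Z t))
        + A_ext lam e (fst (equilibrium B + mode n (Y t) (Z t)))
      = coeffs e (F (fst (equilibrium B + mode n (Y t) (Z t))))"
  proof (intro exI[of _ "single n (W t)"] conjI impI)
    assume "eps \<noteq> 0"
    have "0 \<in> Hs lam (-1)" by (rule subspace_0[OF Hs_subspace])
    from has_Hs_derivative_single[OF Z[OF \<open>eps \<noteq> 0\<close>] this, of n]
    show "has_Hs_derivative lam (-1) (\<lambda>r. snd (equilibrium B + mode n (Y r) (Z r))) (single n (W t)) t"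
      by (simp add: equilibrium_def mode_def)
    next
    have "eps * W t + Z t + lam n * Y t = k * Y t" using eq[of t] by (simp add: algebra_simps)
    then show "eps *\<^sub>R single n (W t) + snd (equilibrium B + mode n (Y t) (Z t))
        + A_ext lam e (fst (equilibrium B + mode n (Y t) (Z t)))
      = coeffs e (F (fst (equilibrium B + mode n (Y t) (Z t))))"
      by (auto simp: equilibrium_def mode_def F[OF bounded[OF t]] single_def A_ext_def coeffs_def
          scaleR_fun_def orth inner_add_left fun_eq_iff algebra_simps)
  qed
qed

lemma S_equilibrium:
  assumes "linear_along B n k" "t \<ge> 0"
  shows "S t (equilibrium B) = equilibrium B" and "equilibrium B \<in> phase"
proof -
  obtain r where r: "r > 0" "\<And>y. \<bar>y\<bar> \<le> r \<Longrightarrow> F (B *\<^sub>R e 0 + y *\<^sub>R e n) = (lam 0 * B) *\<^sub>R e 0 + (k * y) *\<^sub>R e n"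
    using assms by (auto simp: linear_along_def)
  have "solution (\<lambda>t. equilibrium B + mode n 0 0)"
    by (rule mode_solution[where Y = "\<lambda>_. 0" and Z = "\<lambda>_. 0" and W = "\<lambda>_. 0", OF r(2)])
       (use r in \<open>auto simp: oscillation_def\<close>)
  moreover have "mode n 0 0 = 0" by (simp add: mode_zero_iff)
  ultimately have sol: "solution (\<lambda>t. equilibrium B)" by simp
  show "S t (equilibrium B) = equilibrium B" using S_eqI[OF sol assms(2)] .
  show "equilibrium B \<in> phase" using sol assms(2) by (auto simp: solution_def)
qed

text \<open>For small \<open>s\<close> the semigroup maps \<open>equilibrium B + s \<eta>\<close> exactly to \<open>equilibrium B + s \<eta>\<^sub>t\<close> along an explicit
solution that stays on the segment where \<open>F\<close> is affine. Boundedness for all future times matters,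
because the semigroup is defined through solutions on the whole half-line.\<close>

lemma derivative_on_mode:
  assumes lin: "linear_along B n k"
    and osc: "oscillation (lam n - k) Y Z W" and bounded: "\<And>t. t \<ge> 0 \<Longrightarrow> \<bar>Y t\<bar> \<le> K"
    and t: "t \<ge> 0"
    and D: "has_frechet E_space E_norm E_space E_norm phase (S t) D (equilibrium B)"
  shows "D (mode n (Y 0) (Z 0)) = mode n (Y t) (Z t)"
proof -
  let ?m = "\<lambda>t. mode n (Y t) (Z t)"
  obtain r where r: "r > 0" "\<And>y. \<bar>y\<bar> \<le> r \<Longrightarrow> F (B *\<^sub>R e 0 + y *\<^sub>R e n) = (lam 0 * B) *\<^sub>R e 0 + (k * y) *\<^sub>R e n"
    using lin by (auto simp: linear_along_def)
  have linD: "linear D" and D_E: "D ` E_space \<subseteq> E_space"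
    and D_err: "\<And>q. q > 0 \<Longrightarrow> \<exists>d>0. \<forall>y\<in>phase. E_norm (y - equilibrium B) < d \<longrightarrow>
        E_norm (S t y - S t (equilibrium B) - D (y - equilibrium B)) \<le> q * E_norm (y - equilibrium B)"
    using D by (auto simp: has_frechet_def)
  have K0: "K \<ge> 0" using bounded[of 0] by simp
  have sol: "solution (\<lambda>t. equilibrium B + s *\<^sub>R ?m t)" if "0 < s" "s * K \<le> r" for s
  proof -
    have "\<bar>s * Y t\<bar> \<le> r" if "t \<ge> 0" for t
      using order_trans[OF mult_left_mono[OF bounded[OF that], of s] \<open>s * K \<le> r\<close>] \<open>0 < s\<close>
      by (simp add: abs_mult)
    from mode_solution[OF r(2) oscillation_scale[OF osc] this]
    show ?thesis by (simp add: mode_scale)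
  qed
  have m_E: "?m t - D (?m 0) \<in> E_space"
    using D_E by (intro subspace_diff[OF E_space_subspace]) auto
  have "E_norm (?m t - D (?m 0)) \<le> q * E_norm (?m 0)" if q: "q > 0" for q
  proof -
    obtain d where d: "d > 0" "\<And>y. y \<in> phase \<Longrightarrow> E_norm (y - equilibrium B) < d \<Longrightarrow>
        E_norm (S t y - S t (equilibrium B) - D (y - equilibrium B)) \<le> q * E_norm (y - equilibrium B)"
      using D_err[OF q] by blast
    have m0: "E_norm (?m 0) \<ge> 0" by (rule E_norm_sq) simp
    \<comment> \<open>the scale keeps the whole scaled solution on the segment where \<open>F\<close> is affine, and its initial value in the
    range of the differentiability estimate\<close>
    define s where "s = min (r / (K + 1)) (d / (E_norm (?m 0) + 1)) / 2"
    have s: "0 < s" using r(1) d(1) K0 m0 by (simp add: s_def)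
    have "s \<le> r / (K + 1)" "s < d / (E_norm (?m 0) + 1)"
    proof -
      have "x / 2 \<le> y" "x / 2 < y" if "x \<le> y" "0 < x" for x y :: real using that by auto
      then show "s \<le> r / (K + 1)" "s < d / (E_norm (?m 0) + 1)"
        using s unfolding s_def by (meson half_gt_zero_iff min.cobounded1 min.cobounded2)+
    qed
    then have "s * (K + 1) \<le> r" "s * (E_norm (?m 0) + 1) < d"
      using K0 m0 by (simp_all add: field_simps)
    then have sK: "s * K \<le> r" and sd: "s * E_norm (?m 0) < d" using s by (simp_all add: distrib_left)
    note sol = sol[OF s sK]
    let ?y = "equilibrium B + s *\<^sub>R ?m 0"
    have y: "?y \<in> phase" using sol by (auto simp: solution_def)
    have "S t ?y = equilibrium B + s *\<^sub>R ?m t" using S_eqI[OF sol t] .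
    then have "S t ?y - S t (equilibrium B) - D (?y - equilibrium B) = s *\<^sub>R (?m t - D (?m 0))"
      using S_equilibrium(1)[OF lin t] by (simp add: linear_scale[OF linD] scaleR_diff_right)
    moreover have "E_norm (?y - equilibrium B) = s * E_norm (?m 0)"
      using s by (simp add: E_norm_scale)
    ultimately have "s * E_norm (?m t - D (?m 0)) \<le> q * (s * E_norm (?m 0))"
      using d(2)[OF y] sd s E_norm_scale[OF m_E, of s] by simp
    then show ?thesis using s by simp
  qed
  then have "E_norm (?m t - D (?m 0)) \<le> 0"
  proof (cases "E_norm (?m 0) = 0")
    case False
    assume *: "\<And>q. q > 0 \<Longrightarrow> E_norm (?m t - D (?m 0)) \<le> q * E_norm (?m 0)"
    have pos: "E_norm (?m 0) > 0" using False E_norm_sq(2)[OF mode_E_space, of n "Y 0" "Z 0"] by simp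
    show ?thesis
    proof (rule field_le_epsilon)
      fix q :: real assume "q > 0"
      then show "E_norm (?m t - D (?m 0)) \<le> 0 + q" using *[of "q / E_norm (?m 0)"] pos by simp
    qed
  qed (metis mult_zero_right zero_less_one)
  from E_norm_eq_0D[OF m_E this] show ?thesis by simp
qed

lemma mode_tangent:
  assumes "linear_along B n k" "eps = 0 \<Longrightarrow> y = - (lam n - k) * x"
  shows "mode n x y \<in> tangent phase (equilibrium B)"
proof -
  obtain r where r: "r > 0" "\<And>y. \<bar>y\<bar> \<le> r \<Longrightarrow> F (B *\<^sub>R e 0 + y *\<^sub>R e n) = (lam 0 * B) *\<^sub>R e 0 + (k * y) *\<^sub>R e n"
    using assms(1) by (auto simp: linear_along_def)
  define \<gamma> where "\<gamma> s = equilibrium B + mode n (s * x) (s * y)" for s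
  have "\<gamma> s \<in> phase" if s: "\<bar>s\<bar> < r / (\<bar>x\<bar> + 1)" for s
  proof -
    have "\<bar>s\<bar> * (\<bar>x\<bar> + 1) < r" using s by (simp add: field_simps)
    then have "\<bar>s * x\<bar> \<le> r" by (simp add: abs_mult distrib_left)
    then show ?thesis unfolding \<gamma>_def
      by (intro mode_in_phase[OF r(2)]) (use assms(2) in \<open>auto simp del: mult_minus_left\<close>)
  qed
  moreover have "((\<lambda>s. E_norm (inverse s *\<^sub>R (\<gamma> s - equilibrium B) - mode n x y)) \<longlongrightarrow> 0) (at (0::real))"
    by (rule tendsto_eventually) (auto simp: eventually_at_filter \<gamma>_def mode_scale)
  moreover have "\<gamma> 0 = equilibrium B" using mode_zero_iff[of n 0 0] by (simp add: \<gamma>_def)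
  ultimately show ?thesis
    using r(1) unfolding tangent_def
    by (auto intro!: exI[of _ \<gamma>] exI[of _ "r / (\<bar>x\<bar> + 1)"])
qed

end

section \<open>Invariant splittings with separated rates\<close>

lemma sum_fun_apply: "(\<Sum>j\<in>A. f j) x = (\<Sum>j\<in>A. f j x)" for f :: "'b \<Rightarrow> 'c \<Rightarrow> 'd::comm_monoid_add"
  by (induction A rule: infinite_finite_induct) auto

text \<open>More vectors than the dimension allows; a family may repeat vectors, so this is not just a statement
about dependent sets.\<close>

lemma dependent_family:
  fixes v :: "nat \<Rightarrow> 'v::real_vector"
  assumes "finite B" "card B \<le> N" "\<And>i. i \<le> N \<Longrightarrow> v i \<in> span B"
  obtains c where "(\<Sum>i\<le>N. c i *\<^sub>R v i) = 0" "\<exists>i\<le>N. c i \<noteq> (0::real)"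
proof (cases "inj_on v {..N}")
  case True
  have "dependent (v ` {..N})"
  proof (rule ccontr)
    assume "independent (v ` {..N})"
    then have "card (v ` {..N}) \<le> card B"
      using independent_span_bound[OF assms(1), of "v ` {..N}"] assms(3) by blast
    then show False using card_image[OF True] assms(2) by simp
  qed
  then obtain u w where u: "w \<in> v ` {..N}" "u w \<noteq> 0" "(\<Sum>x\<in>v ` {..N}. u x *\<^sub>R x) = 0"
    by (auto simp: dependent_finite)
  then have "(\<Sum>i\<le>N. u (v i) *\<^sub>R v i) = 0" using True by (simp add: sum.reindex)
  with u show thesis by (intro that[of "u \<circ> v"]) auto
next
  case False
  then obtain i j where ij: "i \<le> N" "j \<le> N" "i \<noteq> j" "v i = v j" by (auto simp: inj_on_def)
  \<comment> \<open>a repeated vector gives the relation \<open>v i - v j = 0\<close>\<close>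
  define c where "c k = (if k = i then 1 else if k = j then -1 else (0::real))" for k
  have "(\<Sum>k\<le>N. c k *\<^sub>R v k) = (\<Sum>k\<in>{i,j}. c k *\<^sub>R v k)"
    using ij by (intro sum.mono_neutral_right) (auto simp: c_def)
  also have "\<dots> = 0" using ij by (simp add: c_def)
  finally show thesis using ij by (intro that[of c]) (auto simp: c_def)
qed

lemma direct_sum_projector:
  assumes "direct_sum V T N" "a \<in> T" "b \<in> N"
  shows "projector T N (a + b) = a"
  unfolding projector_def
proof (rule the_equality)
  fix a' assume a': "a' \<in> T \<and> a + b - a' \<in> N"
  have sub: "subspace T" "subspace N" "T \<inter> N = {0}" using assms by (auto simp: direct_sum_def)
  have "a - a' \<in> T" using sub(1) a' assms(2) by (simp add: subspace_diff)
  moreover have "a - a' = (a + b - a') - b" by simp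
  then have "a - a' \<in> N" using sub(2) a' assms(3) by (metis subspace_diff)
  ultimately have "a - a' \<in> T \<inter> N" by blast
  then show "a' = a" unfolding sub(3) by simp
qed (use assms in auto)

lemma direct_sum_commute: "direct_sum V T N \<Longrightarrow> direct_sum V N T"
proof -
  assume "direct_sum V T N"
  moreover have "{a + b | a b. a \<in> T \<and> b \<in> N} = {a + b | a b. a \<in> N \<and> b \<in> T}"
    by (metis add.commute)
  ultimately show ?thesis by (simp add: direct_sum_def Int_commute)
qed

lemma direct_sum_add_mem: "direct_sum V T N \<Longrightarrow> a \<in> T \<Longrightarrow> b \<in> N \<Longrightarrow> a + b \<in> V"
  unfolding direct_sum_def by blast

lemma direct_sum_left_mem:
  assumes "direct_sum V T N" "a \<in> T"
  shows "a \<in> V"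
proof -
  have "0 \<in> N" using assms(1) subspace_0 unfolding direct_sum_def by blast
  then show ?thesis using direct_sum_add_mem[OF assms] by fastforce
qed

text \<open>All complements of \<open>Q\<close> have the dimension \<open>n\<close>: project the family along \<open>Q\<close> to the given complement.\<close>

lemma complement_no_larger_family:
  assumes "has_codim n V Q" "direct_sum V T Q" and v: "\<And>i. i \<le> n \<Longrightarrow> v i \<in> T"
  obtains c where "(\<Sum>i\<le>n. c i *\<^sub>R v i) = 0" "\<exists>i\<le>n. c i \<noteq> (0::real)"
proof -
  obtain B where B: "finite B" "card B = n" "direct_sum V (span B) Q"
    using assms(1) by (auto simp: has_codim_def)
  have T: "subspace T" "subspace Q" "T \<inter> Q = {0}" using assms(2) by (auto simp: direct_sum_def)
  have "\<exists>b q. b \<in> span B \<and> q \<in> Q \<and> v i = b + q" if "i \<le> n" for i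
  proof -
    have "v i \<in> V" using direct_sum_left_mem[OF assms(2) v[OF that]] .
    then show ?thesis using B(3) by (auto simp: direct_sum_def)
  qed
  then obtain b q where bq: "\<And>i. i \<le> n \<Longrightarrow> b i \<in> span B \<and> q i \<in> Q \<and> v i = b i + q i" by metis
  obtain c where c: "(\<Sum>i\<le>n. c i *\<^sub>R b i) = 0" "\<exists>i\<le>n. c i \<noteq> (0::real)"
    using dependent_family[OF B(1), of n b] B(2) bq by blast
  have "(\<Sum>i\<le>n. c i *\<^sub>R v i) = (\<Sum>i\<le>n. c i *\<^sub>R b i) + (\<Sum>i\<le>n. c i *\<^sub>R q i)"
    using bq by (simp add: scaleR_add_right sum.distrib)
  then have "(\<Sum>i\<le>n. c i *\<^sub>R v i) \<in> Q"
    using c(1) bq T(2) by (auto intro!: subspace_sum subspace_scale)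
  moreover have "(\<Sum>i\<le>n. c i *\<^sub>R v i) \<in> T"
    using v T(1) by (auto intro!: subspace_sum subspace_scale)
  ultimately have "(\<Sum>i\<le>n. c i *\<^sub>R v i) = 0" using T(3) by blast
  then show thesis using c(2) by (rule that)
qed

text \<open>A space of dimension \<open>k + 1\<close> contains a nonzero common zero of \<open>k\<close> linear functionals.\<close>

lemma complement_meets_kernel:
  fixes l :: "nat \<Rightarrow> 'v::real_vector \<Rightarrow> real"
  assumes "has_codim (Suc k) V Q" "direct_sum V T Q" and l: "\<And>i. linear (l i)"
  obtains \<eta> where "\<eta> \<in> T" "\<eta> \<noteq> 0" "\<And>i. i < k \<Longrightarrow> l i \<eta> = 0"
proof -
  obtain B where B: "finite B" "independent B" "card B = Suc k" "direct_sum V (span B) Q"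
    using assms(1) by (auto simp: has_codim_def)
  have T: "subspace T" "subspace Q" "span B \<inter> Q = {0}" 
    using assms(2) B(4) by (auto simp: direct_sum_def)
  obtain \<beta> where \<beta>: "bij_betw \<beta> {..k} B"
    using ex_bij_betw_nat_finite[OF B(1)] B(3) by (auto simp: atLeast0LessThan lessThan_Suc_atMost)
  have "\<exists>a q. a \<in> T \<and> q \<in> Q \<and> \<beta> i = a + q" if "i \<le> k" for i
  proof -
    have "\<beta> i \<in> B" using \<beta> that by (auto simp: bij_betw_def)
    then have "\<beta> i \<in> V" using direct_sum_left_mem[OF B(4) span_base] by blast
    then show ?thesis using assms(2) by (auto simp: direct_sum_def)
  qed
  then obtain a q where aq: "\<And>i. i \<le> k \<Longrightarrow> a i \<in> T \<and> q i \<in> Q \<and> \<beta> i = a i + q i" by metis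
  define E :: "(nat \<Rightarrow> real) set" where "E = (\<lambda>j. single j 1) ` {..<k}"
  define f where "f i = (\<lambda>j. if j < k then l j (a i) else 0)" for i
  have "f i \<in> span E" for i
  proof -
    have "f i = (\<Sum>j<k. l j (a i) *\<^sub>R single j 1)"
    proof
      fix m
      have "(\<Sum>j<k. l j (a i) *\<^sub>R single j 1) m = (\<Sum>j<k. l j (a i) * (if m = j then 1 else 0))"
        by (simp add: sum_fun_apply scaleR_fun_def single_def)
      then show "f i m = (\<Sum>j<k. l j (a i) *\<^sub>R single j 1) m"
        by (simp add: f_def if_distrib cong: if_cong)
    qed
    moreover have "\<dots> \<in> span E" by (intro span_sum span_scale span_base) (auto simp: E_def)
    ultimately show ?thesis by simp
  qed
  moreover have "finite E" "card E \<le> k"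
    unfolding E_def using card_image_le[of "{..<k}"] by auto
  ultimately obtain c where c: "(\<Sum>i\<le>k. c i *\<^sub>R f i) = 0" "\<exists>i\<le>k. c i \<noteq> (0::real)"
    using dependent_family[of E k f] by blast
  show thesis
  proof (rule that)
    show "(\<Sum>i\<le>k. c i *\<^sub>R a i) \<in> T" using aq T(1) by (auto intro!: subspace_sum subspace_scale)
    fix j assume j: "j < k"
    have "l j (\<Sum>i\<le>k. c i *\<^sub>R a i) = (\<Sum>i\<le>k. c i *\<^sub>R f i) j"
      using j by (simp add: linear_sum[OF l] linear_scale[OF l] f_def sum_fun_apply scaleR_fun_def)
    then show "l j (\<Sum>i\<le>k. c i *\<^sub>R a i) = 0" by (simp add: c(1))
  next
    show "(\<Sum>i\<le>k. c i *\<^sub>R a i) \<noteq> 0"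
    proof
      assume "(\<Sum>i\<le>k. c i *\<^sub>R a i) = 0"
      moreover have "(\<Sum>i\<le>k. c i *\<^sub>R \<beta> i) = (\<Sum>i\<le>k. c i *\<^sub>R a i) + (\<Sum>i\<le>k. c i *\<^sub>R q i)"
        using aq by (simp add: scaleR_add_right sum.distrib)
      ultimately have "(\<Sum>i\<le>k. c i *\<^sub>R \<beta> i) \<in> Q"
        using aq T(2) by (auto intro!: subspace_sum subspace_scale)
      moreover have "(\<Sum>i\<le>k. c i *\<^sub>R \<beta> i) \<in> span B"
        by (intro span_sum span_scale span_base) (use \<beta> in \<open>auto simp: bij_betw_def\<close>)
      ultimately have zero: "(\<Sum>i\<le>k. c i *\<^sub>R \<beta> i) = 0" using T(3) by blast
      have "(\<Sum>x\<in>B. c (inv_into {..k} \<beta> x) *\<^sub>R x) = (\<Sum>i\<le>k. c i *\<^sub>R \<beta> i)"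
        using \<beta> by (intro sum.reindex_bij_betw[OF \<beta>, THEN sym, THEN trans] sum.cong)
           (auto simp: bij_betw_def)
      then have "\<forall>x\<in>B. c (inv_into {..k} \<beta> x) = 0"
        using independentD[OF B(2,1) subset_refl] zero by metis
      then have "c i = 0" if "i \<le> k" for i
        using \<beta> that by (auto simp: bij_betw_def)
      then show False using c(2) by blast
    qed
  qed
qed

lemma nonpos_if_exp_small:
  fixes x K and c :: real
  assumes "c > 0" "\<And>t. t \<ge> 0 \<Longrightarrow> x \<le> K * exp (- c * t)"
  shows "x \<le> 0"
proof (rule tendsto_lowerbound)
  have "filterlim (\<lambda>t. - c * t) at_bot at_top"
    by (rule filterlim_tendsto_neg_mult_at_bot[OF tendsto_const _ filterlim_ident]) (use assms(1) in simp)
  then have "((\<lambda>t. exp (- c * t)) \<longlongrightarrow> 0) at_top"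
    by (rule filterlim_compose[OF exp_at_bot])
  from tendsto_mult_right_zero[OF this]
  show "((\<lambda>t. K * exp (- c * t)) \<longlongrightarrow> 0) at_top" .
  show "\<forall>\<^sub>F t in at_top. x \<le> K * exp (- c * t)"
    using assms(2) eventually_ge_at_top[of 0] by (rule eventually_mono[rotated])
qed simp

text \<open>An invariant splitting \<open>V = T \<oplus> Q\<close> with separated rates, detached from the manifold it comes from.\<close>

locale dichotomy = wave +
  fixes V T Q :: "'a state set" and DS :: "real \<Rightarrow> 'a state \<Rightarrow> 'a state"
    and Cp C \<theta> \<kappa> :: real
  assumes V_subset: "V \<subseteq> E_space"
    and direct: "direct_sum V T Q"
    and linear_DS: "\<And>t. t \<ge> 0 \<Longrightarrow> linear (DS t)"
    and DS_T: "\<And>t \<eta>. t \<ge> 0 \<Longrightarrow> \<eta> \<in> T \<Longrightarrow> DS t \<eta> \<in> T"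
    and DS_Q: "\<And>t \<eta>. t \<ge> 0 \<Longrightarrow> \<eta> \<in> Q \<Longrightarrow> DS t \<eta> \<in> Q"
    and bounded_T: "\<And>\<eta>. \<eta> \<in> V \<Longrightarrow> E_norm (projector T Q \<eta>) \<le> Cp * E_norm \<eta>"
    and bounded_Q: "\<And>\<eta>. \<eta> \<in> V \<Longrightarrow> E_norm (projector Q T \<eta>) \<le> Cp * E_norm \<eta>"
    and C_pos: "C > 0" and \<kappa>_pos: "\<kappa> > 0"
    and decay_Q: "\<And>t \<eta>. t \<ge> 0 \<Longrightarrow> \<eta> \<in> Q \<Longrightarrow> E_norm (DS t \<eta>) \<le> C * exp (- (\<theta> + \<kappa>) * t) * E_norm \<eta>"
    and growth_T: "\<And>t \<eta>. t \<ge> 0 \<Longrightarrow> \<eta> \<in> T \<Longrightarrow> E_norm (DS t \<eta>) \<ge> inverse C * exp (- (\<theta> - \<kappa>) * t) * E_norm \<eta>"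
begin

lemma decompose:
  assumes "\<eta> \<in> V"
  obtains a b where "a \<in> T" "b \<in> Q" "\<eta> = a + b" "projector T Q \<eta> = a" "projector Q T \<eta> = b"
proof -
  obtain a b where ab: "a \<in> T" "b \<in> Q" "\<eta> = a + b" using assms direct by (auto simp: direct_sum_def)
  moreover have "projector T Q (a + b) = a" using direct_sum_projector[OF direct ab(1,2)] .
  moreover have "projector Q T (b + a) = b"
    using direct_sum_projector[OF direct_sum_commute[OF direct] ab(2,1)] .
  ultimately show thesis using that by (simp add: add.commute)
qed

lemma sum_in_V: "a \<in> T \<Longrightarrow> b \<in> Q \<Longrightarrow> a + b \<in> V"
  by (rule direct_sum_add_mem[OF direct])

lemma T_subset: "T \<subseteq> V" and Q_subset: "Q \<subseteq> V"
  using direct_sum_left_mem[OF direct] direct_sum_left_mem[OF direct_sum_commute[OF direct]] by auto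

text \<open>The component in \<open>T\<close> inherits the decay, since the projections commute with the flow, but nonzero vectors
of \<open>T\<close> cannot decay that fast.\<close>

lemma in_Q_if_decay:
  assumes "\<eta> \<in> V" "c > \<theta> - \<kappa>" "\<And>t. t \<ge> 0 \<Longrightarrow> E_norm (DS t \<eta>) \<le> K * exp (- c * t)"
  shows "\<eta> \<in> Q"
proof -
  obtain a b where ab: "a \<in> T" "b \<in> Q" "\<eta> = a + b" using decompose[OF assms(1)] by metis
  have Cp: "E_norm a' \<le> \<bar>Cp\<bar> * E_norm (a' + b')" if "a' \<in> T" "b' \<in> Q" for a' b'
  proof -
    have "E_norm a' \<le> Cp * E_norm (a' + b')"
      using bounded_T[OF sum_in_V[OF that]] direct_sum_projector[OF direct that] by simp
    also have "\<dots> \<le> \<bar>Cp\<bar> * E_norm (a' + b')"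
      using V_subset sum_in_V[OF that] by (intro mult_right_mono E_norm_sq) auto
    finally show ?thesis .
  qed
  have "E_norm a \<le> (C * \<bar>Cp\<bar> * K) * exp (- (c - (\<theta> - \<kappa>)) * t)" if t: "t \<ge> 0" for t
  proof -
    have "inverse C * exp (- (\<theta> - \<kappa>) * t) * E_norm a \<le> E_norm (DS t a)"
      using growth_T[OF t ab(1)] .
    also have "\<dots> \<le> \<bar>Cp\<bar> * E_norm (DS t \<eta>)"
      using Cp[OF DS_T[OF t ab(1)] DS_Q[OF t ab(2)]] by (simp add: ab(3) linear_add[OF linear_DS[OF t]])
    also have "\<dots> \<le> \<bar>Cp\<bar> * (K * exp (- c * t))"
      by (intro mult_left_mono assms t) auto
    finally have "(C * exp ((\<theta> - \<kappa>) * t)) * (inverse C * exp (- (\<theta> - \<kappa>) * t) * E_norm a)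
        \<le> (C * exp ((\<theta> - \<kappa>) * t)) * (\<bar>Cp\<bar> * (K * exp (- c * t)))"
      using C_pos by (intro mult_left_mono) auto
    moreover have "(C * exp ((\<theta> - \<kappa>) * t)) * (inverse C * exp (- (\<theta> - \<kappa>) * t) * E_norm a) = E_norm a"
    proof -
      have "(C * exp ((\<theta> - \<kappa>) * t)) * (inverse C * exp (- (\<theta> - \<kappa>) * t) * E_norm a)
         = (C * inverse C) * (exp ((\<theta> - \<kappa>) * t) * exp (- (\<theta> - \<kappa>) * t)) * E_norm a" by simp
      moreover have "exp ((\<theta> - \<kappa>) * t) * exp (- (\<theta> - \<kappa>) * t) = 1"
        by (simp add: exp_add[symmetric] algebra_simps)
      moreover have "C * inverse C = 1" using C_pos by simp
      ultimately show ?thesis by (simp only: mult_1)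
    qed
    moreover have "(C * exp ((\<theta> - \<kappa>) * t)) * (\<bar>Cp\<bar> * (K * exp (- c * t)))
        = (C * \<bar>Cp\<bar> * K) * exp (- (c - (\<theta> - \<kappa>)) * t)"
    proof -
      have "exp (- (c - (\<theta> - \<kappa>)) * t) = exp ((\<theta> - \<kappa>) * t) * exp (- c * t)"
        by (simp add: exp_add[symmetric] algebra_simps)
      then show ?thesis by simp
    qed
    ultimately show ?thesis by (simp only:)
  qed
  then have "E_norm a \<le> 0"
    using assms(2) by (intro nonpos_if_exp_small[of "c - (\<theta> - \<kappa>)"]) auto
  then have "a = 0" using E_norm_eq_0D ab(1) T_subset V_subset by blast
  then show ?thesis using ab by simp
qed

text \<open>The component in \<open>Q\<close> is the image under the flow of components that grow too slowly backwards in
time to survive the decay in \<open>Q\<close>.\<close>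

lemma in_T_if_backward_bound:
  assumes "\<eta> \<in> V" "c < \<theta> + \<kappa>"
    and preimage: "\<And>t. t \<ge> 0 \<Longrightarrow> \<exists>\<zeta>\<in>V. DS t \<zeta> = \<eta> \<and> E_norm \<zeta> \<le> K * exp (c * t)"
  shows "\<eta> \<in> T"
proof -
  obtain a b where ab: "a \<in> T" "b \<in> Q" "\<eta> = a + b" using decompose[OF assms(1)] by metis
  have "E_norm b \<le> (C * \<bar>Cp\<bar> * K) * exp (- (\<theta> + \<kappa> - c) * t)" if t: "t \<ge> 0" for t
  proof -
    obtain \<zeta> where \<zeta>: "\<zeta> \<in> V" "DS t \<zeta> = \<eta>" "E_norm \<zeta> \<le> K * exp (c * t)" using preimage[OF t] by blast
    obtain a' b' where ab': "a' \<in> T" "b' \<in> Q" "\<zeta> = a' + b'" "projector Q T \<zeta> = b'"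
      using decompose[OF \<zeta>(1)] by metis
    have "DS t b' = b"
    proof -
      have eq: "DS t a' + DS t b' = a + b"
        using \<zeta>(2) ab(3) ab'(3) by (simp add: linear_add[OF linear_DS[OF t]])
      have "projector Q T (DS t b' + DS t a') = DS t b'" "projector Q T (b + a) = b"
        using ab ab' t direct_sum_commute[OF direct]
        by (auto intro!: direct_sum_projector[of V] DS_T DS_Q)
      then show ?thesis using eq by (metis add.commute)
    qed
    then have "E_norm b \<le> C * exp (- (\<theta> + \<kappa>) * t) * E_norm b'" using decay_Q[OF t ab'(2)] by simp
    also have "\<dots> \<le> C * exp (- (\<theta> + \<kappa>) * t) * (\<bar>Cp\<bar> * (K * exp (c * t)))"
    proof (intro mult_left_mono)
      have "E_norm b' \<le> Cp * E_norm \<zeta>" using bounded_Q[OF \<zeta>(1)] ab'(4) by simp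
      also have "\<dots> \<le> \<bar>Cp\<bar> * E_norm \<zeta>"
        using \<zeta>(1) V_subset by (intro mult_right_mono E_norm_sq) auto
      also have "\<dots> \<le> \<bar>Cp\<bar> * (K * exp (c * t))" by (intro mult_left_mono \<zeta>) auto
      finally show "E_norm b' \<le> \<bar>Cp\<bar> * (K * exp (c * t))" .
    qed (use C_pos in auto)
    also have "\<dots> = (C * \<bar>Cp\<bar> * K) * (exp (- (\<theta> + \<kappa>) * t) * exp (c * t))" by simp
    also have "exp (- (\<theta> + \<kappa>) * t) * exp (c * t) = exp (- (\<theta> + \<kappa> - c) * t)"
      by (simp add: exp_add[symmetric] algebra_simps)
    finally show ?thesis .
  qed
  then have "E_norm b \<le> 0"
    using assms(2) by (intro nonpos_if_exp_small[of "\<theta> + \<kappa> - c"]) auto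
  then have "b = 0" using E_norm_eq_0D ab(2) Q_subset V_subset by blast
  then show ?thesis using ab by simp
qed

lemma Q_closed:
  assumes "\<eta> \<in> V" "\<And>m. q m \<in> Q" "(\<lambda>m. E_norm (\<eta> - q m)) \<longlonglongrightarrow> 0"
  shows "\<eta> \<in> Q"
proof -
  obtain a b where ab: "a \<in> T" "b \<in> Q" "\<eta> = a + b" using decompose[OF assms(1)] by metis
  have "E_norm a \<le> Cp * E_norm (\<eta> - q m)" for m
  proof -
    have q: "b - q m \<in> Q" using direct ab(2) assms(2) by (auto simp: direct_sum_def subspace_diff)
    have "projector T Q (a + (b - q m)) = a" by (rule direct_sum_projector[OF direct ab(1) q])
    then show ?thesis using bounded_T[OF sum_in_V[OF ab(1) q]] by (simp add: ab(3) add_diff_eq)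
  qed
  then have "E_norm a \<le> 0"
    using LIMSEQ_le_const[OF tendsto_mult_right_zero[OF assms(3), of Cp]] by blast
  then have "a = 0" using E_norm_eq_0D ab(1) T_subset V_subset by blast
  then show ?thesis using ab by simp
qed

end

section \<open>Decay rates of single modes\<close>

context wave begin

text \<open>The two-sided bound, for negative times as well, serves the forward estimate that puts a mode into \<open>Q\<close> and
the backward estimate that puts it into \<open>T\<close>.\<close>

definition rate_mode :: "real \<Rightarrow> real \<Rightarrow> real \<Rightarrow> real \<Rightarrow> bool" where
  "rate_mode nu c x y \<longleftrightarrow> (\<exists>Y Z W K. oscillation nu Y Z W \<and> Y 0 = x \<and> Z 0 = y \<and>
     (\<forall>t. \<bar>Y t\<bar> \<le> K * exp (- c * t) \<and> \<bar>Z t\<bar> \<le> K * exp (- c * t)))"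

lemma rate_mode_root:
  assumes "eps * \<mu>\<^sup>2 + \<mu> + nu = 0"
  shows "rate_mode nu (- \<mu>) x (\<mu> * x)"
proof -
  define Y where "Y t = x * exp (\<mu> * t)" for t
  define Z where "Z t = \<mu> * x * exp (\<mu> * t)" for t
  define W where "W t = \<mu>\<^sup>2 * x * exp (\<mu> * t)" for t
  have "eps * W t + Z t + nu * Y t = (eps * \<mu>\<^sup>2 + \<mu> + nu) * (x * exp (\<mu> * t))" for t
    by (simp add: Y_def Z_def W_def algebra_simps)
  then have "eps * W t + Z t + nu * Y t = 0" for t using assms by simp
  moreover have "(Y has_real_derivative Z t) (at t)" "(Z has_real_derivative W t) (at t)" for t
    unfolding Y_def[abs_def] Z_def[abs_def] W_def
    by (auto intro!: derivative_eq_intros simp: power2_eq_square)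
  ultimately have "oscillation nu Y Z W" by (simp add: oscillation_def)
  moreover have "\<bar>Y t\<bar> \<le> ((1 + \<bar>\<mu>\<bar>) * \<bar>x\<bar>) * exp (- (- \<mu>) * t)"
    "\<bar>Z t\<bar> \<le> ((1 + \<bar>\<mu>\<bar>) * \<bar>x\<bar>) * exp (- (- \<mu>) * t)" for t
    by (simp_all add: Y_def Z_def abs_mult algebra_simps)
  moreover have "Y 0 = x" "Z 0 = \<mu> * x" by (simp_all add: Y_def Z_def)
  ultimately show ?thesis unfolding rate_mode_def by blast
qed

text \<open>With \<open>p = 1 / (2 \<epsilon>)\<close> the solutions are \<open>exp (- p t)\<close> times a trigonometric polynomial.\<close>

lemma rate_mode_complex:
  assumes "eps > 0" "4 * eps * nu > 1"
  shows "rate_mode nu (1 / (2 * eps)) x y"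
proof -
  define p where "p = 1 / (2 * eps)"
  define om where "om = sqrt (4 * eps * nu - 1) / (2 * eps)"
  have om: "om > 0" using assms by (simp add: om_def)
  have om2: "om\<^sup>2 = (4 * eps * nu - 1) / (2 * eps)\<^sup>2"
    using assms by (simp add: om_def power_divide)
  have char1: "eps * (p\<^sup>2 - om\<^sup>2) - p + nu = 0"
    using assms(1) unfolding om2 by (simp add: p_def power2_eq_square field_simps)
  have char2: "2 * eps * p = 1" using assms(1) by (simp add: p_def)
  define h where "h a b t = exp (- p * t) * (a * cos (om * t) + b * sin (om * t))" for a b t
  have h_deriv: "(h a b has_real_derivative h (- p * a + om * b) (- p * b - om * a) t) (at t)" for a b t
    unfolding h_def[abs_def] by (auto intro!: derivative_eq_intros simp: algebra_simps)
  have h_bound: "\<bar>h a b t\<bar> \<le> (\<bar>a\<bar> + \<bar>b\<bar>) * exp (- p * t)" for a b t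
  proof -
    have "\<bar>a * cos (om * t) + b * sin (om * t)\<bar> \<le> \<bar>a\<bar> * \<bar>cos (om * t)\<bar> + \<bar>b\<bar> * \<bar>sin (om * t)\<bar>"
      by (metis abs_mult abs_triangle_ineq)
    also have "\<dots> \<le> \<bar>a\<bar> * 1 + \<bar>b\<bar> * 1" by (intro add_mono mult_left_mono) auto
    finally show ?thesis by (simp add: h_def abs_mult mult.commute mult_left_mono)
  qed
  \<comment> \<open>fits the initial velocity \<open>y\<close>\<close>
  define b where "b = (y + p * x) / om"
  define a1 where "a1 = - p * x + om * b"
  define b1 where "b1 = - p * b - om * x"
  have a1: "a1 = y" using om by (simp add: a1_def b_def)
  have eq: "eps * h (- p * a1 + om * b1) (- p * b1 - om * a1) t + h a1 b1 t + nu * h x b t = 0" for t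
  proof -
    have "eps * (- p * a1 + om * b1) + a1 + nu * x = (eps * (p\<^sup>2 - om\<^sup>2) - p + nu) * x + om * b * (1 - 2 * eps * p)"
      by (simp add: a1_def b1_def power2_eq_square algebra_simps)
    also have "\<dots> = 0" by (simp add: char1 char2)
    finally have 1: "eps * (- p * a1 + om * b1) + a1 + nu * x = 0" .
    have "eps * (- p * b1 - om * a1) + b1 + nu * b = (eps * (p\<^sup>2 - om\<^sup>2) - p + nu) * b - om * x * (1 - 2 * eps * p)"
      by (simp add: a1_def b1_def power2_eq_square algebra_simps)
    also have "\<dots> = 0" by (simp add: char1 char2)
    finally have 2: "eps * (- p * b1 - om * a1) + b1 + nu * b = 0" .
    have "eps * h (- p * a1 + om * b1) (- p * b1 - om * a1) t + h a1 b1 t + nu * h x b t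
      = h (eps * (- p * a1 + om * b1) + a1 + nu * x) (eps * (- p * b1 - om * a1) + b1 + nu * b) t"
      unfolding h_def by (simp add: algebra_simps)
    then show ?thesis unfolding 1 2 by (simp add: h_def)
  qed
  have osc: "oscillation nu (h x b) (h a1 b1) (h (- p * a1 + om * b1) (- p * b1 - om * a1))"
    unfolding oscillation_def using eq h_deriv[of x b] h_deriv[of a1 b1] by (simp add: a1_def b1_def)
  define K where "K = (\<bar>x\<bar> + \<bar>b\<bar>) + (\<bar>a1\<bar> + \<bar>b1\<bar>)"
  have "\<bar>h x b t\<bar> \<le> K * exp (- p * t)" "\<bar>h a1 b1 t\<bar> \<le> K * exp (- p * t)" for t
  proof -
    have "(\<bar>x\<bar> + \<bar>b\<bar>) * exp (- p * t) \<le> K * exp (- p * t)" "(\<bar>a1\<bar> + \<bar>b1\<bar>) * exp (- p * t) \<le> K * exp (- p * t)"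
      unfolding K_def by (intro mult_right_mono; simp)+
    then show "\<bar>h x b t\<bar> \<le> K * exp (- p * t)" "\<bar>h a1 b1 t\<bar> \<le> K * exp (- p * t)"
      using h_bound[of x b t] h_bound[of a1 b1 t] by linarith+
  qed
  moreover have "h x b 0 = x" "h a1 b1 0 = y" by (simp_all add: h_def a1)
  ultimately show ?thesis
    unfolding rate_mode_def p_def[symmetric] using osc by blast
qed

text \<open>The usual \<open>(1 - sqrt (1 - 4 \<epsilon> \<nu>)) / (2 \<epsilon>)\<close> in a form that is also correct for \<open>\<epsilon> = 0\<close>, where it is \<open>\<nu>\<close>.\<close>

definition slow_rate :: "real \<Rightarrow> real" where
  "slow_rate nu = 2 * nu / (1 + sqrt (1 - 4 * eps * nu))"

definition fast_rate :: "real \<Rightarrow> real" where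
  "fast_rate nu = (1 + sqrt (1 - 4 * eps * nu)) / (2 * eps)"

lemma slow_rate_root:
  assumes "4 * eps * nu \<le> 1"
  shows "eps * (- slow_rate nu)\<^sup>2 + (- slow_rate nu) + nu = 0"
proof -
  define q where "q = sqrt (1 - 4 * eps * nu)"
  have q: "q \<ge> 0" "q\<^sup>2 = 1 - 4 * eps * nu" using assms by (simp_all add: q_def)
  have "(1 + q)\<^sup>2 * (eps * (- slow_rate nu)\<^sup>2 + (- slow_rate nu) + nu)
      = nu * (4 * eps * nu - 2 * (1 + q) + (1 + q)\<^sup>2)"
  proof -
    have s: "(1 + q) * slow_rate nu = 2 * nu" using q(1) by (simp add: slow_rate_def q_def[symmetric])
    have "(1 + q)\<^sup>2 * (eps * (- slow_rate nu)\<^sup>2 + (- slow_rate nu) + nu)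
      = eps * ((1 + q) * slow_rate nu)\<^sup>2 - (1 + q) * ((1 + q) * slow_rate nu) + (1 + q)\<^sup>2 * nu"
      by (simp add: power2_eq_square algebra_simps)
    then show ?thesis unfolding s by (simp add: power2_eq_square algebra_simps)
  qed
  also have "\<dots> = nu * (4 * eps * nu - 1 + q\<^sup>2)" by (simp add: power2_eq_square algebra_simps)
  also have "\<dots> = 0" by (simp add: q)
  finally show ?thesis using q(1) by simp
qed

lemma fast_rate_root:
  assumes "4 * eps * nu \<le> 1" "eps > 0"
  shows "eps * (- fast_rate nu)\<^sup>2 + (- fast_rate nu) + nu = 0"
proof -
  define q where "q = sqrt (1 - 4 * eps * nu)"
  have q: "q\<^sup>2 = 1 - 4 * eps * nu" using assms by (simp add: q_def)
  have f: "2 * eps * fast_rate nu = 1 + q" using assms(2) by (simp add: fast_rate_def q_def)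
  have "4 * eps * (eps * (- fast_rate nu)\<^sup>2 + (- fast_rate nu) + nu)
     = (2 * eps * fast_rate nu)\<^sup>2 - 2 * (2 * eps * fast_rate nu) + 4 * eps * nu"
    by (simp add: power2_eq_square algebra_simps)
  also have "\<dots> = q\<^sup>2 - 1 + 4 * eps * nu" unfolding f by (simp add: power2_eq_square algebra_simps)
  also have "\<dots> = 0" by (simp add: q)
  finally show ?thesis using assms(2) by simp
qed

lemma slow_rate_mono:
  assumes "0 \<le> nu" "nu \<le> nu'" "4 * eps * nu' \<le> 1"
  shows "slow_rate nu \<le> slow_rate nu'"
proof -
  have "4 * eps * nu \<le> 4 * eps * nu'" using assms eps_nonneg by (intro mult_left_mono) auto
  then have "sqrt (1 - 4 * eps * nu') \<le> sqrt (1 - 4 * eps * nu)" "0 \<le> sqrt (1 - 4 * eps * nu')"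
    using assms by auto
  moreover have "0 < 1 + sqrt (1 - 4 * eps * nu')" using calculation(2) by linarith
  ultimately show ?thesis unfolding slow_rate_def using assms by (intro frac_le) auto
qed

lemma slow_rate_nonneg: "0 \<le> nu \<Longrightarrow> 4 * eps * nu \<le> 1 \<Longrightarrow> 0 \<le> slow_rate nu"
  by (simp add: slow_rate_def)

lemma slow_rate_le:
  assumes "0 \<le> nu" "4 * eps * nu \<le> 1" "eps > 0"
  shows "slow_rate nu \<le> 1 / (2 * eps)"
proof -
  have "1 \<le> 1 + sqrt (1 - 4 * eps * nu)" using assms by simp
  then have "slow_rate nu \<le> 2 * nu / 1"
    unfolding slow_rate_def using assms by (intro frac_le) auto
  also have "\<dots> \<le> 1 / (2 * eps)" using assms by (simp add: field_simps)
  finally show ?thesis .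
qed

lemma fast_rate_ge: "4 * eps * nu \<le> 1 \<Longrightarrow> eps > 0 \<Longrightarrow> 1 / (2 * eps) \<le> fast_rate nu"
  unfolding fast_rate_def by (intro divide_right_mono) auto

end

locale equilibrium_dichotomy = dichotomy +
  fixes B :: real and N :: nat
  assumes V_eq: "V = tangent phase (equilibrium B)"
    and frechet: "\<And>t. t \<ge> 0 \<Longrightarrow> has_frechet E_space E_norm E_space E_norm phase (S t) (DS t) (equilibrium B)"
    and codim: "has_codim N V Q"
begin

lemma rate_mode_in_V:
  assumes "linear_along B n k" "rate_mode (lam n - k) c x y"
  shows "mode n x y \<in> V"
proof -
  obtain Y Z W where osc: "oscillation (lam n - k) Y Z W" "Y 0 = x" "Z 0 = y"
    using assms(2) by (auto simp: rate_mode_def)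
  have "eps * W 0 + Z 0 + (lam n - k) * Y 0 = 0" using osc(1) by (simp add: oscillation_def)
  then have "y = - (lam n - k) * x" if "eps = 0" using that osc by (simp add: algebra_simps)
  then show ?thesis unfolding V_eq by (rule mode_tangent[OF assms(1)])
qed

lemma fast_mode_in_Q:
  assumes lin: "linear_along B n k" and rate: "rate_mode (lam n - k) c x y"
    and "c \<ge> 0" "c > \<theta> - \<kappa>"
  shows "mode n x y \<in> Q"
proof -
  obtain Y Z W K where osc: "oscillation (lam n - k) Y Z W" "Y 0 = x" "Z 0 = y"
    and K: "\<And>t. \<bar>Y t\<bar> \<le> K * exp (- c * t)" "\<And>t. \<bar>Z t\<bar> \<le> K * exp (- c * t)"
    using rate unfolding rate_mode_def by metis
  have K0: "K \<ge> 0" using K(1)[of 0] by simp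
  have bounded: "\<bar>Y t\<bar> \<le> K" if "t \<ge> 0" for t
  proof -
    have "K * exp (- c * t) \<le> K * 1" using K0 that \<open>c \<ge> 0\<close> by (intro mult_left_mono) auto
    then show ?thesis using K(1)[of t] by linarith
  qed
  show ?thesis
  proof (rule in_Q_if_decay[OF rate_mode_in_V[OF lin rate] assms(4)])
    fix t :: real assume t: "t \<ge> 0"
    have "DS t (mode n x y) = mode n (Y t) (Z t)"
      using derivative_on_mode[OF lin osc(1) bounded t frechet[OF t]] by (simp add: osc)
    then have "E_norm (DS t (mode n x y)) \<le> sqrt (lam n) * \<bar>Y t\<bar> + sqrt (weight n) * \<bar>Z t\<bar>"
      by (simp add: E_norm_mode_le)
    also have "\<dots> \<le> sqrt (lam n) * (K * exp (- c * t)) + sqrt (weight n) * (K * exp (- c * t))"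
      by (intro add_mono mult_left_mono K) auto
    finally show "E_norm (DS t (mode n x y)) \<le> ((sqrt (lam n) + sqrt (weight n)) * K) * exp (- c * t)"
      by (simp add: algebra_simps)
  qed
qed

lemma slow_mode_in_T:
  assumes lin: "linear_along B n k" and rate: "rate_mode (lam n - k) c x y"
    and "c \<ge> 0" "c < \<theta> + \<kappa>"
  shows "mode n x y \<in> T"
proof -
  obtain Y Z W K where osc: "oscillation (lam n - k) Y Z W" "Y 0 = x" "Z 0 = y"
    and K: "\<And>t. \<bar>Y t\<bar> \<le> K * exp (- c * t)" "\<And>t. \<bar>Z t\<bar> \<le> K * exp (- c * t)"
    using rate unfolding rate_mode_def by metis
  have K0: "K \<ge> 0" using K(1)[of 0] by simp
  show ?thesis
  proof (rule in_T_if_backward_bound[OF rate_mode_in_V[OF lin rate] assms(4)])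
    fix t :: real assume t: "t \<ge> 0"
    have exps: "exp (- c * (s + - t)) = exp (c * t) * exp (- c * s)" for s
      by (simp add: exp_add[symmetric] algebra_simps)
    have rate': "rate_mode (lam n - k) c (Y (- t)) (Z (- t))"
      unfolding rate_mode_def
    proof (intro exI conjI allI)
      show "oscillation (lam n - k) (\<lambda>s. Y (s + - t)) (\<lambda>s. Z (s + - t)) (\<lambda>s. W (s + - t))"
        by (rule oscillation_shift[OF osc(1)])
      fix s
      show "\<bar>Y (s + - t)\<bar> \<le> (K * exp (c * t)) * exp (- c * s)" "\<bar>Z (s + - t)\<bar> \<le> (K * exp (c * t)) * exp (- c * s)"
        using K[of "s + - t"] by (simp_all only: exps mult.assoc)
    qed auto
    have bounded: "\<bar>Y (s + - t)\<bar> \<le> K * exp (c * t)" if "s \<ge> 0" for s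
    proof -
      have "K * (exp (c * t) * exp (- c * s)) \<le> K * (exp (c * t) * 1)"
        using K0 that \<open>c \<ge> 0\<close> by (intro mult_left_mono) auto
      then show ?thesis using K(1)[of "s + - t"] unfolding exps by simp
    qed
    have "DS t (mode n (Y (0 + - t)) (Z (0 + - t))) = mode n (Y (t + - t)) (Z (t + - t))"
      by (rule derivative_on_mode[OF lin oscillation_shift[OF osc(1)] bounded t frechet[OF t]])
    then have DS: "DS t (mode n (Y (- t)) (Z (- t))) = mode n x y" by (simp add: osc)
    have "E_norm (mode n (Y (- t)) (Z (- t))) \<le> sqrt (lam n) * \<bar>Y (- t)\<bar> + sqrt (weight n) * \<bar>Z (- t)\<bar>"
      by (rule E_norm_mode_le)
    also have "\<dots> \<le> sqrt (lam n) * (K * exp (c * t)) + sqrt (weight n) * (K * exp (c * t))"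
      using K[of "- t"] by (intro add_mono mult_left_mono) auto
    finally have "E_norm (mode n (Y (- t)) (Z (- t))) \<le> ((sqrt (lam n) + sqrt (weight n)) * K) * exp (c * t)"
      by (simp add: algebra_simps)
    then show "\<exists>\<zeta>\<in>V. DS t \<zeta> = mode n x y \<and> E_norm \<zeta> \<le> ((sqrt (lam n) + sqrt (weight n)) * K) * exp (c * t)"
      using DS rate_mode_in_V[OF lin rate'] by blast
  qed
qed

lemma too_many_slow_modes:
  assumes "\<And>i. i \<le> N \<Longrightarrow> mode (j + i) 1 (y i) \<in> T"
  shows False
proof -
  obtain c where c: "(\<Sum>i\<le>N. c i *\<^sub>R mode (j + i) 1 (y i)) = 0" "\<exists>i\<le>N. c i \<noteq> (0::real)"
    using complement_no_larger_family[OF codim direct, of "\<lambda>i. mode (j + i) 1 (y i)"] assms by blast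
  have "(\<Sum>i\<le>N. c i *\<^sub>R e (j + i)) = 0"
    using arg_cong[OF c(1), of fst] by (simp add: fst_sum mode_def)
  then have z: "(\<Sum>i\<le>N. c i *\<^sub>R e (j + i)) \<bullet> e (j + m) = 0" for m by simp
  have d: "(\<Sum>i\<le>N. c i *\<^sub>R e (j + i)) \<bullet> e (j + m) = (\<Sum>i\<le>N. if i = m then c i else 0)" for m
    unfolding inner_sum_left by (intro sum.cong) (auto simp: orth)
  have "c m = 0" if "m \<le> N" for m using z[of m] that unfolding d by simp
  then show False using c(2) by blast
qed

text \<open>The slow space has dimension \<open>k + 1\<close>, hence contains a nonzero \<open>\<eta>\<close> annihilated by the \<open>k\<close>
functionals. All its modes lie in \<open>Q\<close>; as \<open>Q\<close> is closed, so does \<open>\<eta>\<close>, although \<open>T\<close> and \<open>Q\<close> meet only in \<open>0\<close>.\<close>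

lemma too_many_fast_modes:
  assumes N: "N = Suc k" and l: "\<And>n. linear (l n)"
    and low: "\<And>n \<eta>. \<eta> \<in> V \<Longrightarrow> n < k \<Longrightarrow> l n \<eta> = (0::real) \<Longrightarrow> mode n (fst \<eta> \<bullet> e n) (snd \<eta> n) \<in> Q"
    and high: "\<And>n \<eta>. \<eta> \<in> V \<Longrightarrow> n \<ge> k \<Longrightarrow> mode n (fst \<eta> \<bullet> e n) (snd \<eta> n) \<in> Q"
  shows False
proof -
  obtain \<eta> where \<eta>: "\<eta> \<in> T" "\<eta> \<noteq> 0" "\<And>i. i < k \<Longrightarrow> l i \<eta> = 0"
    by (rule complement_meets_kernel[where l = l, OF codim[unfolded N] direct l]) (rule that)
  have V: "\<eta> \<in> V" and E: "\<eta> \<in> E_space" using \<eta>(1) T_subset V_subset by auto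
  define q where "q m = (\<Sum>n<m. mode n (fst \<eta> \<bullet> e n) (snd \<eta> n))" for m
  have Q: "subspace Q" "T \<inter> Q = {0}" using direct by (auto simp: direct_sum_def)
  have qQ: "q m \<in> Q" for m
    unfolding q_def using low[OF V _ \<eta>(3)] high[OF V]
    by (intro subspace_sum[OF Q(1)]) (metis not_le)
  define a where "a n = lam n * (fst \<eta> \<bullet> e n)\<^sup>2 + weight n * (snd \<eta> n)\<^sup>2" for n
  have s: "summable (\<lambda>n. lam n * (fst \<eta> \<bullet> e n)\<^sup>2)" "summable (\<lambda>n. weight n * (snd \<eta> n)\<^sup>2)"
    using E by (cases \<eta>; simp add: E_space_iff)+
  have a_sum: "a sums (suminf a)" unfolding a_def using s by (intro summable_sums summable_add)
  have sq: "(E_norm (\<eta> - q m))\<^sup>2 = suminf a - (\<Sum>n<m. a n)" for m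
  proof -
    have mem: "\<eta> - q m \<in> E_space"
      using E qQ[of m] Q_subset V_subset by (intro subspace_diff[OF E_space_subspace]) auto
    have "fst (q m) \<bullet> e n = (if n < m then fst \<eta> \<bullet> e n else 0)" for n
      by (simp add: q_def fst_sum mode_def inner_finite_sum)
    then have f: "fst (\<eta> - q m) \<bullet> e n = (if n < m then 0 else fst \<eta> \<bullet> e n)" for n
      by (simp add: inner_diff_left)
    have "snd (q m) n = (\<Sum>i<m. if n = i then snd \<eta> i else 0)" for n
      by (simp add: q_def snd_sum mode_def single_def sum_fun_apply)
    then have g: "snd (\<eta> - q m) n = (if n < m then 0 else snd \<eta> n)" for n by simp
    have s': "summable (\<lambda>n. lam n * (fst (\<eta> - q m) \<bullet> e n)\<^sup>2)" "summable (\<lambda>n. weight n * (snd (\<eta> - q m) n)\<^sup>2)"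
      using mem by (cases "\<eta> - q m"; simp add: E_space_iff)+
    have "(E_norm (\<eta> - q m))\<^sup>2 = (\<Sum>n. lam n * (fst (\<eta> - q m) \<bullet> e n)\<^sup>2 + weight n * (snd (\<eta> - q m) n)\<^sup>2)"
      by (simp only: E_norm_sq(1)[OF mem] suminf_add[OF s'])
    also have "\<dots> = (\<Sum>n. if n < m then 0 else a n)"
      unfolding f g a_def by (intro arg_cong[of _ _ suminf] ext) simp
    also have "\<dots> = suminf a - (\<Sum>n<m. a n)"
    proof (rule sums_unique[symmetric])
      have "(\<lambda>n. if n \<in> {..<m} then a n else 0) sums (\<Sum>n<m. a n)" by (rule sums_If_finite_set) simp
      from sums_diff[OF a_sum this]
      show "(\<lambda>n. if n < m then 0 else a n) sums (suminf a - (\<Sum>n<m. a n))"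
        by (rule sums_cong[THEN iffD1, rotated]) auto
    qed
    finally show ?thesis .
  qed
  have "(\<lambda>m. suminf a - (\<Sum>n<m. a n)) \<longlonglongrightarrow> suminf a - suminf a"
    using a_sum by (intro tendsto_intros) (simp add: sums_def)
  then have "(\<lambda>m. sqrt ((E_norm (\<eta> - q m))\<^sup>2)) \<longlonglongrightarrow> sqrt 0"
    unfolding sq by (intro tendsto_intros) simp
  moreover have "sqrt ((E_norm (\<eta> - q m))\<^sup>2) = E_norm (\<eta> - q m)" for m
    using E qQ[of m] Q_subset V_subset by (intro real_sqrt_abs[THEN trans] abs_of_nonneg E_norm_sq subspace_diff[OF E_space_subspace]) auto
  ultimately have "(\<lambda>m. E_norm (\<eta> - q m)) \<longlonglongrightarrow> 0" by simp
  then have "\<eta> \<in> Q" by (rule Q_closed[where q = q, OF V qQ])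
  then show False using \<eta>(1,2) Q(2) by blast
qed

end

section \<open>Splittings obtained from a normally hyperbolic manifold\<close>

context wave begin

text \<open>The equilibrium is approached by points of the manifold, and the manifold is closed, being a Lipschitz
graph over a finite-dimensional space. The second fact is used in the form of an explicit estimate: the
distance from the equilibrium to the point over its projection is bounded by a constant multiple of the
distance to any other point of the manifold.\<close>

lemma inertial_manifold_contains_equilibria:
  assumes IM: "inertial_manifold N M" and lin: "linear_along B n k"
  shows "equilibrium B \<in> M"
proof -
  let ?\<xi> = "equilibrium B"
  obtain \<Phi> K where M: "M = \<Phi> ` range (P\<^sub>N e N)" "M \<subseteq> phase"
    and base_all: "\<forall>p\<in>range (P\<^sub>N e N). P\<^sub>N e N (fst (\<Phi> p)) = p"
    and Lip_all: "\<forall>p\<in>range (P\<^sub>N e N). \<forall>q\<in>range (P\<^sub>N e N). E_norm (\<Phi> p - \<Phi> q) \<le> K * norm (p - q)"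
    using IM unfolding inertial_manifold_def lipschitz_submanifold_def by (elim exE conjE) (rule that)
  note base = bspec[OF base_all] and Lip = bspec[OF bspec[OF Lip_all]]
  have \<xi>phase: "?\<xi> \<in> phase" using S_equilibrium(2)[OF lin, of 0] by simp
  obtain C \<theta> where C\<theta>: "C > 0" "\<theta> > 0" and attract:
    "\<forall>\<xi>\<^sub>0\<in>phase. \<exists>\<xi>\<^sub>1\<in>M. \<forall>t\<ge>0. E_norm (S t \<xi>\<^sub>0 - S t \<xi>\<^sub>1) \<le> C * E_norm \<xi>\<^sub>0 * exp (- \<theta> * t)"
    using IM unfolding inertial_manifold_def by (elim exE conjE) (rule that)
  obtain \<xi>1 where \<xi>1: "\<xi>1 \<in> M"
    "\<And>t. t \<ge> 0 \<Longrightarrow> E_norm (S t ?\<xi> - S t \<xi>1) \<le> C * E_norm ?\<xi> * exp (- \<theta> * t)"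
    using bspec[OF attract \<xi>phase] by blast
  have invariant: "S t \<xi>1 \<in> M" if "t \<ge> 0" for t
    using IM \<xi>1(1) that by (auto simp: inertial_manifold_def)
  have \<xi>E: "?\<xi> \<in> E_space" by (rule phase_E_space[OF \<xi>phase])
  define p where "p = P\<^sub>N e N (fst ?\<xi>)"
  have p: "p \<in> range (P\<^sub>N e N)" by (simp add: p_def)
  have pM: "\<Phi> p \<in> E_space" using M p phase_E_space by blast
  define A where "A = 1 + \<bar>K\<bar> * (real N * inverse (sqrt (lam 0)))"
  have near: "E_norm (?\<xi> - \<Phi> p) \<le> A * E_norm (?\<xi> - \<zeta>)" if \<zeta>: "\<zeta> \<in> M" for \<zeta>
  proof -
    obtain q where q: "q \<in> range (P\<^sub>N e N)" "\<zeta> = \<Phi> q" using M \<zeta> by blast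
    have \<zeta>E: "\<zeta> \<in> E_space" using \<zeta> M phase_E_space by blast
    have dE: "?\<xi> - \<zeta> \<in> E_space" by (intro subspace_diff[OF E_space_subspace] \<xi>E \<zeta>E)
    have "norm (p - q) = norm (P\<^sub>N e N (fst (?\<xi> - \<zeta>)))"
      using base[OF q(1)] q(2) by (simp add: p_def P_diff)
    also have "\<dots> \<le> (\<Sum>n<N. norm (fst (?\<xi> - \<zeta>)))"
      unfolding P\<^sub>N_def
    proof (rule sum_norm_le)
      fix n show "norm ((fst (?\<xi> - \<zeta>) \<bullet> e n) *\<^sub>R e n) \<le> norm (fst (?\<xi> - \<zeta>))"
        using Cauchy_Schwarz_ineq2[of "fst (?\<xi> - \<zeta>)" "e n"] by simp
    qed
    also have "\<dots> = real N * norm (fst (?\<xi> - \<zeta>))" by simp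
    also have "\<dots> \<le> real N * (inverse (sqrt (lam 0)) * E_norm (?\<xi> - \<zeta>))"
      using norm_fst_le_E_norm[OF dE] lam_pos[of 0] by (intro mult_left_mono) (auto simp: field_simps)
    finally have pq: "norm (p - q) \<le> real N * (inverse (sqrt (lam 0)) * E_norm (?\<xi> - \<zeta>))" .
    have "E_norm (\<zeta> - \<Phi> p) \<le> K * norm (q - p)" using Lip[OF q(1) p] q(2) by simp
    also have "\<dots> \<le> \<bar>K\<bar> * norm (p - q)" by (simp add: norm_minus_commute mult_right_mono)
    also have "\<dots> \<le> \<bar>K\<bar> * (real N * (inverse (sqrt (lam 0)) * E_norm (?\<xi> - \<zeta>)))"
      by (intro mult_left_mono pq) simp
    finally have "E_norm ((?\<xi> - \<zeta>) + (\<zeta> - \<Phi> p)) \<le> E_norm (?\<xi> - \<zeta>) + \<bar>K\<bar> * (real N * (inverse (sqrt (lam 0)) * E_norm (?\<xi> - \<zeta>)))"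
      by (intro order_trans[OF E_norm_add_le] add_mono dE subspace_diff[OF E_space_subspace] \<zeta>E pM) auto
    then show ?thesis by (simp add: A_def algebra_simps)
  qed
  have A0: "A \<ge> 0" using lam_pos[of 0] by (simp add: A_def)
  have "E_norm (?\<xi> - \<Phi> p) \<le> (A * (C * E_norm ?\<xi>)) * exp (- \<theta> * t)" if t: "t \<ge> 0" for t
  proof -
    have "E_norm (?\<xi> - \<Phi> p) \<le> A * E_norm (?\<xi> - S t \<xi>1)" by (rule near[OF invariant[OF t]])
    also have "\<dots> \<le> A * (C * E_norm ?\<xi> * exp (- \<theta> * t))"
      using \<xi>1(2)[OF t] S_equilibrium(1)[OF lin t] A0 by (intro mult_left_mono) auto
    finally show ?thesis by (simp add: mult.assoc)
  qed
  from nonpos_if_exp_small[OF C\<theta>(2) this]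
  have "?\<xi> - \<Phi> p = 0" by (intro E_norm_eq_0D subspace_diff[OF E_space_subspace] \<xi>E pM)
  then show ?thesis using M p by auto
qed

text \<open>The chain rule for the curve that represents a tangent vector.\<close>

lemma tangent_invariant:
  assumes M: "M \<subseteq> phase" and inv: "S t ` M \<subseteq> M" and \<xi>: "S t \<xi> = \<xi>" "\<xi> \<in> phase"
    and D: "has_frechet E_space E_norm E_space E_norm phase (S t) D \<xi>"
    and \<eta>: "\<eta> \<in> tangent M \<xi>"
  shows "D \<eta> \<in> tangent M \<xi>"
proof -
  obtain \<gamma> d where \<gamma>0: "\<gamma> 0 = \<xi>" "d > 0" "\<forall>s. \<bar>s\<bar> < d \<longrightarrow> \<gamma> s \<in> M"
    "((\<lambda>s. E_norm (inverse s *\<^sub>R (\<gamma> s - \<xi>) - \<eta>)) \<longlongrightarrow> 0) (at (0::real))" and \<eta>E: "\<eta> \<in> E_space"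
    using \<eta> unfolding tangent_def by blast
  note \<gamma> = \<gamma>0(1,2) \<gamma>0(3)[rule_format] \<gamma>0(4)
  have linD: "linear D" and D_E: "\<And>h. h \<in> E_space \<Longrightarrow> D h \<in> E_space" and D_fin: "op_norm E_space E_norm E_norm D < \<infinity>"
    and D_err: "\<And>q. q > 0 \<Longrightarrow> \<exists>d>0. \<forall>y\<in>phase. E_norm (y - \<xi>) < d \<longrightarrow>
        E_norm (S t y - S t \<xi> - D (y - \<xi>)) \<le> q * E_norm (y - \<xi>)"
    using D by (auto simp: has_frechet_def)
  have diff: "a - b \<in> E_space" if "a \<in> E_space" "b \<in> E_space" for a b
    using subspace_diff[OF E_space_subspace that] .
  have scale: "r *\<^sub>R a \<in> E_space" if "a \<in> E_space" for a and r :: real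
    using subspace_scale[OF E_space_subspace that] .
  obtain C where C: "op_norm E_space E_norm E_norm D \<le> ereal C"
    using ereal_dense2[OF D_fin] less_imp_le by blast
  have D_le: "E_norm (D h) \<le> \<bar>C\<bar> * E_norm h" if h: "h \<in> E_space" for h
  proof (cases "E_norm h > 0")
    case True
    have "E_norm (D h) \<le> C * E_norm h" by (rule op_norm_bound[OF C h True])
    also have "\<dots> \<le> \<bar>C\<bar> * E_norm h" using True by (intro mult_right_mono) auto
    finally show ?thesis .
  next
    case False
    then have "h = 0" using E_norm_eq_0D[OF h] by simp
    then show ?thesis using linear_0[OF linD] by simp
  qed
  define q where "q s = inverse s *\<^sub>R (\<gamma> s - \<xi>)" for s
  have \<gamma>E: "\<gamma> s \<in> E_space" "\<gamma> s \<in> phase" if "\<bar>s\<bar> < d" for s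
    using \<gamma>(3)[OF that] M phase_E_space by blast+
  have \<xi>E: "\<xi> \<in> E_space" by (rule phase_E_space[OF \<xi>(2)])
  have qE: "q s \<in> E_space" if "\<bar>s\<bar> < d" for s
    unfolding q_def by (intro scale diff \<gamma>E \<xi>E that)
  define \<delta> where "\<delta> s = S t (\<gamma> s)" for s
  have \<delta>M: "\<delta> s \<in> M" if "\<bar>s\<bar> < d" for s using inv \<gamma>(3)[OF that] by (auto simp: \<delta>_def)
  have \<delta>E: "\<delta> s \<in> E_space" if "\<bar>s\<bar> < d" for s using \<delta>M[OF that] M phase_E_space by blast
  have ev_d: "\<forall>\<^sub>F s in at 0. \<bar>s\<bar> < d"
    using \<gamma>(2) by (auto simp: eventually_at intro!: exI[of _ d])
  have q_lim: "((\<lambda>s. E_norm (q s - \<eta>)) \<longlongrightarrow> 0) (at 0)" using \<gamma>(4) by (simp add: q_def)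
  have ev_q: "\<forall>\<^sub>F s in at 0. E_norm (q s) < E_norm \<eta> + 1"
  proof -
    have "\<forall>\<^sub>F s in at 0. E_norm (q s - \<eta>) < 1" using order_tendstoD(2)[OF q_lim] by simp
    with ev_d show ?thesis
    proof eventually_elim
      case (elim s)
      have "E_norm ((q s - \<eta>) + \<eta>) \<le> E_norm (q s - \<eta>) + E_norm \<eta>"
        by (intro E_norm_add_le diff qE \<eta>E elim)
      then show ?case using elim by simp
    qed
  qed
  have \<eta>0: "E_norm \<eta> \<ge> 0" by (rule E_norm_sq[OF \<eta>E])
  have "((\<lambda>s. E_norm (inverse s *\<^sub>R (\<delta> s - \<xi>) - D \<eta>)) \<longlongrightarrow> 0) (at 0)"
  proof (rule tendstoI)
    fix r :: real assume r: "r > 0"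
    \<comment> \<open>half of the error \<open>r\<close> is spent on the linearisation, half on the velocity of the curve\<close>
    define q0 where "q0 = r / (2 * (E_norm \<eta> + 1))"
    have q0: "q0 > 0" using r \<eta>0 by (simp add: q0_def)
    obtain d' where d': "d' > 0" "\<And>y. y \<in> phase \<Longrightarrow> E_norm (y - \<xi>) < d' \<Longrightarrow>
        E_norm (S t y - S t \<xi> - D (y - \<xi>)) \<le> q0 * E_norm (y - \<xi>)" using D_err[OF q0] by blast
    have "\<forall>\<^sub>F s in at (0::real). \<bar>s\<bar> < d' / (E_norm \<eta> + 1)"
      using d'(1) \<eta>0 by (auto simp: eventually_at intro!: exI[of _ "d' / (E_norm \<eta> + 1)"])
    moreover have "\<forall>\<^sub>F s in at (0::real). s \<noteq> 0" by (simp add: eventually_at_filter)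
    moreover have "\<forall>\<^sub>F s in at 0. E_norm (q s - \<eta>) < r / (2 * (\<bar>C\<bar> + 1))"
      using order_tendstoD(2)[OF q_lim, of "r / (2 * (\<bar>C\<bar> + 1))"] r by (simp add: add_nonneg_pos)
    ultimately show "\<forall>\<^sub>F s in at 0. dist (E_norm (inverse s *\<^sub>R (\<delta> s - \<xi>) - D \<eta>)) 0 < r"
      using ev_d ev_q
    proof eventually_elim
      case (elim s)
      note s = elim
      have \<gamma>q: "\<gamma> s - \<xi> = s *\<^sub>R q s" using s(2) by (simp add: q_def)
      have n\<gamma>: "E_norm (\<gamma> s - \<xi>) = \<bar>s\<bar> * E_norm (q s)" unfolding \<gamma>q by (rule E_norm_scale[OF qE[OF s(4)]])
      have "\<bar>s\<bar> * E_norm (q s) \<le> \<bar>s\<bar> * (E_norm \<eta> + 1)" using s(5) by (intro mult_left_mono) auto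
      also have "\<dots> < d'" using s(1) \<eta>0 by (simp add: field_simps)
      finally have "E_norm (S t (\<gamma> s) - S t \<xi> - D (\<gamma> s - \<xi>)) \<le> q0 * E_norm (\<gamma> s - \<xi>)"
        using d'(2)[OF \<gamma>E(2)[OF s(4)]] n\<gamma> by simp
      then have err: "E_norm (\<delta> s - \<xi> - D (\<gamma> s - \<xi>)) \<le> q0 * (\<bar>s\<bar> * E_norm (q s))"
        by (simp add: \<delta>_def \<xi>(1) n\<gamma>)
      have D\<gamma>: "D (\<gamma> s - \<xi>) = s *\<^sub>R D (q s)" unfolding \<gamma>q by (rule linear_scale[OF linD])
      let ?a = "\<delta> s - \<xi> - D (\<gamma> s - \<xi>)"
      have aE: "?a \<in> E_space" by (intro diff \<delta>E \<xi>E D_E \<gamma>E s)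
      have eq: "inverse s *\<^sub>R (\<delta> s - \<xi>) - D \<eta> = inverse s *\<^sub>R ?a + D (q s - \<eta>)"
        using s(2) by (simp add: D\<gamma> linear_diff[OF linD, of "q s" \<eta>] scaleR_diff_right)
      have "E_norm (inverse s *\<^sub>R ?a) \<le> q0 * E_norm (q s)"
        using err s(2) unfolding E_norm_scale[OF aE] by (simp add: field_simps)
      also have "\<dots> \<le> q0 * (E_norm \<eta> + 1)" using s(5) q0 by (intro mult_left_mono) auto
      also have "\<dots> = r / 2" using \<eta>0 by (simp add: q0_def field_simps)
      finally have 1: "E_norm (inverse s *\<^sub>R ?a) \<le> r / 2" .
      have "E_norm (D (q s - \<eta>)) \<le> \<bar>C\<bar> * E_norm (q s - \<eta>)" by (intro D_le diff qE \<eta>E s)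
      also have "\<dots> \<le> (\<bar>C\<bar> + 1) * E_norm (q s - \<eta>)"
        using E_norm_sq(2)[OF diff[OF qE[OF s(4)] \<eta>E]] by (intro mult_right_mono) auto
      also have "\<dots> < (\<bar>C\<bar> + 1) * (r / (2 * (\<bar>C\<bar> + 1)))" using s(3) by (intro mult_strict_left_mono) auto
      also have "\<dots> = r / 2" using abs_ge_zero[of C] by (simp add: field_simps add_nonneg_eq_0_iff)
      finally have 2: "E_norm (D (q s - \<eta>)) < r / 2" .
      have rhsE: "inverse s *\<^sub>R ?a \<in> E_space" "D (q s - \<eta>) \<in> E_space"
        by (intro scale aE D_E diff qE \<eta>E s)+
      have "E_norm (inverse s *\<^sub>R (\<delta> s - \<xi>) - D \<eta>) < r"
        unfolding eq using E_norm_add_le[OF rhsE] 1 2 by linarith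
      moreover have "E_norm (inverse s *\<^sub>R (\<delta> s - \<xi>) - D \<eta>) \<ge> 0"
        unfolding eq by (rule E_norm_sq(2)) (rule subspace_add[OF E_space_subspace rhsE])
      ultimately show ?case by simp
    qed
  qed
  then show ?thesis
    unfolding tangent_def using \<gamma>(1,2) \<delta>M D_E[OF \<eta>E] \<xi>(1)
    by (auto intro!: exI[of _ \<delta>] exI[of _ d] simp: \<delta>_def)
qed

definition splits_at :: "real \<Rightarrow> real \<Rightarrow> nat \<Rightarrow> real \<Rightarrow> bool" where
  "splits_at \<theta> \<kappa> N B \<longleftrightarrow> (\<exists>V T Q DS Cp C. equilibrium_dichotomy eps lam e F L V T Q DS Cp C \<theta> \<kappa> B N)"

lemma normally_hyperbolic_splits:
  assumes "normally_hyperbolic_IM N M"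
  obtains \<theta> \<kappa> where "\<kappa> > 0" "\<kappa> < \<theta>" "\<And>B n k. linear_along B n k \<Longrightarrow> splits_at \<theta> \<kappa> N B"
proof -
  have IM: "inertial_manifold N M" and NH: "normally_hyperbolic N M"
    using assms by (auto simp: normally_hyperbolic_IM_def)
  have Mphase: "M \<subseteq> phase" using IM by (auto simp: inertial_manifold_def lipschitz_submanifold_def)
  obtain \<beta> DS \<N> Cp C \<theta> \<kappa> where
    smooth: "\<forall>t\<ge>0. C1_holder \<beta> E_space E_norm E_space E_norm phase (S t) (DS t)"
    and inv: "\<forall>t\<ge>0. S t ` M = M"
    and codim: "\<forall>\<xi>\<in>M. has_codim N (tangent phase \<xi>) (\<N> \<xi>)"
    and DSN: "\<forall>\<xi>\<in>M. \<forall>t\<ge>0. DS t \<xi> ` \<N> \<xi> \<subseteq> \<N> (S t \<xi>)"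
    and dir: "\<forall>\<xi>\<in>M. direct_sum (tangent phase \<xi>) (tangent M \<xi>) (\<N> \<xi>)"
    and Cp: "\<forall>\<xi>\<in>M.
           op_norm (tangent phase \<xi>) E_norm E_norm (projector (tangent M \<xi>) (\<N> \<xi>)) +
           op_norm (tangent phase \<xi>) E_norm E_norm (projector (\<N> \<xi>) (tangent M \<xi>)) \<le> ereal Cp"
    and C: "C > 0" and \<kappa>: "\<kappa> > 0" "\<kappa> < \<theta>" and rate:
     "\<forall>\<xi>\<in>M. \<forall>t\<ge>0.
              (\<forall>\<eta>\<in>\<N> \<xi>. E_norm (DS t \<xi> \<eta>) \<le> C * exp (- (\<theta> + \<kappa>) * t) * E_norm \<eta>) \<and>
              (\<forall>\<eta>\<in>tangent M \<xi>.
                 E_norm (DS t \<xi> \<eta>) \<ge> inverse C * exp (- (\<theta> - \<kappa>) * t) * E_norm \<eta>)"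
    using NH unfolding normally_hyperbolic_def by (elim exE conjE) (rule that)
  show thesis
  proof (rule that[OF \<kappa>])
    fix B n k assume lin: "linear_along B n k"
    let ?\<xi> = "equilibrium B"
    have \<xi>M: "?\<xi> \<in> M" by (rule inertial_manifold_contains_equilibria[OF IM lin])
    have S\<xi>: "S t ?\<xi> = ?\<xi>" if "t \<ge> 0" for t by (rule S_equilibrium(1)[OF lin that])
    have \<xi>phase: "?\<xi> \<in> phase" using \<xi>M Mphase by blast
    let ?V = "tangent phase ?\<xi>" and ?T = "tangent M ?\<xi>" and ?Q = "\<N> ?\<xi>"
    have frechet: "has_frechet E_space E_norm E_space E_norm phase (S t) (DS t ?\<xi>) ?\<xi>" if "t \<ge> 0" for t
      using smooth that \<xi>phase by (auto simp: C1_holder_def)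
    have V_sub: "?V \<subseteq> E_space" by (auto simp: tangent_def)
    have dirs: "direct_sum ?V ?T ?Q" using dir \<xi>M by blast
    have zero: "0 \<in> ?T" "0 \<in> ?Q" using dirs by (auto simp: direct_sum_def subspace_0)
    have zeroV: "0 \<in> ?V" using direct_sum_add_mem[OF dirs zero] by simp
    have proj0: "projector ?T ?Q 0 = 0" "projector ?Q ?T 0 = 0"
      using direct_sum_projector[OF dirs zero] direct_sum_projector[OF direct_sum_commute[OF dirs] zero(2,1)] by auto
    have nonneg: "0 \<le> op_norm ?V E_norm E_norm f" for f :: "'a state \<Rightarrow> 'a state"
      unfolding op_norm_def using zeroV by (intro SUP_upper2[of 0]) auto
    have sum: "op_norm ?V E_norm E_norm (projector ?T ?Q) + op_norm ?V E_norm E_norm (projector ?Q ?T) \<le> ereal Cp"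
      using Cp \<xi>M by blast
    have bT: "op_norm ?V E_norm E_norm (projector ?T ?Q) \<le> ereal Cp"
      by (rule order_trans[OF add_increasing2[OF nonneg order_refl] sum])
    have bQ: "op_norm ?V E_norm E_norm (projector ?Q ?T) \<le> ereal Cp"
      by (rule order_trans[OF add_increasing[OF nonneg order_refl] sum])
    have bound: "E_norm (f \<eta>) \<le> Cp * E_norm \<eta>"
      if "op_norm ?V E_norm E_norm f \<le> ereal Cp" "f 0 = 0" "\<eta> \<in> ?V" for f \<eta>
    proof (cases "E_norm \<eta> > 0")
      case False
      then have "\<eta> = 0" using E_norm_eq_0D[of \<eta>] that(3) V_sub by auto
      then show ?thesis using that(2) by simp
    qed (rule op_norm_bound[OF that(1,3)])
    have "equilibrium_dichotomy eps lam e F L ?V ?T ?Q (\<lambda>t. DS t ?\<xi>) Cp C \<theta> \<kappa> B N"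
    proof (intro equilibrium_dichotomy.intro dichotomy.intro wave_axioms dichotomy_axioms.intro
        equilibrium_dichotomy_axioms.intro)
      show "?V \<subseteq> E_space" "direct_sum ?V ?T ?Q" by fact+
      show "linear (DS t ?\<xi>)" if "t \<ge> 0" for t using frechet[OF that] by (simp add: has_frechet_def)
      show "DS t ?\<xi> \<eta> \<in> ?T" if "t \<ge> 0" "\<eta> \<in> ?T" for t \<eta>
        by (rule tangent_invariant[OF Mphase _ S\<xi>[OF that(1)] \<xi>phase frechet[OF that(1)] that(2)])
           (use inv that(1) in simp)
      show "DS t ?\<xi> \<eta> \<in> ?Q" if "t \<ge> 0" "\<eta> \<in> ?Q" for t \<eta>
        using DSN \<xi>M that S\<xi>[OF that(1)] by (metis image_subset_iff)
      show "E_norm (projector ?T ?Q \<eta>) \<le> Cp * E_norm \<eta>" if "\<eta> \<in> ?V" for \<eta> by (rule bound[OF bT proj0(1) that])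
      show "E_norm (projector ?Q ?T \<eta>) \<le> Cp * E_norm \<eta>" if "\<eta> \<in> ?V" for \<eta> by (rule bound[OF bQ proj0(2) that])
      show "C > 0" "\<kappa> > 0" by fact+
      show "E_norm (DS t ?\<xi> \<eta>) \<le> C * exp (- (\<theta> + \<kappa>) * t) * E_norm \<eta>" if "t \<ge> 0" "\<eta> \<in> ?Q" for t \<eta>
        using rate \<xi>M that by blast
      show "inverse C * exp (- (\<theta> - \<kappa>) * t) * E_norm \<eta> \<le> E_norm (DS t ?\<xi> \<eta>)" if "t \<ge> 0" "\<eta> \<in> ?T" for t \<eta>
        using rate \<xi>M that by blast
      show "has_codim N ?V ?Q" using codim \<xi>M by blast
    qed (use frechet in auto)
    then show "splits_at \<theta> \<kappa> N B" unfolding splits_at_def by blast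
  qed
qed

end

section \<open>Incompatible spectral gaps\<close>

context wave begin

lemma linear_along_zero:
  assumes "r > 0" "\<And>u. norm u \<le> r \<Longrightarrow> F u = - l *\<^sub>R u"
  shows "linear_along 0 n (- l)"
  unfolding linear_along_def using assms by (intro exI[of _ r]) auto

text \<open>The phase space is a graph, on which a continuous linear functional vanishes near \<open>0\<close>.\<close>

lemma parabolic_tangent_at_zero:
  assumes near: "r > 0" "\<And>u. norm u \<le> r \<Longrightarrow> F u = - l *\<^sub>R u" and "eps = 0"
    and \<eta>: "\<eta> \<in> tangent phase (equilibrium 0)"
  shows "snd \<eta> n = - (lam n + l) * (fst \<eta> \<bullet> e n)"
proof -
  have zero: "equilibrium 0 = 0" by (simp add: equilibrium_def zero_prod_def)
  obtain \<gamma> d where \<gamma>: "d > 0" "\<forall>s. \<bar>s\<bar> < d \<longrightarrow> \<gamma> s \<in> phase"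
    "((\<lambda>s. E_norm (inverse s *\<^sub>R (\<gamma> s - 0) - \<eta>)) \<longlongrightarrow> 0) (at (0::real))" and \<eta>E: "\<eta> \<in> E_space"
    using \<eta> unfolding tangent_def zero by blast
  define q where "q s = inverse s *\<^sub>R \<gamma> s" for s
  have q_lim: "((\<lambda>s. E_norm (q s - \<eta>)) \<longlongrightarrow> 0) (at 0)" using \<gamma>(3) by (simp add: q_def)
  have \<eta>0: "E_norm \<eta> \<ge> 0" by (rule E_norm_sq[OF \<eta>E])
  define f where "f \<zeta> = snd \<zeta> n + (lam n + l) * (fst \<zeta> \<bullet> e n)" for \<zeta> :: "'a state"
  define A where "A = inverse (sqrt (weight n)) + \<bar>lam n + l\<bar> * inverse (sqrt (lam n))"
  have f_le: "\<bar>f \<zeta>\<bar> \<le> A * E_norm \<zeta>" if "\<zeta> \<in> E_space" for \<zeta>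
  proof -
    have "\<bar>snd \<zeta> n\<bar> \<le> inverse (sqrt (weight n)) * E_norm \<zeta>" "\<bar>fst \<zeta> \<bullet> e n\<bar> \<le> inverse (sqrt (lam n)) * E_norm \<zeta>"
      using coeff_le_E_norm[OF that, of n] lam_pos[of n] weight_pos[of n] by (simp_all add: field_simps)
    then have "\<bar>snd \<zeta> n\<bar> + \<bar>lam n + l\<bar> * \<bar>fst \<zeta> \<bullet> e n\<bar>
      \<le> inverse (sqrt (weight n)) * E_norm \<zeta> + \<bar>lam n + l\<bar> * (inverse (sqrt (lam n)) * E_norm \<zeta>)"
      by (intro add_mono mult_left_mono) auto
    moreover have "\<bar>f \<zeta>\<bar> \<le> \<bar>snd \<zeta> n\<bar> + \<bar>lam n + l\<bar> * \<bar>fst \<zeta> \<bullet> e n\<bar>"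
      unfolding f_def by (metis abs_mult abs_triangle_ineq)
    ultimately show ?thesis by (simp add: A_def algebra_simps)
  qed
  have ev: "\<forall>\<^sub>F s in at 0. \<bar>f \<eta>\<bar> \<le> A * E_norm (q s - \<eta>)"
  proof -
    define \<delta> where "\<delta> = min d (r * sqrt (lam 0) / (E_norm \<eta> + 1))"
    have "\<delta> > 0" using \<gamma>(1) near(1) lam_pos[of 0] \<eta>0 by (simp add: \<delta>_def)
    then have "\<forall>\<^sub>F s in at (0::real). s \<noteq> 0 \<and> \<bar>s\<bar> < \<delta>"
      by (auto simp: eventually_at intro!: exI[of _ \<delta>])
    moreover have "\<forall>\<^sub>F s in at 0. E_norm (q s - \<eta>) < 1" using order_tendstoD(2)[OF q_lim] by simp
    ultimately show ?thesis
    proof eventually_elim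
      case (elim s)
      have s: "s \<noteq> 0" "\<bar>s\<bar> < d" "\<bar>s\<bar> < r * sqrt (lam 0) / (E_norm \<eta> + 1)"
        using elim by (simp_all add: \<delta>_def)
      have mem: "\<gamma> s \<in> phase" using \<gamma>(2) s(2) by blast
      then have \<gamma>E: "\<gamma> s \<in> E_space" by (rule phase_E_space)
      have qE: "q s \<in> E_space" unfolding q_def by (rule subspace_scale[OF E_space_subspace \<gamma>E])
      have dE: "q s - \<eta> \<in> E_space" by (rule subspace_diff[OF E_space_subspace qE \<eta>E])
      have "E_norm (q s) \<le> E_norm \<eta> + 1"
        using E_norm_add_le[OF dE \<eta>E] elim(2) by simp
      moreover have "E_norm (\<gamma> s) = \<bar>s\<bar> * E_norm (q s)"
        using s(1) E_norm_scale[OF qE, of s] by (simp add: q_def)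
      ultimately have "E_norm (\<gamma> s) \<le> \<bar>s\<bar> * (E_norm \<eta> + 1)" by (simp add: mult_left_mono)
      also have "\<dots> \<le> r * sqrt (lam 0)" using s(3) \<eta>0 by (simp add: field_simps)
      finally have "sqrt (lam 0) * norm (fst (\<gamma> s)) \<le> sqrt (lam 0) * r"
        using norm_fst_le_E_norm[OF \<gamma>E] by (simp add: mult.commute)
      then have "norm (fst (\<gamma> s)) \<le> r" using lam_pos[of 0] by simp
      then have "F (fst (\<gamma> s)) = - l *\<^sub>R fst (\<gamma> s)" by (rule near(2))
      moreover have "snd (\<gamma> s) = coeffs e (F (fst (\<gamma> s))) - A_ext lam e (fst (\<gamma> s))"
        using mem unfolding phase_def if_P[OF \<open>eps = 0\<close>] by auto
      ultimately have "snd (\<gamma> s) n = - l * (fst (\<gamma> s) \<bullet> e n) - lam n * (fst (\<gamma> s) \<bullet> e n)"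
        by (simp add: coeffs_def A_ext_def)
      then have "f (\<gamma> s) = 0" by (simp add: f_def algebra_simps)
      then have "f (q s) = 0"
      proof -
        have "f (q s) = inverse s * f (\<gamma> s)"
          by (simp add: f_def q_def scaleR_fun_def algebra_simps)
        then show ?thesis using \<open>f (\<gamma> s) = 0\<close> by simp
      qed
      then have "f (q s - \<eta>) = - f \<eta>" by (simp add: f_def inner_diff_left algebra_simps)
      then show ?case using f_le[OF dE] by simp
    qed
  qed
  have "\<bar>f \<eta>\<bar> \<le> A * 0"
    by (rule tendsto_lowerbound[OF tendsto_mult_left[OF q_lim] ev]) simp
  then show ?thesis by (simp add: f_def algebra_simps)
qed

text \<open>If all modes from \<open>k\<close> on decay faster than the slow space permits, then among the modes below \<open>k\<close> only one
direction each can be slow. The functionals that detect these \<open>k\<close> directions vanish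
on the fast eigenvectors \<open>(1, - fast_rate)\<close>; for \<open>eps = 0\<close> there is only one direction per mode, detected
by its first component.\<close>

lemma slow_modes_faster_than_splitting_impossible:
  assumes split: "equilibrium_dichotomy eps lam e F L V T Q DS Cp C \<theta> \<kappa> 0 (Suc k)"
    and near: "r > 0" "\<And>u. norm u \<le> r \<Longrightarrow> F u = - l *\<^sub>R u"
    and nonres: "\<And>n. 4 * eps * (lam n + l) \<noteq> 1"
    and c: "c \<ge> 0" "c > \<theta> - \<kappa>" "eps > 0 \<Longrightarrow> c \<le> 1 / (2 * eps)"
    and slow: "\<And>n. n \<ge> k \<Longrightarrow> 4 * eps * (lam n + l) \<le> 1 \<Longrightarrow> c \<le> slow_rate (lam n + l)"
  shows False
proof -
  interpret D: equilibrium_dichotomy eps lam e F L V T Q DS Cp C \<theta> \<kappa> 0 "Suc k" by (rule split)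
  have Q: "subspace Q" using D.direct by (auto simp: direct_sum_def)
  define nu where "nu n = lam n + l" for n
  have fast: "mode n x y \<in> Q" if "rate_mode (nu n) c' x y" "c' \<ge> c" for n c' x y
  proof (rule D.fast_mode_in_Q[OF linear_along_zero[OF near]])
    show "rate_mode (lam n - - l) c' x y" using that(1) by (simp add: nu_def)
  qed (use that c in auto)
  have rel: "snd \<eta> n = - nu n * (fst \<eta> \<bullet> e n)" if "eps = 0" "\<eta> \<in> V" for \<eta> n
    using parabolic_tangent_at_zero[OF near that(1)] that(2) by (simp add: D.V_eq nu_def)
  have complex: "mode n x y \<in> Q" if "eps > 0" "4 * eps * nu n > 1" for n x y
    using fast[OF rate_mode_complex[OF that]] c(3)[OF that(1)] by blast
  have fast_root: "mode n x (- fast_rate (nu n) * x) \<in> Q" if "eps > 0" "4 * eps * nu n \<le> 1" for n x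
    using fast[OF rate_mode_root[OF fast_rate_root[OF that(2,1)]]] fast_rate_ge[OF that(2,1)] c(3)[OF that(1)]
    by simp
  have slow_root: "mode n x (- slow_rate (nu n) * x) \<in> Q" if "n \<ge> k" "4 * eps * nu n \<le> 1" for n x
    using fast[OF rate_mode_root[OF slow_rate_root[OF that(2)]]] slow[OF that(1)] that(2)
    by (simp add: nu_def)
  define f where "f n \<zeta> = (if eps = 0 then fst \<zeta> \<bullet> e n else snd \<zeta> n + fast_rate (nu n) * (fst \<zeta> \<bullet> e n))"
    for n and \<zeta> :: "'a state"
  show False
  proof (rule D.too_many_fast_modes[OF refl, of f])
    show "linear (f n)" for n
      by (rule linearI) (auto simp: f_def inner_add_left scaleR_fun_def algebra_simps)
  next
    fix n \<eta> assume \<eta>: "\<eta> \<in> V" "n < k" "f n \<eta> = 0"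
    show "mode n (fst \<eta> \<bullet> e n) (snd \<eta> n) \<in> Q"
    proof (cases "eps = 0")
      case True
      then have "fst \<eta> \<bullet> e n = 0" "snd \<eta> n = 0" using \<eta> rel[OF True \<eta>(1)] by (simp_all add: f_def)
      moreover have "mode n 0 0 = 0" by (simp add: mode_zero_iff)
      ultimately show ?thesis using subspace_0[OF Q] by simp
    next
      case False
      then have eps: "eps > 0" using eps_nonneg by simp
      show ?thesis
      proof (cases "4 * eps * nu n \<le> 1")
        case True
        have "snd \<eta> n = - fast_rate (nu n) * (fst \<eta> \<bullet> e n)" using \<eta>(3) False by (simp add: f_def)
        then show ?thesis using fast_root[OF eps True] by simp
      qed (use complex[OF eps] in simp)
    qed
  next
    fix n \<eta> assume \<eta>: "\<eta> \<in> V" "n \<ge> k"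
    let ?x = "fst \<eta> \<bullet> e n" and ?y = "snd \<eta> n"
    show "mode n ?x ?y \<in> Q"
    proof (cases "eps = 0")
      case True
      have "slow_rate (nu n) = nu n" unfolding slow_rate_def using True by simp
      then show ?thesis using slow_root[OF \<eta>(2), of ?x] rel[OF True \<eta>(1), of n] True by simp
    next
      case False
      then have eps: "eps > 0" using eps_nonneg by simp
      consider "4 * eps * nu n < 1" | "4 * eps * nu n > 1" using nonres[of n] by (fastforce simp: nu_def)
      then show ?thesis
      proof cases
        case 1
        define \<rho> where "\<rho> = slow_rate (nu n)"
        define \<phi> where "\<phi> = fast_rate (nu n)"
        have "\<rho> < \<phi>"
        proof -
          define q where "q = sqrt (1 - 4 * eps * nu n)"
          have q: "q > 0" "q\<^sup>2 = 1 - 4 * eps * nu n" using 1 by (simp_all add: q_def)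
          have "(1 + q) * \<rho> = 2 * nu n" using q(1) by (simp add: \<rho>_def slow_rate_def q_def[symmetric])
          then have "2 * eps * ((1 + q) * \<rho>) = 4 * eps * nu n" by simp
          also have "\<dots> = (1 + q) * (1 - q)" using q(2) by (simp add: power2_eq_square algebra_simps)
          finally have "(1 + q) * (2 * eps * \<rho>) = (1 + q) * (1 - q)" by (metis mult.left_commute)
          then have "2 * eps * \<rho> = 1 - q" using q(1) by simp
          moreover have "2 * eps * \<phi> = 1 + q" using eps by (simp add: \<phi>_def fast_rate_def q_def)
          ultimately have "2 * eps * \<rho> < 2 * eps * \<phi>" using q(1) by simp
          then show ?thesis using eps by simp
        qed
        \<comment> \<open>the coordinates of the block in the basis of the slow and the fast eigenvector\<close>
        define x1 where "x1 = (?y + \<phi> * ?x) / (\<phi> - \<rho>)"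
        define x2 where "x2 = - (?y + \<rho> * ?x) / (\<phi> - \<rho>)"
        have "x1 + x2 = ?x" "- \<rho> * x1 + - \<phi> * x2 = ?y"
        proof -
          have "(\<phi> - \<rho>) * (x1 + x2) = (\<phi> - \<rho>) * ?x" "(\<phi> - \<rho>) * (- \<rho> * x1 + - \<phi> * x2) = (\<phi> - \<rho>) * ?y"
          proof -
            have "(\<phi> - \<rho>) * x1 = ?y + \<phi> * ?x" "(\<phi> - \<rho>) * x2 = - (?y + \<rho> * ?x)"
              using \<open>\<rho> < \<phi>\<close> by (simp_all add: x1_def x2_def)
            moreover have "(\<phi> - \<rho>) * (- \<rho> * x1 + - \<phi> * x2) = - \<rho> * ((\<phi> - \<rho>) * x1) - \<phi> * ((\<phi> - \<rho>) * x2)"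
              by (simp add: algebra_simps)
            ultimately show "(\<phi> - \<rho>) * (x1 + x2) = (\<phi> - \<rho>) * ?x" "(\<phi> - \<rho>) * (- \<rho> * x1 + - \<phi> * x2) = (\<phi> - \<rho>) * ?y"
              by (simp_all add: distrib_left, simp_all add: algebra_simps)
          qed
          then show "x1 + x2 = ?x" "- \<rho> * x1 + - \<phi> * x2 = ?y" using \<open>\<rho> < \<phi>\<close> by (simp_all only: mult_cancel_left) auto
        qed
        then have "mode n ?x ?y = mode n x1 (- \<rho> * x1) + mode n x2 (- \<phi> * x2)"
          by (simp only: mode_add[symmetric])
        moreover have "mode n x1 (- \<rho> * x1) \<in> Q" "mode n x2 (- \<phi> * x2) \<in> Q"
          unfolding \<rho>_def \<phi>_def using 1 by (intro slow_root fast_root \<eta> eps; simp)+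
        ultimately show ?thesis using subspace_add[OF Q] by simp
      qed (use complex[OF eps] in simp)
    qed
  qed
qed

theorem no_normally_hyperbolic_IM:
  assumes near: "r > 0" "\<And>u. norm u \<le> r \<Longrightarrow> F u = - l *\<^sub>R u" and l: "l > 0"
    and far: "\<And>N. \<exists>B. linear_along B 0 (lam 0) \<and> (\<forall>n. 1 \<le> n \<and> n \<le> N \<longrightarrow> linear_along B n (min l (lam n)))"
    and gap: "\<And>k. eps = 0 \<or> 1 / eps > 4 * lam k \<Longrightarrow> lam (Suc k) - lam k \<le> 2 * l"
    and nonres: "\<And>n. 4 * eps * (lam n + l) \<noteq> 1"
  shows "\<not> normally_hyperbolic_IM N M"
proof
  assume "normally_hyperbolic_IM N M"
  then obtain \<theta> \<kappa> where \<kappa>: "\<kappa> > 0" "\<kappa> < \<theta>" and split: "\<And>B n k. linear_along B n k \<Longrightarrow> splits_at \<theta> \<kappa> N B"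
    using normally_hyperbolic_splits by metis
  obtain B where B: "linear_along B 0 (lam 0)" "\<And>n. 1 \<le> n \<Longrightarrow> n \<le> N \<Longrightarrow> linear_along B n (min l (lam n))"
    using far[of N] by blast
  \<comment> \<open>the exponents of the linearisation at the distant equilibrium\<close>
  define ex where "ex n = (if n = 0 then 0 else max 0 (lam n - l))" for n
  have lin: "\<exists>k. linear_along B n k \<and> lam n - k = ex n" if "n \<le> N" for n
  proof (cases "n = 0")
    case False
    then have "linear_along B n (min l (lam n))" using B(2)[of n] that by simp
    then show ?thesis using False by (intro exI[of _ "min l (lam n)"]) (auto simp: ex_def)
  qed (use B(1) in \<open>auto simp: ex_def\<close>)
  have far_contra: False
    if real: "\<And>n. n \<le> N \<Longrightarrow> 4 * eps * ex n \<le> 1" and rate: "\<And>n. n \<le> N \<Longrightarrow> slow_rate (ex n) < \<theta> + \<kappa>"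
  proof -
    obtain V T Q DS Cp C where "equilibrium_dichotomy eps lam e F L V T Q DS Cp C \<theta> \<kappa> B N"
      using split[OF B(1)] unfolding splits_at_def by blast
    then interpret D: equilibrium_dichotomy eps lam e F L V T Q DS Cp C \<theta> \<kappa> B N .
    have "mode (0 + n) 1 (- slow_rate (ex n) * 1) \<in> T" if n: "n \<le> N" for n
    proof -
      obtain k where k: "linear_along B n k" "lam n - k = ex n" using lin[OF n] by blast
      have "rate_mode (lam n - k) (slow_rate (ex n)) 1 (- slow_rate (ex n) * 1)"
        using rate_mode_root[OF slow_rate_root[OF real[OF n]], of 1] k(2) by simp
      moreover have "slow_rate (ex n) \<ge> 0"
        by (rule slow_rate_nonneg[OF _ real[OF n]]) (simp add: ex_def)
      ultimately show ?thesis using D.slow_mode_in_T[OF k(1)] rate[OF n] by simp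
    qed
    then show False by (rule D.too_many_slow_modes)
  qed
  show False
  proof (cases N)
    case 0
    show False
      by (rule far_contra) (use 0 \<kappa> in \<open>auto simp: ex_def slow_rate_def\<close>)
  next
    case (Suc k)
    define \<alpha> where "\<alpha> = lam k + l"
    have \<alpha>: "\<alpha> > 0" using l lam_pos[of k] by (simp add: \<alpha>_def)
    obtain V T Q DS Cp C where D0: "equilibrium_dichotomy eps lam e F L V T Q DS Cp C \<theta> \<kappa> 0 (Suc k)"
      using split[OF linear_along_zero[OF near]] unfolding splits_at_def Suc by blast
    then interpret D0: equilibrium_dichotomy eps lam e F L V T Q DS Cp C \<theta> \<kappa> 0 "Suc k" .
    have mono4: "4 * eps * x \<le> 4 * eps * y" if "x \<le> y" for x y
      using that eps_nonneg by (simp add: mult_left_mono)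
    have \<alpha>_le: "\<alpha> \<le> lam n + l" if "n \<ge> k" for n
      using monoD[OF lam_mono that] by (simp add: \<alpha>_def)
    consider (real) "4 * eps * \<alpha> < 1" | (complex) "4 * eps * \<alpha> > 1"
      using nonres[of k] by (fastforce simp: \<alpha>_def)
    then show False
    proof cases
      case real
      have "slow_rate \<alpha> \<le> \<theta> - \<kappa>"
      proof (rule ccontr)
        assume "\<not> slow_rate \<alpha> \<le> \<theta> - \<kappa>"
        then show False
          using real \<alpha> by (intro slow_modes_faster_than_splitting_impossible[OF D0 near nonres, of "slow_rate \<alpha>"])
            (auto intro: slow_rate_nonneg slow_rate_le slow_rate_mono \<alpha>_le)
      qed
      have "eps = 0 \<or> 1 / eps > 4 * lam k"
      proof (cases "eps = 0")
        case False
        then have "eps > 0" using eps_nonneg by simp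
        moreover have "4 * eps * lam k < 1" using real mono4[of "lam k" \<alpha>] l by (simp add: \<alpha>_def)
        ultimately show ?thesis by (simp add: field_simps)
      qed simp
      from gap[OF this] have "lam N - l \<le> \<alpha>" by (simp add: Suc \<alpha>_def)
      then have ex_le: "ex n \<le> \<alpha>" if "n \<le> N" for n
        using monoD[OF lam_mono that] \<alpha> by (auto simp: ex_def)
      show False
      proof (rule far_contra)
        fix n assume n: "n \<le> N"
        show "4 * eps * ex n \<le> 1" using mono4[OF ex_le[OF n]] real by simp
        have "slow_rate (ex n) \<le> slow_rate \<alpha>"
          by (rule slow_rate_mono[OF _ ex_le[OF n]]) (use real in \<open>auto simp: ex_def\<close>)
        then show "slow_rate (ex n) < \<theta> + \<kappa>" using \<open>slow_rate \<alpha> \<le> \<theta> - \<kappa>\<close> \<kappa>(1) by linarith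
      qed
    next
      case complex
      then have eps: "eps > 0" using eps_nonneg \<alpha> by (cases "eps = 0") auto
      have complex_n: "4 * eps * (lam n + l) > 1" if "n \<ge> k" for n
        using complex mono4[OF \<alpha>_le[OF that]] by simp
      show False
      proof (cases "1 / (2 * eps) < \<theta> + \<kappa>")
        case True
        have "mode (k + n) 1 0 \<in> T" for n
        proof (rule D0.slow_mode_in_T[OF linear_along_zero[OF near] _ _ True])
          show "rate_mode (lam (k + n) - - l) (1 / (2 * eps)) 1 0"
            using rate_mode_complex[OF eps complex_n[of "k + n"]] by simp
          show "0 \<le> 1 / (2 * eps)" using eps by simp
        qed
        then show False by (rule D0.too_many_slow_modes)
      next
        case False
        then show False
          using eps \<kappa>(1) complex_n
          by (intro slow_modes_faster_than_splitting_impossible[OF D0 near nonres, of "1 / (2 * eps)"]) (auto simp: not_le[symmetric])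
      qed
    qed
  qed
qed

end

section \<open>The theorem\<close>

theorem theorem4p7:
  fixes domA :: "'a::{real_inner, complete_space} set"
    and A :: "'a \<Rightarrow> 'a"
    and lam :: "nat \<Rightarrow> real"
    and e :: "nat \<Rightarrow> 'a"
    and L eps :: real
  assumes "self_adjoint_op domA A" and "positive_op domA A" and "compact_inverse domA A"
    and "eigenbasis domA A lam e"
    and "L > 0" and "eps \<ge> 0"
    and "(SUP k\<in>{k. enat (Suc k) \<le> n_cr eps lam}. ereal (lam (Suc k) - lam k)) < ereal (2 * L)"
    and "L > lam 0"
  shows "\<exists>F :: 'a \<Rightarrow> 'a. smooth_map F \<and> F 0 = 0 \<and> L-lipschitz_on UNIV F \<and>
           \<not> (\<exists>N M. damped_wave.normally_hyperbolic_IM eps lam e F N M)"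
proof -
  have orth: "e m \<bullet> e n = (if m = n then 1 else 0)" for m n
    using assms(4) by (simp add: eigenbasis_def)
  have basis: "hilbert_basis e"
    using assms(4) by unfold_locales (simp_all add: eigenbasis_def)
  have lam_pos: "lam n > 0" for n
  proof -
    have "e n \<in> domA" "A (e n) = lam n *\<^sub>R e n" using assms(4) by (auto simp: eigenbasis_def)
    moreover have "e n \<noteq> 0" using orth[of n n] by auto
    ultimately show ?thesis using assms(2) orth[of n n] by (force simp: positive_op_def)
  qed
  have lam_mono: "mono lam" using assms(4) by (simp add: eigenbasis_def)
  obtain g where g: "(SUP k\<in>{k. enat (Suc k) \<le> n_cr eps lam}. ereal (lam (Suc k) - lam k)) < ereal g" "g < 2 * L"
    using ereal_dense2[OF assms(7)] by auto
  \<comment> \<open>the slope has to avoid countably many values, for which a linearised mode would have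
    a Jordan block\<close>
  have "uncountable {max 0 (g / 2)<..<L}"
    using assms(5) g(2) by (simp add: uncountable_open_interval)
  then have "\<not> {max 0 (g / 2)<..<L} \<subseteq> range (\<lambda>n. 1 / (4 * eps) - lam n)"
    by (meson countable_image countable_subset uncountable_def countableI_type)
  then obtain l where l_range: "l \<in> {max 0 (g / 2)<..<L}" and l_avoids: "l \<notin> range (\<lambda>n. 1 / (4 * eps) - lam n)"
    by blast
  have l: "0 < l" "g / 2 < l" "l < L" using l_range by auto
  have nonresonant: "4 * eps * (lam n + l) \<noteq> 1" for n
  proof
    assume *: "4 * eps * (lam n + l) = 1"
    then have "eps \<noteq> 0" by auto
    with * have "l = 1 / (4 * eps) - lam n" by (simp add: field_simps)
    then show False using l_avoids by blast
  qed
  have gap: "lam (Suc k) - lam k \<le> 2 * l" if "eps = 0 \<or> 1 / eps > 4 * lam k" for k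
  proof -
    have "enat (Suc k) \<le> n_cr eps lam" unfolding n_cr_def using that by (intro Sup_upper) blast
    then have "ereal (lam (Suc k) - lam k) \<le> (SUP k\<in>{k. enat (Suc k) \<le> n_cr eps lam}. ereal (lam (Suc k) - lam k))"
      by (intro SUP_upper) simp
    then have "ereal (lam (Suc k) - lam k) < ereal g" using g(1) by (rule le_less_trans)
    then show ?thesis using l(2) by simp
  qed
  \<comment> \<open>the first component gets half of the available margin, the influence of the first coordinate on the
    others, measured by \<open>h\<close>, gets all that is left of \<open>L\<^sup>2\<close>\<close>
  define \<delta> where "\<delta> = (L - max l (lam 0)) / 2"
  define M where "M = max l (lam 0) + \<delta>"
  define h where "h = sqrt ((L\<^sup>2 - M\<^sup>2) / 2) / l"
  have \<delta>: "\<delta> > 0" using l(3) assms(8) by (simp add: \<delta>_def)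
  have M: "0 < M" "M < L" using l(1,3) assms(8) by (simp_all add: M_def \<delta>_def field_simps)
  have M2: "M\<^sup>2 < L\<^sup>2" using M by (intro power_strict_mono) auto
  have h: "h > 0" using M2 l(1) by (simp add: h_def)
  have h2: "M\<^sup>2 + 2 * l\<^sup>2 * h\<^sup>2 = L\<^sup>2"
  proof -
    have "l * h = sqrt ((L\<^sup>2 - M\<^sup>2) / 2)" using l(1) by (simp add: h_def)
    then have "(l * h)\<^sup>2 = (L\<^sup>2 - M\<^sup>2) / 2" using M2 by simp
    then show ?thesis by (simp add: power_mult_distrib)
  qed
  obtain D c where D: "derivs D" "\<And>x. \<bar>x\<bar> \<le> 1 \<Longrightarrow> D 0 x = x" "\<And>x. D 0 (- x) = - D 0 x"
    "\<And>x. x \<ge> 2 \<Longrightarrow> D 0 x = c" "\<And>x. 0 \<le> D (Suc 0) x" "\<And>x. D (Suc 0) x \<le> 1"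
    "\<And>k. \<exists>K. \<forall>x. \<bar>D (Suc k) x\<bar> \<le> K"
    by (rule smooth_truncation) (rule that)
  interpret NL: nonlinearity e lam D l \<delta> h c
    by (intro nonlinearity.intro basis nonlinearity_axioms.intro lam_pos l(1) \<delta> h D)
  have lip: "L-lipschitz_on UNIV NL.F"
    using h2 assms(5) by (intro NL.lipschitz_F[of M]) (auto simp: M_def)
  interpret W: wave eps lam e NL.F L
    by (intro wave.intro basis wave_axioms.intro lam_pos lam_mono assms(6) lip)
  have far: "\<exists>B. W.linear_along B 0 (lam 0) \<and> (\<forall>n. 1 \<le> n \<and> n \<le> N \<longrightarrow> W.linear_along B n (min l (lam n)))" for N
  proof -
    obtain B where B: "\<forall>n\<le>N. \<forall>y. \<bar>y\<bar> \<le> 1 \<longrightarrow> NL.F (B *\<^sub>R e 0 + y *\<^sub>R e n) = (lam 0 * B) *\<^sub>R e 0 + (NL.diag n * y) *\<^sub>R e n"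
      using NL.F_far by blast
    have lin: "W.linear_along B n (NL.diag n)" if "n \<le> N" for n
      unfolding W.linear_along_def using B that by (intro exI[of _ 1]) auto
    have "W.linear_along B 0 (lam 0)" using lin[of 0] by (simp add: NL.diag_def)
    moreover have "W.linear_along B n (min l (lam n))" if "1 \<le> n \<and> n \<le> N" for n
      using lin[of n] that by (simp add: NL.diag_def)
    ultimately show ?thesis by blast
  qed
  have "\<not> W.normally_hyperbolic_IM N M'" for N M'
  proof (rule W.no_normally_hyperbolic_IM[OF _ NL.F_near_zero l(1) far gap nonresonant])
    show "0 < 1 / (1 + h)" using h by simp
  qed
  moreover have "NL.F 0 = 0" using NL.F_near_zero[of 0] h by simp
  ultimately show ?thesis using NL.smooth_F lip by blast
qed

end
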